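(* Every function $u:\mathcal{G}_0\to\mathbb{R}$ which is 1-Lipschitz, i.e. $|u(g)-u(h)|\le\|g-h\|_{L^2}$ for all $g,h\in\mathcal{G}_0$, belongs to $\mathrm{Dom}(\mathbb{E})$ and satisfies $\Gamma(u,u)\le1$ $\mathbb{Q}_0^\beta$-a.e. on $\mathcal{G}_0$.
   Context: $\mathcal{G}_0$ is the set of right continuous nondecreasing maps $g:[0,1[\,\to[0,1]$ extended by $g(1):=1$, with $\|g-h\|_{L^2}=(\int_0^1|g-h|^2dt)^{1/2}$. Fix $\beta>0$; $\mathbb{Q}_0^\beta$ is the probability measure on $\mathcal{G}_0$ such that for every $N$ and $0=t_0<\dots<t_{N+1}=1$ the law of $(g(t_1),\dots,g(t_N))$ is $\frac{\Gamma(\beta)}{\prod_{i=0}^{N}\Gamma(\beta(t_{i+1}-t_i))}\prod_{i=0}^{N}(x_{i+1}-x_i)^{\beta(t_{i+1}-t_i)-1}dx$ on $\{0<x_1<\dots<x_N<1\}$, $x_0:=0,x_{N+1}:=1$. For $u(g)=U(\int_0^1\vec\alpha(g_s)ds)$ with $U\in\mathcal{C}^1(\mathbb{R}^m)$, $\vec\alpha\in\mathcal{C}^1([0,1],\mathbb{R}^m)$ (class $\mathfrak{Z}^1(\mathcal{G}_0)$), $\mathbb{D}u(g)=\sum_i\partial_iU(\int\vec\alpha(g_s)ds)\alpha_i'(g(\cdot))\in L^2([0,1])$. $(\mathbb{E},\mathrm{Dom}(\mathbb{E}))$ is the closure in $L^2(\mathcal{G}_0,\mathbb{Q}_0^\beta)$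 of $\mathbb{E}(u,v)=\int\langle\mathbb{D}u,\mathbb{D}v\rangle_{L^2}d\mathbb{Q}_0^\beta$ on $\mathfrak{Z}^1(\mathcal{G}_0)$, $\overline{\mathbb{D}}$ the closure of $\mathbb{D}$ (so $\mathrm{Dom}(\mathbb{E})=\mathrm{Dom}(\overline{\mathbb{D}})$), and $\Gamma(u,u):=\|\overline{\mathbb{D}}u\|^2_{L^2([0,1])}$. *)

theory Defs
  imports "HOL-Analysis.Analysis" "HOL-Probability.Probability"
begin

text \<open>The space G_0: right continuous nondecreasing g on [0,1[ with values in [0,1],
  extended by g(1) = 1. Values outside [0,1] are normalised to 0 (canonical representative).\<close>
definition G0 :: "(real \<Rightarrow> real) set" where
  "G0 = {g. mono_on {0..<1} g
          \<and> (\<forall>t\<in>{0..<1}. continuous (at_right t) g)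
          \<and> (\<forall>t\<in>{0..<1}. g t \<in> {0..1})
          \<and> g 1 = 1
          \<and> (\<forall>t. t \<notin> {0..1} \<longrightarrow> g t = 0)}"

definition dL2 :: "(real \<Rightarrow> real) \<Rightarrow> (real \<Rightarrow> real) \<Rightarrow> real" where
  "dL2 g h = sqrt (LINT t:{0..1}|lborel. (g t - h t)\<^sup>2)"

definition G0_sets :: "(real \<Rightarrow> real) set set" where
  "G0_sets = sigma_sets G0 {{g \<in> G0. g t \<in> A} | t A. t \<in> {0..1} \<and> A \<in> sets borel}"

definition ext_pt :: "nat \<Rightarrow> (nat \<Rightarrow> real) \<Rightarrow> nat \<Rightarrow> real" where
  "ext_pt N x i = (if i = 0 then 0 else if i = N + 1 then 1 else x i)"

definition dir_simplex :: "nat \<Rightarrow> (nat \<Rightarrow> real) set" where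
  "dir_simplex N = {x. \<forall>i\<in>{0..N}. ext_pt N x i < ext_pt N x (i + 1)}"

definition dir_density :: "real \<Rightarrow> nat \<Rightarrow> (nat \<Rightarrow> real) \<Rightarrow> (nat \<Rightarrow> real) \<Rightarrow> real" where
  "dir_density \<beta> N t x =
     Gamma \<beta> / (\<Prod>i\<in>{0..N}. Gamma (\<beta> * (t (i + 1) - t i)))
     * (\<Prod>i\<in>{0..N}. (ext_pt N x (i + 1) - ext_pt N x i) powr (\<beta> * (t (i + 1) - t i) - 1))"

definition is_Q0 :: "real \<Rightarrow> (real \<Rightarrow> real) measure \<Rightarrow> bool" where
  "is_Q0 \<beta> Q \<longleftrightarrow> prob_space Q \<and> space Q = G0 \<and> sets Q = G0_sets \<and>
     (\<forall>N t. N \<ge> 1 \<and> t 0 = 0 \<and> t (N + 1) = 1 \<and> (\<forall>i\<in>{0..N}. t i < t (i + 1)) \<longrightarrow>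
        distr Q (PiM {1..N} (\<lambda>_. lborel)) (\<lambda>g. \<lambda>i\<in>{1..N}. g (t i))
        = density (PiM {1..N} (\<lambda>_. lborel))
            (\<lambda>x. indicator (dir_simplex N) x * ennreal (dir_density \<beta> N t x)))"

text \<open>C^1 maps U : R^m \<rightarrow> R (vectors of R^m are nat \<Rightarrow> real, only coordinates < m matter),
  with partial derivatives D i which are continuous.\<close>
definition C1_Rm :: "nat \<Rightarrow> ((nat \<Rightarrow> real) \<Rightarrow> real) \<Rightarrow> (nat \<Rightarrow> (nat \<Rightarrow> real) \<Rightarrow> real) \<Rightarrow> bool" where
  "C1_Rm m U D \<longleftrightarrow> (\<forall>x. U x = U (\<lambda>j. if j < m then x j else 0)) \<and>
     (\<forall>i<m. \<forall>x. ((\<lambda>h. U (x(i := h))) has_real_derivative D i x) (at (x i))) \<and>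
     (\<forall>i<m. continuous_on UNIV (D i))"

definition C1_01 :: "nat \<Rightarrow> (nat \<Rightarrow> real \<Rightarrow> real) \<Rightarrow> (nat \<Rightarrow> real \<Rightarrow> real) \<Rightarrow> bool" where
  "C1_01 m \<alpha> \<alpha>' \<longleftrightarrow> (\<forall>i<m. (\<forall>s\<in>{0..1}. (\<alpha> i has_real_derivative \<alpha>' i s) (at s within {0..1}))
                          \<and> continuous_on {0..1} (\<alpha>' i))"

definition avec :: "nat \<Rightarrow> (nat \<Rightarrow> real \<Rightarrow> real) \<Rightarrow> (real \<Rightarrow> real) \<Rightarrow> nat \<Rightarrow> real" where
  "avec m \<alpha> g = (\<lambda>j. if j < m then (LINT s:{0..1}|lborel. \<alpha> j (g s)) else 0)"

text \<open>Graph of the gradient D on the class Z^1(G_0): pairs (u, Du), Du g being a function on [0,1].\<close>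
definition Z1_graph :: "(((real \<Rightarrow> real) \<Rightarrow> real) \<times> ((real \<Rightarrow> real) \<Rightarrow> real \<Rightarrow> real)) set" where
  "Z1_graph = {(u, Du). \<exists>m U D \<alpha> \<alpha>'. C1_Rm m U D \<and> C1_01 m \<alpha> \<alpha>' \<and>
      u = (\<lambda>g. U (avec m \<alpha> g)) \<and>
      Du = (\<lambda>g t. \<Sum>i<m. D i (avec m \<alpha> g) * \<alpha>' i (g t))}"

text \<open>Graph of the closure of D in L^2(G_0,Q) \<times> L^2(G_0,Q;L^2([0,1])).\<close>
definition closure_graph :: "(real \<Rightarrow> real) measure \<Rightarrow>
    (((real \<Rightarrow> real) \<Rightarrow> real) \<times> ((real \<Rightarrow> real) \<Rightarrow> real \<Rightarrow> real)) set" where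
  "closure_graph Q = {(u, G). u \<in> borel_measurable Q \<and>
      (\<lambda>(g, t). G g t) \<in> borel_measurable (Q \<Otimes>\<^sub>M lborel) \<and>
      (\<exists>un Gn. (\<forall>n. (un n, Gn n) \<in> Z1_graph) \<and>
         ((\<lambda>n. \<integral>\<^sup>+ g. ennreal ((un n g - u g)\<^sup>2) \<partial>Q) \<longlonglongrightarrow> 0) \<and>
         ((\<lambda>n. \<integral>\<^sup>+ g. (\<integral>\<^sup>+ t. ennreal ((Gn n g t - G g t)\<^sup>2) * indicator {0..1} t \<partial>lborel) \<partial>Q)
            \<longlonglongrightarrow> 0))}"

definition DomE :: "(real \<Rightarrow> real) measure \<Rightarrow> ((real \<Rightarrow> real) \<Rightarrow> real) set" where
  "DomE Q = {u. \<exists>G. (u, G) \<in> closure_graph Q}"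

end

theory Submission
  imports Defs
begin

text \<open>Closability. Fix \<open>0 < t < 1\<close> and write \<open>\<theta> = g t\<close>. Under the Dirichlet law, \<open>\<theta>\<close> is independent of
  the two rescaled pieces of \<open>g\<close> on either side of \<open>t\<close>, so replacing \<open>\<theta>\<close> by an independent copy
  preserves \<open>Q\<close>. Along each fibre, which is a segment parametrised by \<open>\<theta>\<close>, the derivative of a cylinder
  function \<open>f\<close> is the pairing of its gradient with a tent-shaped function depending on \<open>t\<close>, and the law of
  \<open>\<theta>\<close> is equivalent to Lebesgue measure. Hence one-dimensional closability shows that an \<open>L\<^sup>1\<close> limit \<open>H\<close> of gradients
  of a null sequence is orthogonal to the tents of all rational \<open>t\<close>. Since \<open>g\<close> is almost surely
  strictly increasing, this forces \<open>H = 0\<close>, so the gradient in the closure is unique.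

  Approximation. An \<open>L\<^sup>2\<close>-Lipschitz function is the limit of finite maxima of minima of affine functions
  that interpolate it at pairs of points of a dense sequence and have slope at most 1. A linear
  functional \<open>g \<mapsto> \<integral>g v\<close> is a limit of cylinder functions because \<open>\<integral>g v = \<integral>V (|{g \<le> x}|) dx\<close> with
  \<open>V m = \<integral>v\<close> over \<open>[m,1]\<close>. Gradients of norm at most 1 (in the limit) are kept by smoothed maxima, and
  nearly energy-minimal approximations have gradients that are Cauchy in \<open>L\<^sup>2\<close>.\<close>

section \<open>Functions with continuous partial derivatives\<close>

text \<open>The bound concerns every gradient that the closure relates to \<open>u\<close>, and even
  a cylinder function has many representations, so one good gradient does not suffice until
  uniqueness is known. Uniqueness is reached without integration by parts: the one-point density may
  blow up or vanish at 0 and 1, according to the signs of its exponents, but closability on a line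
  asks only for a lower bound on compact subintervals of (0,1).

  Two obstacles shape the approximation. Cylinder gradients for a linear functional are controlled
  only in the limit and for strictly increasing g, so the constraint "norm at most 1" is relaxed by
  an excess that is small in L1. And the closure demands strong convergence of gradients, whereas a
  norm bound alone gives weak compactness; the admissible approximations are stable under midpoints,
  so the parallelogram law makes near-minimisers of the energy Cauchy.

  The Lipschitz constant 1 enters through Hilbert space geometry: values a, b prescribed at h1, h2
  are interpolated by an affine function of slope |a - b| / |h1 - h2|.\<close>

lemma tendsto_coordinatewise:
  fixes f :: "'b \<Rightarrow> 'a \<Rightarrow> 'c::topological_space"
  assumes "\<And>i. ((\<lambda>x. f x i) \<longlongrightarrow> l i) F"
  shows "(f \<longlongrightarrow> l) F"
proof -
  have "limitin (product_topology (\<lambda>i. euclidean) UNIV) f l F"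
    using assms by (subst limitin_componentwise) (auto simp: limitin_canonical_iff)
  then show ?thesis
    by (simp add: euclidean_product_topology limitin_canonical_iff)
qed

lemma mean_value_between:
  fixes f :: "real \<Rightarrow> real"
  assumes "\<And>x. (f has_real_derivative f' x) (at x)"
  shows "\<exists>c. f b - f a = f' c * (b - a) \<and> \<bar>c - a\<bar> \<le> \<bar>b - a\<bar>"
proof (cases a b rule: linorder_cases)
  case less
  then obtain c where "a < c" "c < b" "f b - f a = (b - a) * f' c"
    using MVT2[of a b f f'] assms by blast
  then show ?thesis by (intro exI[of _ c]) (auto simp: mult.commute)
next
  case greater
  then obtain c where "b < c" "c < a" "f a - f b = (a - b) * f' c"
    using MVT2[of b a f f'] assms by blast
  then show ?thesis by (intro exI[of _ c]) (auto simp: algebra_simps)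
qed (auto intro!: exI[of _ a])

text \<open>\<open>C1_Rm\<close> supplies partial derivatives only, so the increment is recovered by
  changing one coordinate at a time and applying the mean value theorem to each change. The
  intermediate points \<open>\<xi> x y i\<close> are coordinatewise no farther from \<open>x\<close>
  than \<open>y\<close> is, so they tend to \<open>x\<close> with \<open>y\<close>; they are chosen
  once for all pairs so that limits can be taken.\<close>

lemma C1_Rm_increment:
  assumes U: "C1_Rm m U D"
  shows "\<exists>\<xi>. (\<forall>x y. U y - U x = (\<Sum>i<m. D i (\<xi> x y i) * (y i - x i)) \<and>
    (\<forall>i j. \<bar>\<xi> x y i j - x j\<bar> \<le> \<bar>y j - x j\<bar>))"
proof -
  \<comment> \<open>Hybrid point: the first \<open>k\<close> coordinates come from \<open>y\<close>,
    the others from \<open>x\<close>. Thus \<open>z 0\<close> is \<open>x\<close>, and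
    \<open>z m\<close> agrees with \<open>y\<close> on all coordinates that \<open>U\<close>
    sees.\<close>
  define z where "z = (\<lambda>k (x::nat \<Rightarrow> real) (y::nat \<Rightarrow> real) j. if j < k then y j else x j)"
  have ex: "\<exists>w. (i < m \<longrightarrow> U (z (Suc i) x y) - U (z i x y) = D i w * (y i - x i)) \<and>
    (\<forall>j. \<bar>w j - x j\<bar> \<le> \<bar>y j - x j\<bar>)" for x y i
  proof (cases "i < m")
    case True
    have "((\<lambda>h. U ((z i x y)(i := h))) has_real_derivative D i ((z i x y)(i := h))) (at h)" for h
    proof -
      have "((\<lambda>h. U (w(i := h))) has_real_derivative D i w) (at (w i))" for w
        using U True unfolding C1_Rm_def by blast
      from this[of "(z i x y)(i := h)"] show ?thesis by simp
    qed
    from mean_value_between[where f="\<lambda>h. U ((z i x y)(i := h))", OF this]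
    obtain c where c: "U ((z i x y)(i := y i)) - U ((z i x y)(i := x i))
        = D i ((z i x y)(i := c)) * (y i - x i)" "\<bar>c - x i\<bar> \<le> \<bar>y i - x i\<bar>"
      by blast
    have "(z i x y)(i := y i) = z (Suc i) x y" "(z i x y)(i := x i) = z i x y"
      by (auto simp: z_def fun_eq_iff)
    with c show ?thesis
      by (intro exI[of _ "(z i x y)(i := c)"]) (auto simp: z_def)
  qed (auto intro!: exI[of _ x])
  define \<xi> where "\<xi> = (\<lambda>x y i. SOME w. (i < m \<longrightarrow> U (z (Suc i) x y) - U (z i x y) = D i w * (y i - x i)) \<and>
    (\<forall>j. \<bar>w j - x j\<bar> \<le> \<bar>y j - x j\<bar>))"
  have \<xi>: "i < m \<Longrightarrow> U (z (Suc i) x y) - U (z i x y) = D i (\<xi> x y i) * (y i - x i)"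
      "\<bar>\<xi> x y i j - x j\<bar> \<le> \<bar>y j - x j\<bar>" for x y i j
    using someI_ex[OF ex[of i x y]] unfolding \<xi>_def by blast+
  have "U y - U x = (\<Sum>i<m. D i (\<xi> x y i) * (y i - x i))" for x y
  proof -
    have restr: "U w = U (\<lambda>j. if j < m then w j else 0)" for w
      using U unfolding C1_Rm_def by blast
    have "(\<lambda>j. if j < m then z m x y j else 0) = (\<lambda>j. if j < m then y j else 0)"
      by (auto simp: z_def)
    then have "U (z m x y) = U y"
      using restr[of "z m x y"] restr[of y] by simp
    moreover have "z 0 x y = x" by (auto simp: z_def)
    moreover have "(\<Sum>i<m. D i (\<xi> x y i) * (y i - x i)) = (\<Sum>i<m. U (z (Suc i) x y) - U (z i x y))"
      using \<xi> by auto
    ultimately show ?thesis using sum_lessThan_telescope[of "\<lambda>k. U (z k x y)" m] by simp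
  qed
  with \<xi>(2) show ?thesis by blast
qed

lemma C1_Rm_partial_tendsto:
  assumes "C1_Rm m U D" "i < m" "(y \<longlongrightarrow> x) F"
  shows "((\<lambda>t. D i (y t)) \<longlongrightarrow> D i x) F"
proof -
  have "isCont (D i) x"
    using assms(1,2) by (auto simp: C1_Rm_def continuous_on_eq_continuous_at)
  then show ?thesis by (rule isCont_tendsto_compose[OF _ assms(3)])
qed

lemma tendsto_squeeze_coordinates:
  fixes \<xi> y :: "'b \<Rightarrow> 'a \<Rightarrow> real"
  assumes "\<And>j. ((\<lambda>t. y t j) \<longlongrightarrow> x j) F" "\<And>t j. \<bar>\<xi> t j - x j\<bar> \<le> \<bar>y t j - x j\<bar>"
  shows "(\<xi> \<longlongrightarrow> x) F"
proof (rule tendsto_coordinatewise)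
  fix j
  have "((\<lambda>t. y t j - x j) \<longlongrightarrow> 0) F" using assms(1)[of j] by (simp add: LIM_zero)
  then have "((\<lambda>t. \<xi> t j - x j) \<longlongrightarrow> 0) F"
    by (rule Lim_null_comparison[rotated, OF tendsto_rabs_zero])
       (use assms(2) in auto)
  then show "((\<lambda>t. \<xi> t j) \<longlongrightarrow> x j) F" by (simp add: LIM_zero_iff)
qed

text \<open>Truncation to the first \<open>m\<close> coordinates leaves \<open>U\<close> unchanged
  and turns the hypothesis into convergence in the full product topology, where the partial
  derivatives are continuous.\<close>

lemma C1_Rm_tendsto:
  assumes U: "C1_Rm m U D" and y: "\<And>j. j < m \<Longrightarrow> ((\<lambda>t. y t j) \<longlongrightarrow> x j) F"
  shows "((\<lambda>t. U (y t)) \<longlongrightarrow> U x) F"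
proof -
  define y' x' where "y' = (\<lambda>t j. if j < m then y t j else 0)" and "x' = (\<lambda>j. if j < m then x j else 0)"
  have y': "((\<lambda>t. y' t j) \<longlongrightarrow> x' j) F" for j
    using y by (auto simp: y'_def x'_def)
  have restr: "U w = U (\<lambda>j. if j < m then w j else 0)" for w
    using U unfolding C1_Rm_def by blast
  have eq: "(\<lambda>t. U (y t)) = (\<lambda>t. U (y' t))" "U x = U x'"
    using restr[of x] restr[of "y _"] by (simp_all add: y'_def x'_def fun_eq_iff)
  obtain \<xi> where \<xi>: "\<And>x y. U y - U x = (\<Sum>i<m. D i (\<xi> x y i) * (y i - x i))"
    "\<And>x y i j. \<bar>\<xi> x y i j - x j\<bar> \<le> \<bar>y j - x j\<bar>"
    using C1_Rm_increment[OF U] by blast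
  have D: "((\<lambda>t. D i (\<xi> x' (y' t) i)) \<longlongrightarrow> D i x') F" if "i < m" for i
    by (intro C1_Rm_partial_tendsto[OF U that] tendsto_squeeze_coordinates[OF y' \<xi>(2)])
  have "((\<lambda>t. \<Sum>i<m. D i (\<xi> x' (y' t) i) * (y' t i - x' i)) \<longlongrightarrow> (\<Sum>i<m. D i x' * (x' i - x' i))) F"
    by (intro tendsto_intros D y') auto
  then have "((\<lambda>t. U (y' t) - U x') \<longlongrightarrow> 0) F"
    by (simp add: \<xi>(1))
  then show ?thesis unfolding eq by (simp add: LIM_zero_iff)
qed

lemma C1_Rm_continuous:
  assumes U: "C1_Rm m U D"
  shows "continuous_on UNIV U"
  unfolding continuous_on_def
proof
  fix x :: "nat \<Rightarrow> real"
  have "continuous_on UNIV (\<lambda>x::nat \<Rightarrow> real. x i)" for i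
    by (rule continuous_on_product_coordinates)
  then have "((\<lambda>x::nat \<Rightarrow> real. x i) \<longlongrightarrow> x i) (at x within UNIV)" for i
    by (simp add: continuous_on_def)
  then show "(U \<longlongrightarrow> U x) (at x within UNIV)" by (rule C1_Rm_tendsto[OF U])
qed

text \<open>The increment formula divided by \<open>s - t\<close>. That \<open>a\<close> vanishes
  from coordinate \<open>m\<close> on makes \<open>a s\<close> tend to \<open>a t\<close> in the
  product topology, to which the continuity of \<open>D i\<close> refers.\<close>

lemma C1_Rm_chain:
  fixes a :: "real \<Rightarrow> nat \<Rightarrow> real"
  assumes U: "C1_Rm m U D" and a: "\<And>i. i < m \<Longrightarrow> ((\<lambda>t. a t i) has_real_derivative a' i) (at t)"
    and a0: "\<And>i s. i \<ge> m \<Longrightarrow> a s i = 0"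
  shows "((\<lambda>t. U (a t)) has_real_derivative (\<Sum>i<m. D i (a t) * a' i)) (at t)"
proof -
  obtain \<xi> where \<xi>: "\<And>x y. U y - U x = (\<Sum>i<m. D i (\<xi> x y i) * (y i - x i))"
    "\<And>x y i j. \<bar>\<xi> x y i j - x j\<bar> \<le> \<bar>y j - x j\<bar>"
    using C1_Rm_increment[OF U] by blast
  have c: "((\<lambda>s. a s j) \<longlongrightarrow> a t j) (at t)" for j
  proof (cases "j < m")
    case True then show ?thesis using DERIV_isCont[OF a[OF True]] by (simp add: isCont_def)
  next
    case False then show ?thesis using a0 by simp
  qed
  have D: "((\<lambda>s. D i (\<xi> (a t) (a s) i)) \<longlongrightarrow> D i (a t)) (at t)" if "i < m" for i
    by (intro C1_Rm_partial_tendsto[OF U that] tendsto_squeeze_coordinates[OF c \<xi>(2)])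
  have "((\<lambda>s. \<Sum>i<m. D i (\<xi> (a t) (a s) i) * ((a s i - a t i) / (s - t))) \<longlongrightarrow> (\<Sum>i<m. D i (a t) * a' i)) (at t)"
    by (intro tendsto_intros D) (use a in \<open>auto simp: has_field_derivative_iff\<close>)
  then show ?thesis
    unfolding has_field_derivative_iff \<xi>(1) sum_divide_distrib by simp
qed

section \<open>Measurability on the space of monotone functions\<close>

text \<open>A probability measure on the whole line rather than on a restricted space: measurability
  is then plain Borel measurability, and product measures and dominated convergence with constant
  bounds apply directly.\<close>

definition unit_leb :: "real measure" where
  "unit_leb = density lborel (\<lambda>t. ennreal (indicator {0..1} t))"

lemma sets_unit_leb [simp, measurable_cong]: "sets unit_leb = sets borel"
  and space_unit_leb [simp]: "space unit_leb = UNIV"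
  by (simp_all add: unit_leb_def)

lemma nn_integral_unit_leb:
  assumes "f \<in> borel_measurable borel"
  shows "(\<integral>\<^sup>+ t. f t \<partial>unit_leb) = (\<integral>\<^sup>+ t. f t * indicator {0..1} t \<partial>lborel)"
  using assms unfolding unit_leb_def
  by (subst nn_integral_density) (auto simp: mult.commute ennreal_indicator)

lemma LINT_unit_leb:
  fixes f :: "real \<Rightarrow> real"
  assumes "f \<in> borel_measurable borel"
  shows "(LINT t:{0..1}|lborel. f t) = (\<integral> t. f t \<partial>unit_leb)"
  using assms unfolding unit_leb_def set_lebesgue_integral_def
  by (subst integral_density) auto

lemma prob_space_unit_leb: "prob_space unit_leb"
proof
  have "emeasure unit_leb UNIV = (\<integral>\<^sup>+ t. 1 \<partial>unit_leb)" by simp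
  also have "\<dots> = 1" by (subst nn_integral_unit_leb) auto
  finally show "emeasure unit_leb (space unit_leb) = 1" by simp
qed

interpretation unit_leb: prob_space unit_leb by (rule prob_space_unit_leb)

lemma AE_unit_leb: "(AE t in unit_leb. P t) \<longleftrightarrow> (AE t in lborel. t \<in> {0..1} \<longrightarrow> P t)"
  unfolding unit_leb_def by (subst AE_density) (auto simp: indicator_def)

lemma AE_unit_leb_I: "(\<And>t. t \<in> {0<..<1} \<Longrightarrow> P t) \<Longrightarrow> AE t in unit_leb. P t"
  unfolding AE_unit_leb using AE_lborel_singleton[of "0::real"] AE_lborel_singleton[of "1::real"]
  by eventually_elim (metis atLeastAtMost_iff greaterThanLessThan_iff less_eq_real_def)

lemma integrable_unit_leb_bounded:
  fixes f :: "real \<Rightarrow> real"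
  assumes "f \<in> borel_measurable borel" "\<And>t. \<bar>f t\<bar> \<le> B"
  shows "integrable unit_leb f"
  using assms by (intro unit_leb.integrable_const_bound[where B=B]) auto

text \<open>Constant extension from [0,1] to the line. \<open>C1_01\<close> constrains functions on
  [0,1] only; the extension of a continuous function is globally continuous, bounded and measurable,
  and composition with an element of \<open>G0\<close> does not see the difference.\<close>

definition clampf :: "(real \<Rightarrow> 'a) \<Rightarrow> real \<Rightarrow> 'a" where
  "clampf a x = a (max 0 (min 1 x))"

lemma clampf_eq [simp]: "x \<in> {0..1} \<Longrightarrow> clampf a x = a x"
  by (cases "x = 1") (auto simp: clampf_def max_def min_def)

lemma continuous_on_clampf:
  fixes a :: "real \<Rightarrow> real"
  assumes "continuous_on {0..1} a"
  shows "continuous_on UNIV (clampf a)"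
  unfolding clampf_def by (intro continuous_on_compose2[OF assms] continuous_intros) auto

lemma clampf_bounded:
  fixes a :: "real \<Rightarrow> real"
  assumes "continuous_on {0..1} a"
  obtains B where "B \<ge> 0" "\<And>x. \<bar>clampf a x\<bar> \<le> B"
proof -
  have "bounded (a ` {0..1})" using assms compact_continuous_image compact_imp_bounded compact_Icc by blast
  then obtain B where B: "\<forall>x\<in>{0..1}. norm (a x) \<le> B" by (auto simp: bounded_iff)
  have "\<bar>clampf a x\<bar> \<le> \<bar>B\<bar>" for x
  proof -
    have "max 0 (min 1 x) \<in> {0..1}" by auto
    with B have "norm (a (max 0 (min 1 x))) \<le> B" by blast
    then show ?thesis by (simp add: clampf_def)
  qed
  then show ?thesis using that[of "\<bar>B\<bar>"] by simp
qed

lemma G0_range: "g \<in> G0 \<Longrightarrow> g t \<in> {0..1}"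
  by (cases "t \<in> {0..1}"; cases "t = 1") (auto simp: G0_def)

lemma G0_one: "g \<in> G0 \<Longrightarrow> g 1 = 1"
  by (auto simp: G0_def)

lemma G0_mono: "g \<in> G0 \<Longrightarrow> 0 \<le> s \<Longrightarrow> s \<le> t \<Longrightarrow> t \<le> 1 \<Longrightarrow> g s \<le> g t"
proof -
  assume g: "g \<in> G0" and st: "0 \<le> s" "s \<le> t" "t \<le> 1"
  show "g s \<le> g t"
  proof (cases "t = 1")
    case True then show ?thesis using G0_range[OF g, of s] G0_one[OF g] by simp
  next
    case False then show ?thesis using g st by (auto simp: G0_def mono_on_def)
  qed
qed

lemma G0_right_cont: "g \<in> G0 \<Longrightarrow> t \<in> {0..<1} \<Longrightarrow> (g \<longlongrightarrow> g t) (at_right t)"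
  by (auto simp: G0_def continuous_within)

lemma G0_clampf [simp]: "g \<in> G0 \<Longrightarrow> clampf a (g t) = a (g t)"
  using G0_range[of g t] by simp

lemma C1_01_cont:
  assumes "C1_01 m \<alpha> \<alpha>'" "i < m"
  shows "continuous_on {0..1} (\<alpha> i)" "continuous_on {0..1} (\<alpha>' i)"
  using assms unfolding C1_01_def
  by (auto intro!: DERIV_continuous_on)

section \<open>Joint measurability of evaluations and of cylinder functions\<close>

locale entropic =
  fixes \<beta> :: real and Q :: "(real \<Rightarrow> real) measure"
  assumes beta_pos: "\<beta> > 0" and is_Q0: "is_Q0 \<beta> Q"
begin

sublocale Q: prob_space Q
  using is_Q0 by (simp add: is_Q0_def)

lemma space_Q: "space Q = G0" and sets_Q: "sets Q = G0_sets"
  using is_Q0 by (simp_all add: is_Q0_def)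

lemma G0_sets_generator: "{{g \<in> G0. g t \<in> A} | t A. t \<in> {0..1} \<and> A \<in> sets borel} \<subseteq> Pow G0"
  by auto

lemma coordinate_measurable [measurable]: "(\<lambda>g. g t) \<in> borel_measurable Q"
proof (cases "t \<in> {0..1}")
  case True
  show ?thesis
  proof (rule measurableI)
    fix A :: "real set" assume A: "A \<in> sets borel"
    have "{g \<in> G0. g t \<in> A} \<in> G0_sets"
      unfolding G0_sets_def using True A by (intro sigma_sets.Basic) blast
    moreover have "(\<lambda>g. g t) -` A \<inter> space Q = {g \<in> G0. g t \<in> A}" by (auto simp: space_Q)
    ultimately show "(\<lambda>g. g t) -` A \<inter> space Q \<in> sets Q" by (simp add: sets_Q)
  qed auto
next
  case False
  then have "g t = 0" if "g \<in> space Q" for g using that by (auto simp: space_Q G0_def)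
  then show ?thesis by (subst measurable_cong[where g="\<lambda>_. 0"]) auto
qed

lemma measurable_into_Q:
  assumes "\<And>x. x \<in> space N \<Longrightarrow> f x \<in> G0" "\<And>t. t \<in> {0..1} \<Longrightarrow> (\<lambda>x. f x t) \<in> borel_measurable N"
  shows "f \<in> measurable N Q"
proof -
  have "f \<in> measurable N (sigma G0 {{g \<in> G0. g t \<in> A} | t A. t \<in> {0..1} \<and> A \<in> sets borel})"
  proof (rule measurable_measure_of[OF G0_sets_generator])
    show "f \<in> space N \<rightarrow> G0" using assms(1) by auto
    fix y assume "y \<in> {{g \<in> G0. g t \<in> A} | t A. t \<in> {0..1} \<and> A \<in> sets borel}"
    then obtain t A where y: "y = {g \<in> G0. g t \<in> A}" "t \<in> {0..1}" "A \<in> sets borel" by blast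
    have "f -` y \<inter> space N = (\<lambda>x. f x t) -` A \<inter> space N" using y(1) assms(1) by auto
    also have "\<dots> \<in> sets N" using assms(2)[OF y(2)] y(3) by (rule measurable_sets)
    finally show "f -` y \<inter> space N \<in> sets N" .
  qed
  moreover have "sets (sigma G0 {{g \<in> G0. g t \<in> A} | t A. t \<in> {0..1} \<and> A \<in> sets borel}) = sets Q"
    using G0_sets_generator by (simp add: sets_Q G0_sets_def)
  ultimately show ?thesis by (simp cong: measurable_cong_sets)
qed

text \<open>\<open>q n\<close> is the first point strictly to the right of \<open>t\<close> on the
  grid of mesh \<open>1 / Suc n\<close>. Strictness matters because elements of \<open>G0\<close>
  are continuous from the right only.\<close>

lemma grid_tendsto_right:
  fixes t :: real
  defines "q \<equiv> \<lambda>n. (of_int \<lfloor>real (Suc n) * t\<rfloor> + 1) / real (Suc n)"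
  shows "filterlim q (at_right t) sequentially" and "\<And>n. t < q n" and "\<And>n. q n \<le> t + 1 / real (Suc n)"
proof -
  have 1: "t < q n" for n
    unfolding q_def pos_less_divide_eq[OF of_nat_0_less_iff[THEN iffD2, OF zero_less_Suc]]
    using floor_correct[of "real (Suc n) * t"] by (simp add: mult.commute)
  have 2: "q n \<le> t + 1 / real (Suc n)" for n
  proof -
    have "q n = of_int \<lfloor>real (Suc n) * t\<rfloor> / real (Suc n) + 1 / real (Suc n)"
      by (simp add: q_def add_divide_distrib)
    also have "\<dots> \<le> (real (Suc n) * t) / real (Suc n) + 1 / real (Suc n)"
      by (intro add_right_mono divide_right_mono of_int_floor_le) auto
    finally show ?thesis by simp
  qed
  have "(\<lambda>n. 1 / real (Suc n)) \<longlonglongrightarrow> 0" by (rule LIMSEQ_Suc[OF lim_1_over_n])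
  then have "(\<lambda>n. t + 1 / real (Suc n)) \<longlonglongrightarrow> t + 0"
    by (intro tendsto_add tendsto_const)
  then have "q \<longlonglongrightarrow> t"
    by (intro tendsto_sandwich[OF _ _ tendsto_const, of t q _ "\<lambda>n. t + 1 / real (Suc n)"])
       (use 1 2 in \<open>auto intro!: always_eventually less_imp_le\<close>)
  then show "filterlim q (at_right t) sequentially"
    using 1 by (auto simp: filterlim_at intro!: always_eventually)
  show "\<And>n. t < q n" "\<And>n. q n \<le> t + 1 / real (Suc n)" by fact+
qed

text \<open>Right continuity makes evaluation a pointwise limit of evaluations at the next grid
  point. These send the time argument through countably many values, so each is measurable by cases
  on the floor.\<close>

lemma evaluation_measurable [measurable]: "(\<lambda>(g, t). g t) \<in> borel_measurable (Q \<Otimes>\<^sub>M borel)"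
proof -
  define q where "q = (\<lambda>n t. (of_int \<lfloor>real (Suc n) * t\<rfloor> + 1) / real (Suc n))"
  have meas: "(\<lambda>(g, t). g (q n t)) \<in> borel_measurable (Q \<Otimes>\<^sub>M borel)" for n
  proof -
    have "(\<lambda>x. (\<lambda>k x. fst x ((of_int k + 1) / real (Suc n))) \<lfloor>real (Suc n) * snd x\<rfloor> x)
      \<in> borel_measurable (Q \<Otimes>\<^sub>M (borel :: real measure))"
      by (rule measurable_compose_countable) measurable
    then show ?thesis by (simp add: q_def case_prod_beta')
  qed
  have lim: "(\<lambda>n. if t \<in> {0..<1} then g (q n t) else if t = 1 then 1 else 0) \<longlonglongrightarrow> g t" if "g \<in> G0" for g t
  proof (cases "t \<in> {0..<1}")
    case True
    have "(\<lambda>n. g (q n t)) \<longlonglongrightarrow> g t"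
      using filterlim_compose[OF G0_right_cont[OF that True] grid_tendsto_right(1)]
      by (simp add: q_def)
    then show ?thesis using True by simp
  next
    case False
    then show ?thesis using that by (auto simp: G0_def)
  qed
  show ?thesis
  proof (rule borel_measurable_LIMSEQ_real)
    show "(\<lambda>n. if snd x \<in> {0..<1} then (\<lambda>(g, t). g (q n t)) x else if snd x = 1 then 1 else 0)
      \<longlonglongrightarrow> (\<lambda>(g, t). g t) x" if "x \<in> space (Q \<Otimes>\<^sub>M (borel :: real measure))" for x
      using lim[of "fst x" "snd x"] that
      by (cases x) (simp only: space_pair_measure space_Q mem_Times_iff fst_conv snd_conv prod.case)
    show "(\<lambda>x. if snd x \<in> {0..<1} then (\<lambda>(g, t). g (q n t)) x else if snd x = 1 then 1 else 0)
      \<in> borel_measurable (Q \<Otimes>\<^sub>M (borel :: real measure))" for n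
      using meas[of n] by measurable
  qed
qed

lemma G0_measurable: "g \<in> G0 \<Longrightarrow> g \<in> borel_measurable borel"
  using measurable_compose[OF measurable_Pair1'[of g Q "borel :: real measure"] evaluation_measurable]
  by (simp add: space_Q)

lemma compose_measurable:
  assumes "continuous_on {0..1} a"
  shows "(\<lambda>(g, t). a (g t) :: real) \<in> borel_measurable (Q \<Otimes>\<^sub>M borel)"
proof -
  have c [measurable]: "clampf a \<in> borel_measurable borel"
    by (rule borel_measurable_continuous_onI[OF continuous_on_clampf[OF assms]])
  have "(\<lambda>(g, t). clampf a (g t)) \<in> borel_measurable (Q \<Otimes>\<^sub>M (borel :: real measure))"
    using measurable_compose[OF evaluation_measurable c] by (simp add: case_prod_beta')
  then show ?thesis
    by (rule measurable_cong[THEN iffD1, rotated]) (auto simp: space_pair_measure space_Q)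
qed

lemma compose_measurable1:
  assumes "continuous_on {0..1} a" "g \<in> G0"
  shows "(\<lambda>t. a (g t) :: real) \<in> borel_measurable borel"
  using measurable_compose[OF measurable_Pair1'[of g Q "borel :: real measure"] compose_measurable[OF assms(1)]] assms(2)
  by (simp add: space_Q)

lemma avec_eq:
  assumes "C1_01 m \<alpha> \<alpha>'" "g \<in> G0" "j < m"
  shows "avec m \<alpha> g j = (\<integral>s. \<alpha> j (g s) \<partial>unit_leb)"
  using assms compose_measurable1[OF C1_01_cont(1)[OF assms(1,3)] assms(2)]
  by (simp add: avec_def LINT_unit_leb)

lemma avec_measurable:
  assumes "C1_01 m \<alpha> \<alpha>'"
  shows "avec m \<alpha> \<in> borel_measurable Q"
proof -
  have "(\<lambda>g. avec m \<alpha> g j) \<in> borel_measurable Q" for j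
  proof (cases "j < m")
    case True
    have m: "(\<lambda>(g, t). \<alpha> j (g t)) \<in> borel_measurable (Q \<Otimes>\<^sub>M unit_leb)"
      using compose_measurable[OF C1_01_cont(1)[OF assms True]]
      by (simp cong: measurable_cong_sets sets_pair_measure_cong)
    have "(\<lambda>g. \<integral>s. \<alpha> j (g s) \<partial>unit_leb) \<in> borel_measurable Q"
      using unit_leb.borel_measurable_lebesgue_integral[OF m] by simp
    then show ?thesis
      by (rule measurable_cong[THEN iffD1, rotated]) (simp add: avec_eq[OF assms _ True] space_Q)
  next
    case False then show ?thesis by (simp add: avec_def)
  qed
  then show ?thesis
    using measurable_coordinatewise_then_product by blast
qed

lemma Z1_measurable:
  assumes "(f, F) \<in> Z1_graph"
  shows "f \<in> borel_measurable Q" "(\<lambda>(g, t). F g t) \<in> borel_measurable (Q \<Otimes>\<^sub>M unit_leb)"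
    "g \<in> G0 \<Longrightarrow> F g \<in> borel_measurable borel"
    "g \<in> G0 \<Longrightarrow> \<exists>B. \<forall>t. \<bar>F g t\<bar> \<le> B"
proof -
  obtain m U D \<alpha> \<alpha>' where U: "C1_Rm m U D" and \<alpha>: "C1_01 m \<alpha> \<alpha>'"
    and f: "f = (\<lambda>g. U (avec m \<alpha> g))" and F: "F = (\<lambda>g t. \<Sum>i<m. D i (avec m \<alpha> g) * \<alpha>' i (g t))"
    using assms unfolding Z1_graph_def by blast
  have [measurable]: "U \<in> borel_measurable borel"
    by (rule borel_measurable_continuous_onI[OF C1_Rm_continuous[OF U]])
  have D: "D i \<in> borel_measurable borel" if "i < m" for i
    using U that by (intro borel_measurable_continuous_onI) (auto simp: C1_Rm_def)
  note [measurable] = avec_measurable[OF \<alpha>]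
  show "f \<in> borel_measurable Q" unfolding f by measurable
  have Di: "(\<lambda>g. D i (avec m \<alpha> g)) \<in> borel_measurable Q" if "i < m" for i
    using D[OF that] by measurable
  have ai: "(\<lambda>x. \<alpha>' i (fst x (snd x))) \<in> borel_measurable (Q \<Otimes>\<^sub>M unit_leb)" if "i < m" for i
    using compose_measurable[OF C1_01_cont(2)[OF \<alpha> that]]
    by (simp add: case_prod_beta' cong: measurable_cong_sets sets_pair_measure_cong)
  have "(\<lambda>x. \<Sum>i<m. D i (avec m \<alpha> (fst x)) * \<alpha>' i (fst x (snd x))) \<in> borel_measurable (Q \<Otimes>\<^sub>M unit_leb)"
    by (intro borel_measurable_sum borel_measurable_times ai measurable_compose[OF measurable_fst Di]) auto
  then show "(\<lambda>(g, t). F g t) \<in> borel_measurable (Q \<Otimes>\<^sub>M unit_leb)"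
    by (simp add: F case_prod_beta')
  assume g: "g \<in> G0"
  show "F g \<in> borel_measurable borel" unfolding F
    by (intro borel_measurable_sum borel_measurable_times compose_measurable1[OF C1_01_cont(2)[OF \<alpha>] g]) auto
  have "\<exists>B. \<forall>t. \<bar>\<alpha>' i (g t)\<bar> \<le> B" if "i < m" for i
    using clampf_bounded[OF C1_01_cont(2)[OF \<alpha> that]] G0_clampf[OF g] by metis
  then obtain B where B: "\<And>i t. i < m \<Longrightarrow> \<bar>\<alpha>' i (g t)\<bar> \<le> B i" by metis
  have "\<bar>F g t\<bar> \<le> (\<Sum>i<m. \<bar>D i (avec m \<alpha> g)\<bar> * B i)" for t
    unfolding F by (intro order.trans[OF sum_abs] sum_mono) (auto simp: abs_mult intro!: mult_left_mono B)
  then show "\<exists>B. \<forall>t. \<bar>F g t\<bar> \<le> B" by blast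
qed

end

section \<open>Dirichlet distributions\<close>

text \<open>Tonelli peels off one coordinate at a time; each contributes its own scale factor, so
  the Jacobian is their product.\<close>

lemma nn_integral_PiM_affine:
  fixes a c :: "'i \<Rightarrow> real"
  assumes "finite I" "\<And>i. i \<in> I \<Longrightarrow> c i \<noteq> 0"
    "f \<in> borel_measurable (PiM I (\<lambda>_. lborel))"
  shows "(\<integral>\<^sup>+ y. f y \<partial>PiM I (\<lambda>_. lborel))
    = (\<Prod>i\<in>I. ennreal \<bar>c i\<bar>) * (\<integral>\<^sup>+ r. f (\<lambda>i\<in>I. a i + c i * r i) \<partial>PiM I (\<lambda>_. lborel))"
  using assms
proof (induction I arbitrary: f rule: finite_induct)
  case empty
  show ?case
    unfolding prod.empty mult_1 by (rule nn_integral_cong) (auto simp: space_PiM restrict_def)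
next
  case (insert i I)
  interpret P: product_sigma_finite "\<lambda>_::'i. lborel :: real measure" by standard
  note [measurable] = insert.prems(2)
  have ci: "c i \<noteq> 0" and cI: "\<And>j. j \<in> I \<Longrightarrow> c j \<noteq> 0" using insert.prems(1) by auto
  let ?A = "\<lambda>I r. \<lambda>j\<in>I. a j + c j * r j"
  let ?PI = "PiM I (\<lambda>_. lborel :: real measure)"
  have fm: "(\<lambda>(x, y). f (x(i := y))) \<in> borel_measurable (?PI \<Otimes>\<^sub>M lborel)"
    by measurable
  have fm2: "(\<lambda>x. \<integral>\<^sup>+ y. f (x(i := a i + c i * y)) \<partial>lborel) \<in> borel_measurable ?PI"
    by measurable
  have "(\<integral>\<^sup>+ y. f y \<partial>PiM (insert i I) (\<lambda>_. lborel)) = (\<integral>\<^sup>+ x. \<integral>\<^sup>+ y. f (x(i := y)) \<partial>lborel \<partial>?PI)"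
    by (rule P.product_nn_integral_insert) (use insert.hyps insert.prems in auto)
  also have "\<dots> = (\<integral>\<^sup>+ x. ennreal \<bar>c i\<bar> * (\<integral>\<^sup>+ y. f (x(i := a i + c i * y)) \<partial>lborel) \<partial>?PI)"
  proof (rule nn_integral_cong)
    fix x assume x: "x \<in> space ?PI"
    have "(\<lambda>y. f (x(i := y))) \<in> borel_measurable borel"
      using measurable_compose[OF measurable_Pair1'[OF x] fm] by simp
    then show "(\<integral>\<^sup>+ y. f (x(i := y)) \<partial>lborel) = ennreal \<bar>c i\<bar> * (\<integral>\<^sup>+ y. f (x(i := a i + c i * y)) \<partial>lborel)"
      by (rule nn_integral_real_affine[OF _ ci])
  qed
  also have "\<dots> = ennreal \<bar>c i\<bar> * (\<integral>\<^sup>+ x. \<integral>\<^sup>+ y. f (x(i := a i + c i * y)) \<partial>lborel \<partial>?PI)"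
    by (rule nn_integral_cmult[OF fm2])
  also have "(\<integral>\<^sup>+ x. \<integral>\<^sup>+ y. f (x(i := a i + c i * y)) \<partial>lborel \<partial>?PI)
     = (\<Prod>j\<in>I. ennreal \<bar>c j\<bar>) * (\<integral>\<^sup>+ r. \<integral>\<^sup>+ y. f ((?A I r)(i := a i + c i * y)) \<partial>lborel \<partial>?PI)"
    by (rule insert.IH[OF cI fm2])
  also have "(\<integral>\<^sup>+ r. \<integral>\<^sup>+ y. f ((?A I r)(i := a i + c i * y)) \<partial>lborel \<partial>?PI)
     = (\<integral>\<^sup>+ r. \<integral>\<^sup>+ y. f (?A (insert i I) (r(i := y))) \<partial>lborel \<partial>?PI)"
    using insert.hyps(2)
    by (intro nn_integral_cong arg_cong[where f=f]) (auto simp: fun_eq_iff restrict_def)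
  also have "\<dots> = (\<integral>\<^sup>+ r. f (?A (insert i I) r) \<partial>PiM (insert i I) (\<lambda>_. lborel))"
    by (rule P.product_nn_integral_insert[symmetric]) (use insert.hyps in auto)
  finally show ?case
    using insert.hyps by (simp only: prod.insert[OF insert.hyps] mult.assoc)
qed

text \<open>The coordinates \<open>x = glue N k p r\<close>: the value at index \<open>k\<close> is \<open>p\<close>, and \<open>r\<close> records the
  relative positions of the other values in \<open>[0,p]\<close> and \<open>[p,1]\<close>. In these coordinates the Dirichlet
  density is a product, which is the reason why resampling \<open>p\<close> alone preserves the measure.\<close>

definition glue :: "nat \<Rightarrow> nat \<Rightarrow> real \<Rightarrow> (nat \<Rightarrow> real) \<Rightarrow> nat \<Rightarrow> real" where
  "glue N k p r = (\<lambda>i\<in>{1..N}. if i < k then p * r i else if i = k then p else p + (1 - p) * r i)"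

text \<open>Increments of the relative positions. Node \<open>k\<close> counts as position 1 when
  seen from the left and as position 0 when seen from the right; with 0 and 1 at the two ends this
  normalises both blocks to [0,1].\<close>

definition gap :: "nat \<Rightarrow> nat \<Rightarrow> (nat \<Rightarrow> real) \<Rightarrow> nat \<Rightarrow> real" where
  "gap N k r i = (if i + 1 = k \<or> i = N then 1 else r (i + 1)) - (if i = 0 \<or> i = k then 0 else r i)"

lemma ext_pt_glue:
  assumes "1 \<le> k" "k \<le> N" "i \<le> N"
  shows "ext_pt N (glue N k p r) (i + 1) - ext_pt N (glue N k p r) i
    = (if i < k then p else 1 - p) * gap N k r i"
proof -
  consider "i + 1 < k" | "i + 1 = k" | "i = k" | "i > k" by linarith
  then show ?thesis
    by cases (use assms in \<open>auto simp: ext_pt_def glue_def gap_def algebra_simps\<close>)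
qed

section \<open>Product form of the Dirichlet density around one node\<close>

locale dirichlet =
  fixes \<beta> :: real and N k :: nat and \<tau> :: "nat \<Rightarrow> real"
  assumes b: "\<beta> > 0" and k: "1 \<le> k" "k \<le> N" and \<tau>0: "\<tau> 0 = 0" and \<tau>1: "\<tau> (N + 1) = 1"
    and \<tau>: "\<And>i. i \<le> N \<Longrightarrow> \<tau> i < \<tau> (i + 1)"
begin

abbreviation "P \<equiv> PiM {1..N} (\<lambda>_. lborel :: real measure)"
abbreviation "R \<equiv> PiM ({1..N} - {k}) (\<lambda>_. lborel :: real measure)"

definition dens :: "(nat \<Rightarrow> real) \<Rightarrow> ennreal" where
  "dens x = indicator (dir_simplex N) x * ennreal (dir_density \<beta> N \<tau> x)"

text \<open>Unnormalised density of the Beta law with parameters \<open>\<beta> * \<tau> k\<close>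
  and \<open>\<beta> * (1 - \<tau> k)\<close>.\<close>

definition beta_w :: "real \<Rightarrow> ennreal" where
  "beta_w p = indicator {0<..<1} p * ennreal (p powr (\<beta> * \<tau> k - 1) * (1 - p) powr (\<beta> * (1 - \<tau> k) - 1))"

text \<open>The two Dirichlet factors for the relative positions on either side of node
  \<open>k\<close>. The whole normalising constant is placed here, so \<open>beta_w\<close> and
  \<open>rest_w\<close> do not have mass one separately; only the product of their masses is
  fixed.\<close>

definition rest_w :: "(nat \<Rightarrow> real) \<Rightarrow> ennreal" where
  "rest_w r = indicator {r. \<forall>i\<le>N. 0 < gap N k r i} r *
     ennreal (Gamma \<beta> / (\<Prod>i\<le>N. Gamma (\<beta> * (\<tau> (i + 1) - \<tau> i))) *
       (\<Prod>i\<le>N. gap N k r i powr (\<beta> * (\<tau> (i + 1) - \<tau> i) - 1)))"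

lemma sum_\<tau>: "j \<le> N + 1 \<Longrightarrow> (\<Sum>i<j. \<beta> * (\<tau> (i + 1) - \<tau> i) - 1) = \<beta> * \<tau> j - real j"
  by (induction j) (auto simp: \<tau>0 algebra_simps)

lemma prod_split: "(\<Prod>i\<le>N. if i < k then f i else g i) = (\<Prod>i<k. f i) * (\<Prod>i=k..N. g i :: 'b :: comm_monoid_mult)"
proof -
  have "{..N} = {..<k} \<union> {k..N}" using k by auto
  then have "(\<Prod>i\<le>N. if i < k then f i else g i) = (\<Prod>i<k. if i < k then f i else g i) * (\<Prod>i=k..N. if i < k then f i else g i)"
    by (simp add: prod.union_disjoint ivl_disj_int)
  also have "\<dots> = (\<Prod>i<k. f i) * (\<Prod>i=k..N. g i)"
    by (intro arg_cong2[where f="(*)"] prod.cong) auto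
  finally show ?thesis .
qed

text \<open>The increments left of node \<open>k\<close> contribute \<open>p\<close> to the power
  \<open>\<beta> * \<tau> k - k\<close>. The substitution scales \<open>k - 1\<close> coordinates by
  \<open>p\<close>, and this Jacobian raises the exponent to \<open>\<beta> * \<tau> k - 1\<close>.
  The same count with the \<open>N - k\<close> coordinates scaled by \<open>1 - p\<close> gives the
  other Beta exponent, and nothing else depends on \<open>p\<close>.\<close>

lemma dens_glue:
  assumes p: "0 < p" "p < 1"
  shows "ennreal (p ^ (k - 1) * (1 - p) ^ (N - k)) * dens (glue N k p r) = beta_w p * rest_w r"
proof (cases "\<forall>i\<le>N. 0 < gap N k r i")
  \<comment> \<open>Since \<open>p\<close> and \<open>1 - p\<close> are positive, a nonpositive gap
    means a nonpositive increment of the glued point, so both sides vanish.\<close>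
  case False
  then obtain i where i: "i \<le> N" "\<not> 0 < gap N k r i" by blast
  then have "\<not> ext_pt N (glue N k p r) i < ext_pt N (glue N k p r) (i + 1)"
    using ext_pt_glue[OF k i(1), of p r] mult_nonneg_nonpos[of "if i < k then p else 1 - p" "gap N k r i"] p
    by (cases "i < k") (simp_all add: not_less)
  then have "glue N k p r \<notin> dir_simplex N" using i(1) by (auto simp: dir_simplex_def)
  then show ?thesis using False by (simp add: dens_def rest_w_def)
next
  case True
  define q where "q i = (if i < k then p else 1 - p)" for i
  have q: "q i > 0" for i using p by (simp add: q_def)
  have eg: "ext_pt N (glue N k p r) (i + 1) - ext_pt N (glue N k p r) i = q i * gap N k r i" if "i \<le> N" for i
    unfolding q_def by (rule ext_pt_glue[OF k that])
  have "0 < ext_pt N (glue N k p r) (i + 1) - ext_pt N (glue N k p r) i" if "i \<le> N" for i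
    unfolding eg[OF that] using q True that by simp
  then have sim: "glue N k p r \<in> dir_simplex N" by (force simp: dir_simplex_def)
  define e where "e i = \<beta> * (\<tau> (i + 1) - \<tau> i) - 1" for i
  define C where "C = Gamma \<beta> / (\<Prod>i\<le>N. Gamma (\<beta> * (\<tau> (i + 1) - \<tau> i)))"
  have C: "C \<ge> 0" unfolding C_def
    by (intro divide_nonneg_nonneg prod_nonneg ballI less_imp_le[OF Gamma_real_pos] mult_pos_pos)
       (use b \<tau> in auto)
  have s1: "(\<Sum>i<k. e i) = \<beta> * \<tau> k - real k"
    unfolding e_def using k by (intro sum_\<tau>) auto
  have "(\<Sum>i<N+1. e i) = (\<Sum>i<k. e i) + (\<Sum>i=k..N. e i)"
  proof -
    have "{..<N+1} = {..<k} \<union> {k..N}" using k by auto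
    moreover have "{..<k} \<inter> {k..N} = {}" by auto
    ultimately show ?thesis by (simp only: sum.union_disjoint finite_lessThan finite_atLeastAtMost)
  qed
  moreover have "(\<Sum>i<N+1. e i) = \<beta> - real (N + 1)"
    using sum_\<tau>[of "N + 1"] \<tau>1 unfolding e_def by simp
  ultimately have s2: "(\<Sum>i=k..N. e i) = \<beta> * (1 - \<tau> k) - real (N + 1 - k)"
    using s1 k by (simp add: of_nat_diff algebra_simps)
  have "(\<Prod>i\<le>N. q i powr e i) = (\<Prod>i\<le>N. if i < k then p powr e i else (1 - p) powr e i)"
    by (intro prod.cong) (auto simp: q_def)
  also have "\<dots> = p powr (\<beta> * \<tau> k - real k) * (1 - p) powr (\<beta> * (1 - \<tau> k) - real (N + 1 - k))"
    unfolding prod_split using p by (simp add: s1 s2 powr_sum[symmetric])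
  finally have pq: "(\<Prod>i\<le>N. q i powr e i) = p powr (\<beta> * \<tau> k - real k) * (1 - p) powr (\<beta> * (1 - \<tau> k) - real (N + 1 - k))" .
  have "dir_density \<beta> N \<tau> (glue N k p r) = C * (\<Prod>i\<le>N. (q i * gap N k r i) powr e i)"
    unfolding dir_density_def C_def e_def atLeast0AtMost
    by (intro arg_cong2[where f="(*)"] refl prod.cong) (simp_all only: atMost_iff eg)
  also have "\<dots> = C * ((\<Prod>i\<le>N. q i powr e i) * (\<Prod>i\<le>N. gap N k r i powr e i))"
    unfolding prod.distrib[symmetric]
    by (intro arg_cong2[where f="(*)"] refl prod.cong powr_mult)
  finally have d: "dir_density \<beta> N \<tau> (glue N k p r)
    = (p powr (\<beta> * \<tau> k - real k) * (1 - p) powr (\<beta> * (1 - \<tau> k) - real (N + 1 - k))) * (C * (\<Prod>i\<le>N. gap N k r i powr e i))"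
    unfolding pq by (simp add: mult_ac)
  have 1: "p ^ (k - 1) * p powr (\<beta> * \<tau> k - real k) = p powr (\<beta> * \<tau> k - 1)"
    using p k by (simp add: powr_realpow[symmetric] powr_add[symmetric] of_nat_diff)
  have 2: "(1 - p) ^ (N - k) * (1 - p) powr (\<beta> * (1 - \<tau> k) - real (N + 1 - k)) = (1 - p) powr (\<beta> * (1 - \<tau> k) - 1)"
    using p k by (simp add: powr_realpow[symmetric] powr_add[symmetric] of_nat_diff)
  have "ennreal (p ^ (k - 1) * (1 - p) ^ (N - k)) * dens (glue N k p r)
    = ennreal ((p ^ (k - 1) * (1 - p) ^ (N - k)) * dir_density \<beta> N \<tau> (glue N k p r))"
    unfolding dens_def using sim p by (simp add: ennreal_mult')
  also have "(p ^ (k - 1) * (1 - p) ^ (N - k)) * dir_density \<beta> N \<tau> (glue N k p r)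
    = (p powr (\<beta> * \<tau> k - 1) * (1 - p) powr (\<beta> * (1 - \<tau> k) - 1)) * (C * (\<Prod>i\<le>N. gap N k r i powr e i))"
    unfolding d 1[symmetric] 2[symmetric] by (simp add: mult_ac)
  also have "ennreal \<dots> = beta_w p * rest_w r"
    unfolding beta_w_def rest_w_def C_def[symmetric] e_def[symmetric] using p True C
    by (simp add: ennreal_mult'' prod_nonneg)
  finally show ?thesis .
qed

lemma dir_simplex_k:
  assumes "x \<in> dir_simplex N"
  shows "0 < x k" "x k < 1"
proof -
  have step: "ext_pt N x i < ext_pt N x (Suc i)" if "i \<le> N" for i
    using assms that by (auto simp: dir_simplex_def)
  have "j \<le> N + 1 \<Longrightarrow> i < j \<Longrightarrow> ext_pt N x i < ext_pt N x j" for i j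
  proof (induction j)
    case (Suc j)
    then show ?case using step[of j] by (cases "i = j") force+
  qed auto
  from this[of k 0] this[of "N + 1" k] show "0 < x k" "x k < 1"
    using k by (auto simp: ext_pt_def)
qed

lemma ext_pt_measurable [measurable]: "i \<le> N + 1 \<Longrightarrow> (\<lambda>x. ext_pt N x i) \<in> borel_measurable P"
  by (cases "i = 0"; cases "i = N + 1") (auto simp: ext_pt_def)

lemma dens_measurable [measurable]: "dens \<in> borel_measurable P"
proof -
  have "{x \<in> space P. \<forall>i\<in>{0..N}. ext_pt N x i < ext_pt N x (i + 1)} \<in> sets P"
    by (intro sets.sets_Collect_finite_All borel_measurable_less) (auto simp del: One_nat_def)
  moreover have "{x \<in> space P. \<forall>i\<in>{0..N}. ext_pt N x i < ext_pt N x (i + 1)} = dir_simplex N \<inter> space P"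
    by (auto simp: dir_simplex_def)
  ultimately have "(indicator (dir_simplex N) :: _ \<Rightarrow> ennreal) \<in> borel_measurable P"
    by (simp only: borel_measurable_indicator_iff)
  moreover have "dir_density \<beta> N \<tau> \<in> borel_measurable P"
    unfolding dir_density_def
    by (intro borel_measurable_times borel_measurable_const borel_measurable_prod powr_real_measurable
        borel_measurable_diff ext_pt_measurable) auto
  ultimately show ?thesis unfolding dens_def by measurable
qed

lemma gap_measurable [measurable]: "i \<le> N \<Longrightarrow> (\<lambda>r. gap N k r i) \<in> borel_measurable R"
  unfolding gap_def by (cases "i + 1 = k"; cases "i = N"; cases "i = 0"; cases "i = k") auto

lemma rest_w_measurable [measurable]: "rest_w \<in> borel_measurable R"
proof -
  have "{r \<in> space R. \<forall>i\<in>{..N}. 0 < gap N k r i} \<in> sets R"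
    by (intro sets.sets_Collect_finite_All borel_measurable_less) (auto simp del: One_nat_def)
  moreover have "{r \<in> space R. \<forall>i\<in>{..N}. 0 < gap N k r i} = {r. \<forall>i\<le>N. 0 < gap N k r i} \<inter> space R"
    by auto
  ultimately have "(indicator {r. \<forall>i\<le>N. 0 < gap N k r i} :: _ \<Rightarrow> ennreal) \<in> borel_measurable R"
    by (simp only: borel_measurable_indicator_iff)
  moreover have "(\<lambda>r. \<Prod>i\<le>N. gap N k r i powr (\<beta> * (\<tau> (i + 1) - \<tau> i) - 1)) \<in> borel_measurable R"
    by (intro borel_measurable_prod powr_real_measurable borel_measurable_const gap_measurable) auto
  ultimately show ?thesis unfolding rest_w_def by measurable
qed

lemma beta_w_measurable [measurable]: "beta_w \<in> borel_measurable borel"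
  unfolding beta_w_def by measurable

lemma glue_measurable [measurable]: "(\<lambda>(p, r). glue N k p r) \<in> measurable (borel \<Otimes>\<^sub>M R) P"
proof -
  have 1: "(\<lambda>x. snd x i) \<in> borel_measurable ((borel :: real measure) \<Otimes>\<^sub>M R)" if "i \<in> {1..N} - {k}" for i
    using that by (intro measurable_compose[OF measurable_snd]) auto
  have "(\<lambda>x. if i < k then fst x * snd x i else if i = k then fst x else fst x + (1 - fst x) * snd x i)
    \<in> borel_measurable ((borel :: real measure) \<Otimes>\<^sub>M R)" if "i \<in> {1..N}" for i
  proof (cases "i = k")
    case False
    then have [measurable]: "(\<lambda>x. snd x i) \<in> borel_measurable ((borel :: real measure) \<Otimes>\<^sub>M R)"
      using 1 that by auto
    show ?thesis by measurable
  qed simp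
  then show ?thesis
    unfolding glue_def case_prod_beta' by (intro measurable_restrict) auto
qed

text \<open>Tonelli with coordinate \<open>k\<close> outermost, then the affine substitution in the
  other coordinates for fixed \<open>p\<close>. If \<open>p\<close> lies outside (0,1), no point
  with \<open>k\<close>-th coordinate \<open>p\<close> belongs to the simplex, and
  \<open>beta_w p\<close> is 0 as well.\<close>

lemma nn_integral_dens:
  assumes F [measurable]: "F \<in> borel_measurable P"
  shows "(\<integral>\<^sup>+ y. dens y * F y \<partial>P) = (\<integral>\<^sup>+ p. beta_w p * (\<integral>\<^sup>+ r. rest_w r * F (glue N k p r) \<partial>R) \<partial>lborel)"
proof -
  interpret P: product_sigma_finite "\<lambda>_::nat. lborel :: real measure" by standard
  define I where "I = {1..N} - {k}"
  have ins: "{1..N} = insert k I" "finite I" "k \<notin> I" using k by (auto simp: I_def)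
  have m: "(\<lambda>y. dens y * F y) \<in> borel_measurable (PiM (insert k I) (\<lambda>_. lborel))"
    unfolding ins(1)[symmetric] by measurable
  have "(\<integral>\<^sup>+ y. dens y * F y \<partial>P)
    = (\<integral>\<^sup>+ p. (\<integral>\<^sup>+ r. dens (r(k := p)) * F (r(k := p)) \<partial>R) \<partial>lborel)"
    unfolding I_def[symmetric] unfolding ins(1) by (rule P.product_nn_integral_insert_rev[OF ins(2,3) m])
  also have "\<dots> = (\<integral>\<^sup>+ p. beta_w p * (\<integral>\<^sup>+ r. rest_w r * F (glue N k p r) \<partial>R) \<partial>lborel)"
  proof (rule nn_integral_cong)
    fix p :: real
    show "(\<integral>\<^sup>+ r. dens (r(k := p)) * F (r(k := p)) \<partial>R) = beta_w p * (\<integral>\<^sup>+ r. rest_w r * F (glue N k p r) \<partial>R)"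
    proof (cases "0 < p \<and> p < 1")
      case False
      then have "dens (r(k := p)) = 0" for r
        using dir_simplex_k[of "r(k := p)"] by (auto simp: dens_def indicator_def)
      then show ?thesis using False by (auto simp: beta_w_def)
    next
      case True
      then have p: "0 < p" "p < 1" by auto
      define c where "c i = (if i < k then p else 1 - p)" for i
      define a where "a i = (if i < k then 0 else p)" for i
      have m2: "(\<lambda>r. dens (r(k := p)) * F (r(k := p))) \<in> borel_measurable R"
      proof -
        have "(\<lambda>r. r(k := p)) \<in> measurable R P"
          by (rule measurable_fun_upd[where J="{1..N} - {k}"]) (use k in auto)
        then show ?thesis by measurable
      qed
      have m3: "(\<lambda>r. glue N k p r) \<in> measurable R P"
        using measurable_compose[OF measurable_Pair1'[of p borel R] glue_measurable] by simp
      have gl: "(\<lambda>i\<in>I. a i + c i * r i)(k := p) = glue N k p r" for r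
        using ins(1) by (auto simp: glue_def a_def c_def fun_eq_iff restrict_def I_def)
      have "(\<Prod>i\<in>I. ennreal \<bar>c i\<bar>) = (\<Prod>i\<in>{1..<k} \<union> {k+1..N}. ennreal \<bar>c i\<bar>)"
        using k by (intro prod.cong) (auto simp: I_def)
      also have "\<dots> = (\<Prod>i\<in>{1..<k}. ennreal \<bar>c i\<bar>) * (\<Prod>i\<in>{k+1..N}. ennreal \<bar>c i\<bar>)"
        by (rule prod.union_disjoint) auto
      also have "(\<Prod>i\<in>{1..<k}. ennreal \<bar>c i\<bar>) = (\<Prod>i\<in>{1..<k}. ennreal p)"
        using p by (intro prod.cong) (auto simp: c_def)
      also have "(\<Prod>i\<in>{k+1..N}. ennreal \<bar>c i\<bar>) = (\<Prod>i\<in>{k+1..N}. ennreal (1 - p))"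
        using p by (intro prod.cong) (auto simp: c_def)
      finally have jac: "(\<Prod>i\<in>I. ennreal \<bar>c i\<bar>) = ennreal (p ^ (k - 1) * (1 - p) ^ (N - k))"
        using p by (simp add: ennreal_mult' ennreal_power)
      have "(\<integral>\<^sup>+ r. dens (r(k := p)) * F (r(k := p)) \<partial>R)
        = (\<Prod>i\<in>I. ennreal \<bar>c i\<bar>) * (\<integral>\<^sup>+ r. dens ((\<lambda>i\<in>I. a i + c i * r i)(k := p)) * F ((\<lambda>i\<in>I. a i + c i * r i)(k := p)) \<partial>R)"
        unfolding I_def[symmetric]
        by (rule nn_integral_PiM_affine) (use p m2 in \<open>auto simp: c_def I_def\<close>)
      also have "\<dots> = (\<integral>\<^sup>+ r. ennreal (p ^ (k - 1) * (1 - p) ^ (N - k)) * (dens (glue N k p r) * F (glue N k p r)) \<partial>R)"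
        unfolding gl jac by (rule nn_integral_cmult[symmetric]) (use m3 in measurable)
      also have "\<dots> = (\<integral>\<^sup>+ r. beta_w p * (rest_w r * F (glue N k p r)) \<partial>R)"
        using dens_glue[OF p] by (simp add: mult.assoc[symmetric])
      also have "\<dots> = beta_w p * (\<integral>\<^sup>+ r. rest_w r * F (glue N k p r) \<partial>R)"
        by (rule nn_integral_cmult) (use m3 in measurable)
      finally show ?thesis .
    qed
  qed
  finally show ?thesis .
qed

text \<open>Reads off the relative positions \<open>y i / y k\<close> and
  \<open>(y i - y k) / (1 - y k)\<close> and glues them around the new value
  \<open>\<theta>\<close>. At \<open>i = k\<close> the second branch yields \<open>\<theta>\<close>
  itself.\<close>

definition resample :: "(nat \<Rightarrow> real) \<Rightarrow> real \<Rightarrow> nat \<Rightarrow> real" where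
  "resample y \<theta> = (\<lambda>i\<in>{1..N}. if i < k then \<theta> * y i / y k else \<theta> + (1 - \<theta>) * (y i - y k) / (1 - y k))"

lemma resample_glue: "0 < p \<Longrightarrow> p < 1 \<Longrightarrow> resample (glue N k p r) \<theta> = glue N k \<theta> r"
  using k by (auto simp: resample_def glue_def fun_eq_iff)

lemma resample_measurable: "(\<lambda>y. resample y \<theta>) \<in> measurable P P"
  unfolding resample_def
proof (rule measurable_restrict)
  fix i assume i: "i \<in> {1..N}"
  have [measurable]: "(\<lambda>y. y i) \<in> borel_measurable P" "(\<lambda>y. y k) \<in> borel_measurable P" using i k by auto
  show "(\<lambda>y. if i < k then \<theta> * y i / y k else \<theta> + (1 - \<theta>) * (y i - y k) / (1 - y k)) \<in> measurable P lborel"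
    by measurable
qed

context
  assumes prob: "(\<integral>\<^sup>+ y. dens y \<partial>P) = 1"
begin

text \<open>Normalisation is a hypothesis at this point. It is later read off from \<open>Q\<close>
  being a probability measure, so no Beta or Dirichlet integral is ever evaluated.\<close>

lemma mass_factor: "(\<integral>\<^sup>+ p. beta_w p \<partial>lborel) * (\<integral>\<^sup>+ r. rest_w r \<partial>R) = 1"
  using nn_integral_dens[of "\<lambda>_. 1"] prob by (simp add: nn_integral_multc)

lemma nn_integral_coordinate:
  assumes [measurable]: "f \<in> borel_measurable borel"
  shows "(\<integral>\<^sup>+ y. dens y * f (y k) \<partial>P) = (\<integral>\<^sup>+ p. beta_w p * f p \<partial>lborel) * (\<integral>\<^sup>+ r. rest_w r \<partial>R)"
proof -
  have fk: "(\<lambda>y. f (y k)) \<in> borel_measurable P"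
    by (rule measurable_compose[OF _ assms]) (use k in auto)
  have "(\<integral>\<^sup>+ y. dens y * f (y k) \<partial>P) = (\<integral>\<^sup>+ p. beta_w p * (\<integral>\<^sup>+ r. rest_w r * f (glue N k p r k) \<partial>R) \<partial>lborel)"
    by (rule nn_integral_dens[OF fk])
  also have "\<dots> = (\<integral>\<^sup>+ p. (beta_w p * f p) * (\<integral>\<^sup>+ r. rest_w r \<partial>R) \<partial>lborel)"
    using k by (intro nn_integral_cong) (auto simp: glue_def nn_integral_multc nn_integral_cmult mult_ac simp del: One_nat_def)
  also have "\<dots> = (\<integral>\<^sup>+ p. beta_w p * f p \<partial>lborel) * (\<integral>\<^sup>+ r. rest_w r \<partial>R)"
    by (rule nn_integral_multc) measurable
  finally show ?thesis .
qed

text \<open>\<open>resample y \<theta>\<close> depends on \<open>y\<close> through the relative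
  positions only, so the inner integral splits into the mass of \<open>beta_w\<close> times an
  integral against \<open>rest_w\<close>. That mass cancels against the mass of
  \<open>rest_w\<close> by \<open>mass_factor\<close>, and what remains is the integral of
  \<open>F\<close> in glued coordinates.\<close>

lemma nn_integral_resample:
  assumes F [measurable]: "F \<in> borel_measurable P"
  shows "(\<integral>\<^sup>+ \<theta>. beta_w \<theta> * (\<integral>\<^sup>+ y. dens y * F (resample y \<theta>) \<partial>P) \<partial>lborel) * (\<integral>\<^sup>+ r. rest_w r \<partial>R)
    = (\<integral>\<^sup>+ y. dens y * F y \<partial>P)"
proof -
  interpret P: product_sigma_finite "\<lambda>_::nat. lborel :: real measure" by standard
  interpret R: sigma_finite_measure R by (rule P.sigma_finite) simp
  have gm: "(\<lambda>x. rest_w (snd x) * F (glue N k (fst x) (snd x))) \<in> borel_measurable (borel \<Otimes>\<^sub>M R)"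
    by (intro borel_measurable_times_ennreal measurable_compose[OF measurable_snd rest_w_measurable]
        measurable_compose[OF glue_measurable F, unfolded case_prod_beta'])
  have [measurable]: "(\<lambda>\<theta>. \<integral>\<^sup>+ r. rest_w r * F (glue N k \<theta> r) \<partial>R) \<in> borel_measurable borel"
    using R.borel_measurable_nn_integral_fst[OF gm] by simp
  have "(\<integral>\<^sup>+ y. dens y * F (resample y \<theta>) \<partial>P)
    = (\<integral>\<^sup>+ p. beta_w p \<partial>lborel) * (\<integral>\<^sup>+ r. rest_w r * F (glue N k \<theta> r) \<partial>R)" for \<theta>
  proof -
    have "(\<integral>\<^sup>+ y. dens y * F (resample y \<theta>) \<partial>P)
      = (\<integral>\<^sup>+ p. beta_w p * (\<integral>\<^sup>+ r. rest_w r * F (resample (glue N k p r) \<theta>) \<partial>R) \<partial>lborel)"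
      by (rule nn_integral_dens[where F="\<lambda>y. F (resample y \<theta>)"])
         (rule measurable_compose[OF resample_measurable F])
    also have "\<dots> = (\<integral>\<^sup>+ p. beta_w p * (\<integral>\<^sup>+ r. rest_w r * F (glue N k \<theta> r) \<partial>R) \<partial>lborel)"
      by (intro nn_integral_cong) (auto simp: beta_w_def indicator_def resample_glue)
    also have "\<dots> = (\<integral>\<^sup>+ p. beta_w p \<partial>lborel) * (\<integral>\<^sup>+ r. rest_w r * F (glue N k \<theta> r) \<partial>R)"
      by (rule nn_integral_multc) measurable
    finally show ?thesis .
  qed
  then have "(\<integral>\<^sup>+ \<theta>. beta_w \<theta> * (\<integral>\<^sup>+ y. dens y * F (resample y \<theta>) \<partial>P) \<partial>lborel)
    = (\<integral>\<^sup>+ \<theta>. (beta_w \<theta> * (\<integral>\<^sup>+ r. rest_w r * F (glue N k \<theta> r) \<partial>R)) * (\<integral>\<^sup>+ p. beta_w p \<partial>lborel) \<partial>lborel)"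
    by (simp add: mult_ac)
  also have "\<dots> = (\<integral>\<^sup>+ \<theta>. beta_w \<theta> * (\<integral>\<^sup>+ r. rest_w r * F (glue N k \<theta> r) \<partial>R) \<partial>lborel) * (\<integral>\<^sup>+ p. beta_w p \<partial>lborel)"
    by (rule nn_integral_multc) measurable
  also have "(\<integral>\<^sup>+ \<theta>. beta_w \<theta> * (\<integral>\<^sup>+ r. rest_w r * F (glue N k \<theta> r) \<partial>R) \<partial>lborel) = (\<integral>\<^sup>+ y. dens y * F y \<partial>P)"
    by (rule nn_integral_dens[OF F, symmetric])
  finally show ?thesis using mass_factor by (simp add: mult.assoc)
qed

end

end

section \<open>Resampling the value at one point\<close>

text \<open>Sets the value at \<open>t\<close> to \<open>\<theta>\<close> and rescales \<open>g\<close> affinely on both sides of \<open>t\<close>; in the degenerate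
  cases, which are null under the law considered, \<open>g\<close> is left unchanged to stay in \<open>G0\<close>.\<close>

definition move :: "real \<Rightarrow> (real \<Rightarrow> real) \<Rightarrow> real \<Rightarrow> real \<Rightarrow> real" where
  "move t g \<theta> = (if 0 < g t \<and> g t < 1 \<and> 0 < \<theta> \<and> \<theta> < 1
     then (\<lambda>s. if s < t then \<theta> * g s / g t
               else if s \<le> 1 then \<theta> + (1 - \<theta>) * (g s - g t) / (1 - g t) else 0)
     else g)"

text \<open>Both pieces are nondecreasing affine images of \<open>g\<close> that take the value
  \<open>\<theta>\<close> at \<open>t\<close>, so monotonicity across \<open>t\<close> follows by
  comparing each side with \<open>\<theta>\<close>.\<close>

lemma move_G0:
  assumes g: "g \<in> G0" and t: "0 < t" "t < 1"
  shows "move t g \<theta> \<in> G0"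
proof (cases "0 < g t \<and> g t < 1 \<and> 0 < \<theta> \<and> \<theta> < 1")
  case True
  then have gt: "0 < g t" "g t < 1" and \<theta>: "0 < \<theta>" "\<theta> < 1" by auto
  define L where "L s = \<theta> * g s / g t" for s
  define U where "U s = \<theta> + (1 - \<theta>) * (g s - g t) / (1 - g t)" for s
  have m: "move t g \<theta> = (\<lambda>s. if s < t then L s else if s \<le> 1 then U s else 0)"
    unfolding move_def L_def U_def using True by (simp only: if_True simp_thms)
  have L_mono: "L r \<le> L s" if "g r \<le> g s" for r s
    unfolding L_def using gt \<theta> that by (intro divide_right_mono mult_left_mono) auto
  have U_mono: "U r \<le> U s" if "g r \<le> g s" for r s
    unfolding U_def using gt \<theta> that by (intro add_left_mono divide_right_mono mult_left_mono) auto
  have Lt: "L t = \<theta>" and Ut: "U t = \<theta>" and U1: "U 1 = 1"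
    using gt G0_one[OF g] by (auto simp: L_def U_def)
  have L0: "0 \<le> L s" for s using G0_range[OF g, of s] gt \<theta> by (simp add: L_def)
  have mono: "move t g \<theta> r \<le> move t g \<theta> s" if rs: "0 \<le> r" "r \<le> s" "s \<le> 1" for r s
  proof -
    consider "s < t" | "r < t" "t \<le> s" | "t \<le> r" by linarith
    then show ?thesis
    proof cases
      case 1 then show ?thesis using rs t by (auto simp: m intro!: L_mono G0_mono[OF g])
    next
      case 2
      have "L r \<le> L t" "U t \<le> U s" using 2 rs t by (auto intro!: L_mono U_mono G0_mono[OF g])
      then show ?thesis using 2 rs Lt Ut by (auto simp: m)
    next
      case 3 then show ?thesis using rs t by (auto simp: m intro!: U_mono G0_mono[OF g])
    qed
  qed
  have one: "move t g \<theta> 1 = 1" using t U1 by (simp add: m)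
  have zero: "0 \<le> move t g \<theta> 0" using t L0 by (simp add: m)
  have cont: "continuous (at_right s) (move t g \<theta>)" if s: "s \<in> {0..<1}" for s
  proof -
    note gs = G0_right_cont[OF g s]
    show ?thesis
    proof (cases "s < t")
      case True
      have "(L \<longlongrightarrow> L s) (at_right s)"
        unfolding L_def using gt by (intro tendsto_intros gs) auto
      moreover have "\<forall>\<^sub>F r in at_right s. L r = move t g \<theta> r"
        using True by (auto simp: eventually_at_right m intro!: exI[of _ t])
      ultimately have "(move t g \<theta> \<longlongrightarrow> L s) (at_right s)" using tendsto_cong by blast
      then show ?thesis using True by (simp add: continuous_within m)
    next
      case False
      have "(U \<longlongrightarrow> U s) (at_right s)"
        unfolding U_def using gt by (intro tendsto_intros gs) auto
      moreover have "\<forall>\<^sub>F r in at_right s. U r = move t g \<theta> r"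
        using False s by (auto simp: eventually_at_right m intro!: exI[of _ 1])
      ultimately have "(move t g \<theta> \<longlongrightarrow> U s) (at_right s)" using tendsto_cong by blast
      then show ?thesis using False s by (simp add: continuous_within m)
    qed
  qed
  have "move t g \<theta> s = 0" if "s \<notin> {0..1}" for s
    using that g t by (auto simp: m L_def G0_def)
  moreover have "move t g \<theta> s \<in> {0..1}" if "s \<in> {0..<1}" for s
    using mono[of 0 s] mono[of s 1] that one zero by auto
  ultimately show ?thesis
    unfolding G0_def using mono one cont by (auto simp: mono_on_def)
next
  case False then show ?thesis using g by (auto simp: move_def)
qed

lemma partition_of_finite_set:
  assumes J: "finite J" "J \<subseteq> {0<..<1::real}" "t \<in> J" and b: "\<beta> > 0"
  shows "\<exists>N k \<tau>. dirichlet \<beta> N k \<tau> \<and> \<tau> k = t \<and> \<tau> ` {1..N} = J \<and> inj_on \<tau> {1..N}"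
proof -
  define xs where "xs = sorted_list_of_set J"
  define N where "N = card J"
  define \<tau> where "\<tau> i = (if i = 0 then 0 else if i = N + 1 then 1 else xs ! (i - 1))" for i
  have xs: "set xs = J" "length xs = N" "sorted_wrt (<) xs"
    using J(1) by (auto simp: xs_def N_def)
  have nth_less: "xs ! i < xs ! j" if "i < j" "j < N" for i j
    using xs that by (auto simp: sorted_wrt_iff_nth_less)
  have nth_in: "xs ! i \<in> {0<..<1}" if "i < N" for i using that xs J(2) nth_mem by blast
  have img: "\<tau> ` {1..N} = J"
  proof -
    have "\<tau> ` {1..N} = (\<lambda>i. xs ! i) ` {..<N}"
    proof (intro equalityI subsetI)
      fix x assume "x \<in> \<tau> ` {1..N}"
      then obtain i where "i \<in> {1..N}" "x = \<tau> i" by blast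
      then show "x \<in> (\<lambda>i. xs ! i) ` {..<N}" by (intro image_eqI[of _ _ "i - 1"]) (auto simp: \<tau>_def)
    next
      fix x assume "x \<in> (\<lambda>i. xs ! i) ` {..<N}"
      then obtain i where "i < N" "x = xs ! i" by blast
      then show "x \<in> \<tau> ` {1..N}" by (intro image_eqI[of _ _ "Suc i"]) (auto simp: \<tau>_def)
    qed
    also have "\<dots> = J" unfolding xs(1)[symmetric] using xs(2) by (auto simp: set_conv_nth)
    finally show ?thesis .
  qed
  from img J(3) obtain k where k: "k \<in> {1..N}" "\<tau> k = t" by (metis imageE)
  have "\<tau> i < \<tau> (i + 1)" if "i \<le> N" for i
  proof -
    have "N > 0" using k by auto
    consider "i = 0" | "i \<noteq> 0" "i < N" | "i = N" "i \<noteq> 0" using \<open>i \<le> N\<close> by linarith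
    then show ?thesis
    proof cases
      case 1 then show ?thesis using nth_in[of 0] \<open>N > 0\<close> by (auto simp: \<tau>_def)
    next
      case 2 then show ?thesis using nth_less[of "i - 1" i] by (auto simp: \<tau>_def)
    next
      case 3 then show ?thesis using nth_in[of "i - 1"] by (auto simp: \<tau>_def)
    qed
  qed
  then have "dirichlet \<beta> N k \<tau>"
    by unfold_locales (use b k in \<open>auto simp: \<tau>_def\<close>)
  moreover have "inj_on \<tau> {1..N}"
    using img J(1) by (intro eq_card_imp_inj_on) (auto simp: N_def)
  ultimately show ?thesis using img k by blast
qed

lemma (in dirichlet) \<tau>_mono: "i < j \<Longrightarrow> j \<le> N + 1 \<Longrightarrow> \<tau> i < \<tau> j"
proof (induction j)
  case (Suc j) then show ?case using \<tau>[of j] by (cases "i = j") force+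
qed auto

lemma (in dirichlet) dens_eq_0: "x \<notin> dir_simplex N \<Longrightarrow> dens x = 0"
  by (simp add: dens_def)

section \<open>Finite-dimensional laws and almost sure strict monotonicity\<close>

context entropic
begin

context
  fixes N k \<tau>
  assumes D: "dirichlet \<beta> N k \<tau>"
begin

interpretation dirichlet \<beta> N k \<tau> by (rule D)

lemma coordinates_measurable: "(\<lambda>g. \<lambda>i\<in>{1..N}. g (\<tau> i)) \<in> measurable Q P"
  by (rule measurable_restrict) simp

lemma distr_coordinates: "distr Q P (\<lambda>g. \<lambda>i\<in>{1..N}. g (\<tau> i)) = density P dens"
proof -
  have "distr Q P (\<lambda>g. \<lambda>i\<in>{1..N}. g (\<tau> i))
     = density P (\<lambda>x. indicator (dir_simplex N) x * ennreal (dir_density \<beta> N \<tau> x))"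
    by (rule is_Q0[unfolded is_Q0_def, THEN conjunct2, THEN conjunct2, THEN conjunct2, rule_format])
       (use \<tau>0 \<tau>1 \<tau> k in auto)
  then show ?thesis by (simp add: dens_def[abs_def])
qed

lemma nn_integral_coordinates:
  assumes "F \<in> borel_measurable P"
  shows "(\<integral>\<^sup>+ g. F (\<lambda>i\<in>{1..N}. g (\<tau> i)) \<partial>Q) = (\<integral>\<^sup>+ y. dens y * F y \<partial>P)"
proof -
  have "(\<integral>\<^sup>+ g. F (\<lambda>i\<in>{1..N}. g (\<tau> i)) \<partial>Q) = (\<integral>\<^sup>+ y. F y \<partial>distr Q P (\<lambda>g. \<lambda>i\<in>{1..N}. g (\<tau> i)))"
    by (rule nn_integral_distr[symmetric, OF coordinates_measurable]) (use assms in simp)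
  also have "\<dots> = (\<integral>\<^sup>+ y. dens y * F y \<partial>P)"
    unfolding distr_coordinates by (rule nn_integral_density[OF dens_measurable assms])
  finally show ?thesis .
qed

text \<open>This discharges the normalisation hypothesis of the resampling identities: the density
  belongs to an image of the probability measure \<open>Q\<close>.\<close>

lemma dens_mass: "(\<integral>\<^sup>+ y. dens y \<partial>P) = 1"
  using nn_integral_coordinates[of "\<lambda>_. 1"] Q.emeasure_space_1 by simp

lemma AE_coordinates_simplex: "AE g in Q. (\<lambda>i\<in>{1..N}. g (\<tau> i)) \<in> dir_simplex N"
proof -
  have "AE y in density P dens. y \<in> dir_simplex N"
    by (subst AE_density[OF dens_measurable]) (rule AE_I2, metis dens_eq_0 less_irrefl)
  then have "AE y in distr Q P (\<lambda>g. \<lambda>i\<in>{1..N}. g (\<tau> i)). y \<in> dir_simplex N"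
    by (simp only: distr_coordinates)
  then show ?thesis
    by (rule AE_distrD[OF coordinates_measurable])
qed

lemma AE_coordinate: "AE g in Q. 0 < g (\<tau> k) \<and> g (\<tau> k) < 1"
  using AE_coordinates_simplex
proof eventually_elim
  case (elim g)
  from dir_simplex_k[OF this] show ?case using k by auto
qed

text \<open>Sampling at the nodes intertwines \<open>move\<close> on functions with
  \<open>resample\<close> on vectors: the nodes increase, so lying left of \<open>\<tau> k\<close>
  is the same as having a smaller index.\<close>

lemma move_coordinates:
  assumes "0 < g (\<tau> k)" "g (\<tau> k) < 1" "0 < \<theta>" "\<theta> < 1"
  shows "(\<lambda>i\<in>{1..N}. move (\<tau> k) g \<theta> (\<tau> i)) = resample (\<lambda>i\<in>{1..N}. g (\<tau> i)) \<theta>"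
proof (rule ext)
  fix i
  show "(\<lambda>i\<in>{1..N}. move (\<tau> k) g \<theta> (\<tau> i)) i = resample (\<lambda>i\<in>{1..N}. g (\<tau> i)) \<theta> i"
  proof (cases "i \<in> {1..N}")
    case True
    then have i: "\<tau> i < \<tau> k \<longleftrightarrow> i < k" "\<tau> i \<le> 1"
      using \<tau>_mono[of i k] \<tau>_mono[of k i] \<tau>_mono[of i "N + 1"] \<tau>1 k
      by (auto, (metis linorder_neqE_nat less_asym less_irrefl le_SucI)?)
    then show ?thesis using True assms k by (simp add: move_def resample_def)
  next
    case False then show ?thesis by (simp only: resample_def restrict_def if_False)
  qed
qed

end

lemma AE_value:
  assumes "0 < t" "t < 1"
  shows "AE g in Q. 0 < g t \<and> g t < 1"
proof -
  obtain N k \<tau> where "dirichlet \<beta> N k \<tau>" "\<tau> k = t"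
    using partition_of_finite_set[of "{t}" t \<beta>] assms beta_pos by auto
  from AE_coordinate[OF this(1)] this(2) show ?thesis by simp
qed

lemma AE_less:
  assumes "0 < s" "s < t" "t < 1"
  shows "AE g in Q. g s < g t"
proof -
  define \<tau> where "\<tau> i = (if i = 0 then 0 else if i = 1 then s else if i = 2 then t else 1 :: real)" for i :: nat
  have D: "dirichlet \<beta> 2 1 \<tau>"
  proof
    show "\<tau> i < \<tau> (i + 1)" if "i \<le> 2" for i
    proof -
      have "i = 0 \<or> i = 1 \<or> i = 2" using that by linarith
      then show ?thesis using assms by (auto simp: \<tau>_def)
    qed
  qed (use beta_pos in \<open>auto simp: \<tau>_def\<close>)
  from AE_coordinates_simplex[OF this] show ?thesis
  proof eventually_elim
    case (elim g)
    then have "ext_pt 2 (\<lambda>i\<in>{1..2}. g (\<tau> i)) 1 < ext_pt 2 (\<lambda>i\<in>{1..2}. g (\<tau> i)) (1 + 1)"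
      unfolding dir_simplex_def by (metis (mono_tags, lifting) mem_Collect_eq atLeastAtMost_iff one_le_numeral zero_le_one)
    then show ?case by (simp add: ext_pt_def \<tau>_def)
  qed
qed

text \<open>Countably many rational pairs suffice: two rationals inserted strictly between
  \<open>s\<close> and \<open>t\<close> lie in (0,1) even when \<open>s = 0\<close> or
  \<open>t = 1\<close>, and monotonicity carries the strict inequality to the outer points.\<close>

lemma AE_strict_mono: "AE g in Q. \<forall>s t. 0 \<le> s \<longrightarrow> s < t \<longrightarrow> t \<le> 1 \<longrightarrow> g s < g t"
proof -
  have "AE g in Q. \<forall>p\<in>{(a, b). a \<in> \<rat> \<and> b \<in> \<rat> \<and> 0 < a \<and> a < b \<and> b < 1}. g (fst p) < g (snd p)"
  proof (rule AE_ball_countable')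
    show "countable {(a, b). a \<in> \<rat> \<and> b \<in> \<rat> \<and> 0 < a \<and> a < b \<and> (b::real) < 1}"
      by (rule countable_subset[OF _ countable_SIGMA[OF countable_rat countable_rat]]) auto
  qed (auto intro: AE_less)
  with AE_space show ?thesis
  proof eventually_elim
    case (elim g)
    then have g: "g \<in> G0" by (simp add: space_Q)
    show ?case
    proof (intro allI impI)
      fix s t :: real assume st: "0 \<le> s" "s < t" "t \<le> 1"
      obtain a where a: "a \<in> \<rat>" "s < a" "a < t" using Rats_dense_in_real[OF st(2)] by blast
      obtain b where b: "b \<in> \<rat>" "a < b" "b < t" using Rats_dense_in_real[OF a(3)] by blast
      have "g a < g b" using elim(2) a b st by auto
      moreover have "g s \<le> g a" "g b \<le> g t"
        using a b st by (auto intro!: G0_mono[OF g])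
      ultimately show "g s < g t" by linarith
    qed
  qed
qed

lemma move_measurable:
  assumes t: "0 < t" "t < 1"
  shows "(\<lambda>(g, \<theta>). move t g \<theta>) \<in> measurable (Q \<Otimes>\<^sub>M borel) Q"
proof (rule measurable_into_Q)
  show "(case x of (g, \<theta>) \<Rightarrow> move t g \<theta>) \<in> G0" if "x \<in> space (Q \<Otimes>\<^sub>M (borel :: real measure))" for x
    using that move_G0[OF _ t] by (auto simp: space_pair_measure space_Q)
  fix s :: real
  have [measurable]: "(\<lambda>x. fst x r) \<in> borel_measurable (Q \<Otimes>\<^sub>M (borel :: real measure))" for r
    by (rule measurable_compose[OF measurable_fst]) simp
  have "(\<lambda>x. if 0 < fst x t \<and> fst x t < 1 \<and> 0 < snd x \<and> snd x < 1
      then (if s < t then snd x * fst x s / fst x t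
            else if s \<le> 1 then snd x + (1 - snd x) * (fst x s - fst x t) / (1 - fst x t) else 0)
      else fst x s) \<in> borel_measurable (Q \<Otimes>\<^sub>M (borel :: real measure))"
    by measurable
  then show "(\<lambda>x. (case x of (g, \<theta>) \<Rightarrow> move t g \<theta>) s) \<in> borel_measurable (Q \<Otimes>\<^sub>M (borel :: real measure))"
    by (rule measurable_cong[THEN iffD1, rotated]) (auto simp: move_def)
qed

section \<open>One-point laws and invariance of the measure under resampling\<close>

definition law :: "real \<Rightarrow> real measure" where
  "law t = distr Q borel (\<lambda>g. g t)"

lemma sets_law [simp, measurable_cong]: "sets (law t) = sets borel" and space_law [simp]: "space (law t) = UNIV"
  by (simp_all add: law_def)

lemma prob_space_law: "prob_space (law t)"
  unfolding law_def by (rule Q.prob_space_distr) simp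

context
  fixes N k \<tau>
  assumes D: "dirichlet \<beta> N k \<tau>"
begin

interpretation dirichlet \<beta> N k \<tau> by (rule D)

text \<open>The one-point marginal of a Dirichlet law is a Beta law; the mass of
  \<open>rest_w\<close> is its normalising factor.\<close>

lemma nn_integral_law:
  assumes f: "f \<in> borel_measurable borel"
  shows "(\<integral>\<^sup>+ \<theta>. f \<theta> \<partial>law (\<tau> k)) = (\<integral>\<^sup>+ \<theta>. beta_w \<theta> * f \<theta> \<partial>lborel) * (\<integral>\<^sup>+ r. rest_w r \<partial>R)"
proof -
  have fk: "(\<lambda>y. f (y k)) \<in> borel_measurable P"
  proof -
    have "(\<lambda>y. y k) \<in> measurable P lborel"
      by (rule measurable_component_singleton) (use k in simp)
    then show ?thesis by (rule measurable_compose) (use f in simp)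
  qed
  have "(\<integral>\<^sup>+ \<theta>. f \<theta> \<partial>law (\<tau> k)) = (\<integral>\<^sup>+ g. f (g (\<tau> k)) \<partial>Q)"
    unfolding law_def using f by (intro nn_integral_distr) auto
  also have "\<dots> = (\<integral>\<^sup>+ g. f ((\<lambda>i\<in>{1..N}. g (\<tau> i)) k) \<partial>Q)"
    using k by simp
  also have "\<dots> = (\<integral>\<^sup>+ y. dens y * f (y k) \<partial>P)"
    by (rule nn_integral_coordinates[OF D fk])
  also have "\<dots> = (\<integral>\<^sup>+ \<theta>. beta_w \<theta> * f \<theta> \<partial>lborel) * (\<integral>\<^sup>+ r. rest_w r \<partial>R)"
    by (rule nn_integral_coordinate[OF dens_mass[OF D] f])
  finally show ?thesis .
qed

lemma \<tau>k: "0 < \<tau> k" "\<tau> k < 1"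
  using \<tau>_mono[of 0 k] \<tau>_mono[of k "N + 1"] \<tau>0 \<tau>1 k by auto

text \<open>Sampling \<open>move\<close> gives \<open>resample\<close> for
  \<open>g (\<tau> k)\<close> and \<open>\<theta>\<close> strictly between 0 and 1. The exceptional
  \<open>g\<close> form a null set, and exceptional \<open>\<theta>\<close> are hidden by the factor
  \<open>beta_w\<close>.\<close>

lemma nn_integral_move_coordinates:
  assumes F: "F \<in> borel_measurable P"
  shows "(\<integral>\<^sup>+ \<theta>. \<integral>\<^sup>+ g. F (\<lambda>i\<in>{1..N}. move (\<tau> k) g \<theta> (\<tau> i)) \<partial>Q \<partial>law (\<tau> k))
    = (\<integral>\<^sup>+ g. F (\<lambda>i\<in>{1..N}. g (\<tau> i)) \<partial>Q)"
proof -
  define \<phi> where "\<phi> \<theta> = (\<integral>\<^sup>+ g. F (\<lambda>i\<in>{1..N}. move (\<tau> k) g \<theta> (\<tau> i)) \<partial>Q)" for \<theta>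
  have mv: "(\<lambda>x. F (\<lambda>i\<in>{1..N}. move (\<tau> k) (snd x) (fst x) (\<tau> i))) \<in> borel_measurable ((borel :: real measure) \<Otimes>\<^sub>M Q)"
  proof -
    have "(\<lambda>x. (snd x, fst x)) \<in> measurable ((borel :: real measure) \<Otimes>\<^sub>M Q) (Q \<Otimes>\<^sub>M borel)"
      by measurable
    from measurable_compose[OF this move_measurable[OF \<tau>k]]
    have "(\<lambda>x. move (\<tau> k) (snd x) (fst x)) \<in> measurable ((borel :: real measure) \<Otimes>\<^sub>M Q) Q"
      by simp
    from measurable_compose[OF measurable_compose[OF this coordinates_measurable[OF D]] F]
    show ?thesis .
  qed
  have \<phi>: "\<phi> \<in> borel_measurable borel"
    unfolding \<phi>_def using Q.borel_measurable_nn_integral_fst[OF mv] by simp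
  have "\<phi> \<theta> = (\<integral>\<^sup>+ y. dens y * F (resample y \<theta>) \<partial>P)" if \<theta>: "0 < \<theta>" "\<theta> < 1" for \<theta>
  proof -
    have "AE g in Q. F (\<lambda>i\<in>{1..N}. move (\<tau> k) g \<theta> (\<tau> i)) = F (resample (\<lambda>i\<in>{1..N}. g (\<tau> i)) \<theta>)"
      using AE_coordinate[OF D] by eventually_elim (simp only: move_coordinates[OF D] \<theta>)
    then have "\<phi> \<theta> = (\<integral>\<^sup>+ g. F (resample (\<lambda>i\<in>{1..N}. g (\<tau> i)) \<theta>) \<partial>Q)"
      unfolding \<phi>_def by (rule nn_integral_cong_AE)
    also have "\<dots> = (\<integral>\<^sup>+ y. dens y * F (resample y \<theta>) \<partial>P)"
      by (rule nn_integral_coordinates[OF D measurable_compose[OF resample_measurable F]])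
    finally show ?thesis .
  qed
  then have eq: "beta_w \<theta> * \<phi> \<theta> = beta_w \<theta> * (\<integral>\<^sup>+ y. dens y * F (resample y \<theta>) \<partial>P)" for \<theta>
    by (cases "0 < \<theta> \<and> \<theta> < 1") (auto simp: beta_w_def)
  have "(\<integral>\<^sup>+ \<theta>. \<phi> \<theta> \<partial>law (\<tau> k)) = (\<integral>\<^sup>+ y. dens y * F y \<partial>P)"
    unfolding nn_integral_law[OF \<phi>] eq by (rule nn_integral_resample[OF dens_mass[OF D] F])
  then show ?thesis
    unfolding \<phi>_def nn_integral_coordinates[OF D F] .
qed

lemma law_density: "(\<integral>\<^sup>+ r. rest_w r \<partial>R) \<noteq> 0"
  using mass_factor[OF dens_mass[OF D]] by auto

end

text \<open>Every index set contains \<open>t\<close>, so that the resampled point is a node of the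
  partition attached to the cylinder. Only interior times occur because 0 and 1 are the fixed ends
  of each partition.\<close>

definition cylinders :: "real \<Rightarrow> (real \<Rightarrow> real) set set" where
  "cylinders t = {{g \<in> G0. \<forall>s\<in>J. g s \<in> A s} | J A.
     finite J \<and> J \<subseteq> {0<..<1} \<and> t \<in> J \<and> (\<forall>s. A s \<in> sets borel)}"

text \<open>Another interior time \<open>s\<close> is reached through \<open>{s, t}\<close> with a
  trivial constraint at \<open>t\<close>. The value at 0 is recovered by right continuity along
  \<open>1 / (n + 2)\<close>, and the value at 1 is constant.\<close>

lemma sigma_cylinders:
  assumes t: "0 < t" "t < 1"
  shows "sigma_sets G0 (cylinders t) = sets Q"
proof -
  have c: "cylinders t \<subseteq> Pow G0" by (auto simp: cylinders_def)
  have "cylinders t \<subseteq> sets Q"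
  proof
    fix X assume "X \<in> cylinders t"
    then obtain J A where X: "X = {g \<in> G0. \<forall>s\<in>J. g s \<in> A s}" "finite J" "\<And>s. A s \<in> sets borel"
      unfolding cylinders_def by blast
    have "{g \<in> space Q. \<forall>s\<in>J. g s \<in> A s} \<in> sets Q"
      using X(2,3) by (intro sets.sets_Collect_finite_All measurable_sets_Collect[OF coordinate_measurable]) auto
    then show "X \<in> sets Q" by (simp add: X(1) space_Q)
  qed
  then have le: "sigma_sets G0 (cylinders t) \<subseteq> sets Q"
    using sets.sigma_sets_subset[of "cylinders t" Q] by (simp add: space_Q)
  define S where "S = sigma G0 (cylinders t)"
  have S: "sets S = sigma_sets G0 (cylinders t)" "space S = G0"
    using c by (simp_all add: S_def)
  have inner: "(\<lambda>g. g s) \<in> borel_measurable S" if s: "0 < s" "s < 1" for s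
  proof (rule measurableI)
    fix A :: "real set" assume A: "A \<in> sets borel"
    have "{g \<in> G0. \<forall>r\<in>{s, t}. g r \<in> (if r = s then A else UNIV)} \<in> cylinders t"
      unfolding cylinders_def using s t A
      by (intro CollectI exI[of _ "{s, t}"] exI[of _ "\<lambda>r. if r = s then A else UNIV"]) auto
    moreover have "{g \<in> G0. \<forall>r\<in>{s, t}. g r \<in> (if r = s then A else UNIV)} = (\<lambda>g. g s) -` A \<inter> space S"
      by (auto simp: S)
    ultimately show "(\<lambda>g. g s) -` A \<inter> space S \<in> sets S" unfolding S(1) by (metis sigma_sets.Basic)
  qed auto
  have all: "(\<lambda>g. g s) \<in> borel_measurable S" if s: "0 \<le> s" "s \<le> 1" for s
  proof -
    consider "s = 0" | "s = 1" | "0 < s" "s < 1" using s by linarith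
    then show ?thesis
    proof cases
      case 1
      show ?thesis unfolding 1
      proof (rule borel_measurable_LIMSEQ_real)
        show "(\<lambda>n. g (1 / real (Suc (Suc n)))) \<longlonglongrightarrow> g 0" if "g \<in> space S" for g
        proof (rule filterlim_compose[OF G0_right_cont[of g 0]])
          show "g \<in> G0" using that S by simp
          show "filterlim (\<lambda>n. 1 / real (Suc (Suc n))) (at_right 0) sequentially"
            using LIMSEQ_Suc[OF LIMSEQ_Suc[OF lim_1_over_n]]
            by (auto simp: filterlim_at intro!: always_eventually)
        qed auto
        show "(\<lambda>g. g (1 / real (Suc (Suc n)))) \<in> borel_measurable S" for n
          by (rule inner) (auto simp: divide_simps)
      qed
    next
      case 2
      have "g s = 1" if "g \<in> space S" for g using that 2 by (auto simp: S G0_def)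
      then show ?thesis by (subst measurable_cong[where g="\<lambda>_. 1"]) auto
    qed (rule inner)
  qed
  have "{{g \<in> G0. g s \<in> A} | s A. s \<in> {0..1} \<and> A \<in> sets borel} \<subseteq> sets S"
  proof clarify
    fix s :: real and A :: "real set" assume "s \<in> {0..1}" "A \<in> sets borel"
    then have "(\<lambda>g. g s) -` A \<inter> space S \<in> sets S" using measurable_sets[OF all] by auto
    moreover have "(\<lambda>g. g s) -` A \<inter> space S = {g \<in> G0. g s \<in> A}" by (auto simp: S)
    ultimately show "{g \<in> G0. g s \<in> A} \<in> sets S" by simp
  qed
  then have "sets Q \<subseteq> sigma_sets G0 (cylinders t)"
    using sets.sigma_sets_subset[of _ S] unfolding sets_Q G0_sets_def S by blast
  with le show ?thesis by (rule equalityI)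
qed

lemma Int_stable_cylinders: "Int_stable (cylinders t)"
proof (rule Int_stableI)
  fix X Y assume "X \<in> cylinders t" "Y \<in> cylinders t"
  then obtain J A J' A' where X: "X = {g \<in> G0. \<forall>s\<in>J. g s \<in> A s}" "finite J" "J \<subseteq> {0<..<1}" "t \<in> J" "\<And>s. A s \<in> sets borel"
    and Y: "Y = {g \<in> G0. \<forall>s\<in>J'. g s \<in> A' s}" "finite J'" "J' \<subseteq> {0<..<1}" "t \<in> J'" "\<And>s. A' s \<in> sets borel"
    unfolding cylinders_def by (elim CollectE exE conjE) blast
  have "X \<inter> Y = {g \<in> G0. \<forall>s\<in>J \<union> J'. g s \<in> (if s \<in> J then A s else UNIV) \<inter> (if s \<in> J' then A' s else UNIV)}"
    unfolding X(1) Y(1) by auto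
  then show "X \<inter> Y \<in> cylinders t"
    unfolding cylinders_def using X Y
    by (intro CollectI exI[of _ "J \<union> J'"]
        exI[of _ "\<lambda>s. (if s \<in> J then A s else UNIV) \<inter> (if s \<in> J' then A' s else UNIV)"]) auto
qed

text \<open>Dynkin's uniqueness theorem: the indicator of a cylinder is a function of finitely many
  coordinates, one of them at \<open>t\<close>, so the finite-dimensional resampling identity
  applies to it.\<close>

lemma distr_move:
  assumes t: "0 < t" "t < 1"
  shows "distr (Q \<Otimes>\<^sub>M law t) Q (\<lambda>(g, \<theta>). move t g \<theta>) = Q"
proof -
  interpret L: prob_space "law t" by (rule prob_space_law)
  interpret QL: pair_sigma_finite Q "law t" ..
  have mv [measurable]: "(\<lambda>(g, \<theta>). move t g \<theta>) \<in> measurable (Q \<Otimes>\<^sub>M law t) Q"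
    using move_measurable[OF t] by (simp cong: measurable_cong_sets sets_pair_measure_cong)
  show ?thesis
  proof (rule measure_eqI_generator_eq[OF Int_stable_cylinders[of t], where \<Omega>=G0 and A="\<lambda>_. G0"])
    show "cylinders t \<subseteq> Pow G0" by (auto simp: cylinders_def)
    show "sets (distr (Q \<Otimes>\<^sub>M law t) Q (\<lambda>(g, \<theta>). move t g \<theta>)) = sigma_sets G0 (cylinders t)"
      "sets Q = sigma_sets G0 (cylinders t)"
      using sigma_cylinders[OF t] by simp_all
    have "{g \<in> G0. \<forall>s\<in>{t}. g s \<in> UNIV} \<in> cylinders t"
      unfolding cylinders_def using t by (intro CollectI exI[of _ "{t}"] exI[of _ "\<lambda>_. UNIV"]) auto
    then show "range (\<lambda>_::nat. G0) \<subseteq> cylinders t" by auto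
    show "emeasure (distr (Q \<Otimes>\<^sub>M law t) Q (\<lambda>(g, \<theta>). move t g \<theta>)) G0 \<noteq> \<infinity>" for i :: nat
    proof -
      have "prob_space (Q \<Otimes>\<^sub>M law t)" by (rule prob_space_pair) unfold_locales
      then interpret D: prob_space "distr (Q \<Otimes>\<^sub>M law t) Q (\<lambda>(g, \<theta>). move t g \<theta>)"
        by (rule prob_space.prob_space_distr) (rule mv)
      show ?thesis by simp
    qed
  next
    fix X assume "X \<in> cylinders t"
    then obtain J A where X: "X = {g \<in> G0. \<forall>s\<in>J. g s \<in> A s}" and J: "finite J" "J \<subseteq> {0<..<1}" "t \<in> J"
      and A: "\<And>s. A s \<in> sets borel"
      unfolding cylinders_def by blast
    have XQ: "X \<in> sets Q" using \<open>X \<in> cylinders t\<close> sigma_cylinders[OF t] by (metis sigma_sets.Basic)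
    obtain N k \<tau> where D: "dirichlet \<beta> N k \<tau>" and \<tau>: "\<tau> k = t" "\<tau> ` {1..N} = J"
      using partition_of_finite_set[OF J beta_pos] by blast
    define F where "F = (indicator {y \<in> space (PiM {1..N} (\<lambda>_. lborel)). \<forall>i\<in>{1..N}. y i \<in> A (\<tau> i)} :: _ \<Rightarrow> ennreal)"
    have F: "F \<in> borel_measurable (PiM {1..N} (\<lambda>_. lborel))"
      unfolding F_def
      by (intro borel_measurable_indicator sets.sets_Collect_finite_All
          measurable_sets_Collect[OF measurable_component_singleton]) (use A in auto)
    have ind: "indicator X g = F (\<lambda>i\<in>{1..N}. g (\<tau> i))" if "g \<in> G0" for g
      using that unfolding X F_def \<tau>(2)[symmetric] by (auto simp: indicator_def space_PiM)
    have "emeasure (distr (Q \<Otimes>\<^sub>M law t) Q (\<lambda>(g, \<theta>). move t g \<theta>)) X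
      = (\<integral>\<^sup>+ g. indicator X g \<partial>distr (Q \<Otimes>\<^sub>M law t) Q (\<lambda>(g, \<theta>). move t g \<theta>))"
      using XQ by simp
    also have "\<dots> = (\<integral>\<^sup>+ x. indicator X (case x of (g, \<theta>) \<Rightarrow> move t g \<theta>) \<partial>(Q \<Otimes>\<^sub>M law t))"
      using XQ by (intro nn_integral_distr mv) auto
    also have "\<dots> = (\<integral>\<^sup>+ \<theta>. \<integral>\<^sup>+ g. indicator X (case (g, \<theta>) of (g, \<theta>) \<Rightarrow> move t g \<theta>) \<partial>Q \<partial>law t)"
      by (rule QL.nn_integral_snd[symmetric])
         (rule measurable_compose[OF mv borel_measurable_indicator[OF XQ]])
    also have "\<dots> = (\<integral>\<^sup>+ \<theta>. \<integral>\<^sup>+ g. F (\<lambda>i\<in>{1..N}. move t g \<theta> (\<tau> i)) \<partial>Q \<partial>law t)"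
      by (intro nn_integral_cong) (simp only: prod.case ind move_G0[OF _ t] space_Q)
    also have "\<dots> = (\<integral>\<^sup>+ g. F (\<lambda>i\<in>{1..N}. g (\<tau> i)) \<partial>Q)"
      using nn_integral_move_coordinates[OF D F] by (simp only: \<tau>(1))
    also have "\<dots> = (\<integral>\<^sup>+ g. indicator X g \<partial>Q)"
      by (intro nn_integral_cong) (simp only: ind space_Q)
    also have "\<dots> = emeasure Q X" using XQ by simp
    finally show "emeasure (distr (Q \<Otimes>\<^sub>M law t) Q (\<lambda>(g, \<theta>). move t g \<theta>)) X = emeasure Q X" .
  qed auto
qed

lemma nn_integral_move:
  assumes t: "0 < t" "t < 1" and f: "f \<in> borel_measurable Q"
  shows "(\<integral>\<^sup>+ g. \<integral>\<^sup>+ \<theta>. f (move t g \<theta>) \<partial>law t \<partial>Q) = (\<integral>\<^sup>+ g. f g \<partial>Q)"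
proof -
  interpret L: prob_space "law t" by (rule prob_space_law)
  have mv: "(\<lambda>(g, \<theta>). move t g \<theta>) \<in> measurable (Q \<Otimes>\<^sub>M law t) Q"
    using move_measurable[OF t] by (simp cong: measurable_cong_sets sets_pair_measure_cong)
  have "(\<integral>\<^sup>+ g. f g \<partial>Q) = (\<integral>\<^sup>+ g. f g \<partial>distr (Q \<Otimes>\<^sub>M law t) Q (\<lambda>(g, \<theta>). move t g \<theta>))"
    by (simp only: distr_move[OF t])
  also have "\<dots> = (\<integral>\<^sup>+ x. f (case x of (g, \<theta>) \<Rightarrow> move t g \<theta>) \<partial>(Q \<Otimes>\<^sub>M law t))"
    using f by (intro nn_integral_distr mv) auto
  also have "\<dots> = (\<integral>\<^sup>+ g. \<integral>\<^sup>+ \<theta>. f (move t g \<theta>) \<partial>law t \<partial>Q)"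
    using L.nn_integral_fst[OF measurable_compose[OF mv f]] by simp
  finally show ?thesis by simp
qed

text \<open>The Beta density is continuous and positive on \<open>{a..b}\<close>, hence at least its
  minimum there. It may degenerate near 0 and 1, which is why the interval stays inside
  (0,1).\<close>

lemma law_lower_bound:
  assumes t: "0 < t" "t < 1" and ab: "0 < a" "a \<le> b" "b < 1"
  shows "\<exists>c. c \<noteq> 0 \<and> (\<forall>f\<in>borel_measurable borel. c * (\<integral>\<^sup>+ \<theta>. f \<theta> * indicator {a..b} \<theta> \<partial>lborel) \<le> (\<integral>\<^sup>+ \<theta>. f \<theta> \<partial>law t))"
proof -
  obtain N k \<tau> where D: "dirichlet \<beta> N k \<tau>" and tk: "\<tau> k = t"
    using partition_of_finite_set[of "{t}" t \<beta>] t beta_pos by auto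
  interpret dirichlet \<beta> N k \<tau> by (rule D)
  define w where "w p = p powr (\<beta> * \<tau> k - 1) * (1 - p) powr (\<beta> * (1 - \<tau> k) - 1)" for p
  have "continuous_on {a..b} w"
    unfolding w_def using ab by (intro continuous_intros) auto
  then obtain x where x: "x \<in> {a..b}" "\<And>y. y \<in> {a..b} \<Longrightarrow> w x \<le> w y"
    using continuous_attains_inf[of "{a..b}" w] ab by auto
  have wx: "w x > 0" using x(1) ab by (auto simp: w_def)
  define E where "E = (\<integral>\<^sup>+ r. rest_w r \<partial>R)"
  have E: "E \<noteq> 0" using law_density[OF D] by (simp add: E_def)
  show ?thesis
  proof (intro exI[of _ "ennreal (w x) * E"] conjI ballI)
    show "ennreal (w x) * E \<noteq> 0" using wx E by simp
    fix f :: "real \<Rightarrow> ennreal" assume f [measurable]: "f \<in> borel_measurable borel"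
    have "ennreal (w x) * E * (\<integral>\<^sup>+ \<theta>. f \<theta> * indicator {a..b} \<theta> \<partial>lborel)
      = (\<integral>\<^sup>+ \<theta>. ennreal (w x) * (f \<theta> * indicator {a..b} \<theta>) \<partial>lborel) * E"
      by (subst nn_integral_cmult) (auto simp: mult_ac)
    also have "\<dots> \<le> (\<integral>\<^sup>+ \<theta>. beta_w \<theta> * f \<theta> \<partial>lborel) * E"
    proof (intro mult_right_mono nn_integral_mono)
      fix \<theta> :: real
      show "ennreal (w x) * (f \<theta> * indicator {a..b} \<theta>) \<le> beta_w \<theta> * f \<theta>"
      proof (cases "\<theta> \<in> {a..b}")
        case True
        then have "beta_w \<theta> = ennreal (w \<theta>)" using ab by (simp add: beta_w_def w_def)
        then show ?thesis using True x(2)[OF True] by (auto intro!: mult_right_mono ennreal_leI)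
      qed auto
    qed auto
    also have "\<dots> = (\<integral>\<^sup>+ \<theta>. f \<theta> \<partial>law t)"
      using nn_integral_law[OF D f] by (simp add: tk E_def)
    finally show "ennreal (w x) * E * (\<integral>\<^sup>+ \<theta>. f \<theta> * indicator {a..b} \<theta> \<partial>lborel) \<le> (\<integral>\<^sup>+ \<theta>. f \<theta> \<partial>law t)" .
  qed
qed

text \<open>Absolute continuity, the counterpart of the lower bound: it carries conclusions on a
  fibre from Lebesgue measure back to \<open>law t\<close>.\<close>

lemma law_null:
  assumes t: "0 < t" "t < 1" and f: "f \<in> borel_measurable borel"
    and "AE \<theta> in lborel. 0 < \<theta> \<longrightarrow> \<theta> < 1 \<longrightarrow> f \<theta> = 0"
  shows "(\<integral>\<^sup>+ \<theta>. f \<theta> \<partial>law t) = 0"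
proof -
  obtain N k \<tau> where D: "dirichlet \<beta> N k \<tau>" and tk: "\<tau> k = t"
    using partition_of_finite_set[of "{t}" t \<beta>] t beta_pos by auto
  interpret dirichlet \<beta> N k \<tau> by (rule D)
  have "AE \<theta> in lborel. beta_w \<theta> * f \<theta> = 0"
    using assms(4) by eventually_elim (auto simp: beta_w_def indicator_def)
  then have "(\<integral>\<^sup>+ \<theta>. beta_w \<theta> * f \<theta> \<partial>lborel) = 0"
    using f by (subst nn_integral_0_iff_AE) auto
  then show ?thesis using nn_integral_law[OF D f] by (simp add: tk)
qed

end

section \<open>Determining a function from its pairings with tents\<close>

text \<open>The positive and negative parts of \<open>h\<close> are densities of two finite measures
  that agree on all half lines and therefore coincide.\<close>

lemma AE_zero_if_tail_integrals_zero:
  fixes h :: "real \<Rightarrow> real"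
  assumes h: "integrable lborel h" and zero: "\<And>x. (\<integral>s. h s * indicator {x<..} s \<partial>lborel) = 0"
  shows "AE s in lborel. h s = 0"
proof -
  have [measurable]: "h \<in> borel_measurable borel" using h by auto
  define M where "M = density lborel (\<lambda>s. ennreal (h s))"
  define N where "N = density lborel (\<lambda>s. ennreal (- h s))"
  have fin: "(\<integral>\<^sup>+ s. ennreal (h s) \<partial>lborel) < \<infinity>" "(\<integral>\<^sup>+ s. ennreal (- h s) \<partial>lborel) < \<infinity>"
  proof -
    have "(\<integral>\<^sup>+ s. ennreal (norm (h s)) \<partial>lborel) < \<infinity>" using h by (simp add: integrable_iff_bounded)
    moreover have "(\<integral>\<^sup>+ s. ennreal (h s) \<partial>lborel) \<le> (\<integral>\<^sup>+ s. ennreal (norm (h s)) \<partial>lborel)"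
      "(\<integral>\<^sup>+ s. ennreal (- h s) \<partial>lborel) \<le> (\<integral>\<^sup>+ s. ennreal (norm (h s)) \<partial>lborel)"
      by (auto intro!: nn_integral_mono ennreal_leI)
    ultimately show "(\<integral>\<^sup>+ s. ennreal (h s) \<partial>lborel) < \<infinity>" "(\<integral>\<^sup>+ s. ennreal (- h s) \<partial>lborel) < \<infinity>"
      by (auto dest: le_less_trans)
  qed
  have M: "emeasure M {x<..} = (\<integral>\<^sup>+ s. ennreal (h s * indicator {x<..} s) \<partial>lborel)" for x
    unfolding M_def by (subst emeasure_density) (auto intro!: nn_integral_cong simp: indicator_def)
  have N: "emeasure N {x<..} = (\<integral>\<^sup>+ s. ennreal (- (h s * indicator {x<..} s)) \<partial>lborel)" for x
    unfolding N_def by (subst emeasure_density) (auto intro!: nn_integral_cong simp: indicator_def)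
  have Mfin: "emeasure M {x<..} < \<infinity>" for x
    unfolding M by (rule le_less_trans[OF nn_integral_mono fin(1)]) (auto simp: indicator_def)
  have Nfin: "emeasure N {x<..} < \<infinity>" for x
    unfolding N by (rule le_less_trans[OF nn_integral_mono fin(2)]) (auto simp: indicator_def)
  have "M = N"
  proof (rule measure_eqI_lessThan)
    show "emeasure M {x<..} < \<infinity>" for x by (rule Mfin)
    show "emeasure M {x<..} = emeasure N {x<..}" for x
    proof -
      have "integrable lborel (\<lambda>s. h s * indicator {x<..} s)"
        using h by (rule integrable_real_mult_indicator[rotated]) simp
      from real_lebesgue_integral_def[OF this]
      have "enn2real (emeasure M {x<..}) = enn2real (emeasure N {x<..})"
        using zero[of x] by (simp add: M N)
      then show ?thesis using Mfin[of x] Nfin[of x]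
        by (metis ennreal_enn2real infinity_ennreal_def)
    qed
  qed (auto simp: M_def N_def)
  \<comment> \<open>\<open>ennreal\<close> truncates negative numbers to 0, so the two sides are the
    positive and the negative part; equality forces both to vanish.\<close>
  then have "AE s in lborel. ennreal (h s) = ennreal (- h s)"
    unfolding M_def N_def by (subst (asm) finite_density_unique) (use fin(1) in auto)
  then show ?thesis
    by eventually_elim (metis ennreal_eq_0_iff linorder_le_cases neg_0_le_iff_le neg_le_0_iff_le order_antisym)
qed

text \<open>Endpoints come from a dense set \<open>X\<close> because convergence of functions on a
  fibre is known almost everywhere and not at prescribed points. Integrability is local because the
  derivatives on a fibre are controlled on compact subintervals of (0,1).\<close>

lemma AE_zero_if_interval_integrals_zero:
  fixes h :: "real \<Rightarrow> real"
  assumes X: "X \<subseteq> {0<..<1}" "\<And>x y. 0 \<le> x \<Longrightarrow> x < y \<Longrightarrow> y \<le> 1 \<Longrightarrow> \<exists>z\<in>X. x < z \<and> z < y"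
    and int: "\<And>a b. a \<in> X \<Longrightarrow> b \<in> X \<Longrightarrow> a < b \<Longrightarrow> integrable lborel (\<lambda>s. h s * indicator {a..b} s)"
    and zero: "\<And>a b. a \<in> X \<Longrightarrow> b \<in> X \<Longrightarrow> a < b \<Longrightarrow> (\<integral>s. h s * indicator {a..b} s \<partial>lborel) = 0"
  shows "AE s in lborel. s \<in> {0<..<1} \<longrightarrow> h s = 0"
proof -
  have 1: "AE s in lborel. h s * indicator {a..b} s = 0" if ab: "a \<in> X" "b \<in> X" "a < b" for a b
  proof (rule AE_zero_if_tail_integrals_zero[OF int[OF ab]])
    fix x
    consider "x < a" | "a \<le> x" "x < b" | "b \<le> x" by linarith
    then show "(\<integral>s. h s * indicator {a..b} s * indicator {x<..} s \<partial>lborel) = 0"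
    proof cases
      case 1
      then have "(\<lambda>s. h s * indicator {a..b} s * indicator {x<..} s) = (\<lambda>s. h s * indicator {a..b} s)"
        by (auto simp: indicator_def fun_eq_iff)
      then show ?thesis using zero[OF ab] by simp
    next
      case 3
      then have "(\<lambda>s. h s * indicator {a..b} s * indicator {x<..} s) = (\<lambda>s. 0)"
        by (auto simp: indicator_def fun_eq_iff)
      then show ?thesis by simp
    next
      case 2
      have x01: "0 \<le> x" "b \<le> 1" using 2 ab X(1) by auto
      \<comment> \<open>The tail of \<open>{a..b}\<close> beyond \<open>x\<close> is wanted, but
        \<open>x\<close> may lie outside \<open>X\<close>; it is approached from the right by points
        of \<open>X\<close>.\<close>
      have "\<exists>z\<in>X. x < z \<and> z < min b (x + 1 / real (Suc n))" for n
        using X(2)[of x "min b (x + 1 / real (Suc n))"] 2 x01 by (auto simp: min_less_iff_conj)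
      then obtain z where z: "\<And>n. z n \<in> X" "\<And>n. x < z n" "\<And>n. z n < b" "\<And>n. z n < x + 1 / real (Suc n)"
        by (metis min_less_iff_conj)
      have "(\<lambda>n. 1 / real (Suc n)) \<longlonglongrightarrow> 0" by (rule LIMSEQ_Suc[OF lim_1_over_n])
      then have "(\<lambda>n. x + 1 / real (Suc n)) \<longlonglongrightarrow> x + 0" by (intro tendsto_intros)
      then have zl: "z \<longlonglongrightarrow> x"
        by (intro tendsto_sandwich[OF _ _ tendsto_const, of x z _ "\<lambda>n. x + 1 / real (Suc n)"])
           (use z in \<open>auto intro!: always_eventually less_imp_le\<close>)
      have "(\<lambda>n. \<integral>s. h s * indicator {z n..b} s \<partial>lborel) \<longlonglongrightarrow> (\<integral>s. h s * indicator {a..b} s * indicator {x<..} s \<partial>lborel)"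
      proof (rule integral_dominated_convergence)
        show "integrable lborel (\<lambda>s. norm (h s * indicator {a..b} s))" using int[OF ab] by simp
        show "(\<lambda>s. h s * indicator {a..b} s * indicator {x<..} s) \<in> borel_measurable lborel"
          by (intro borel_measurable_times[OF borel_measurable_integrable[OF int[OF ab]]]) simp
        show "(\<lambda>s. h s * indicator {z n..b} s) \<in> borel_measurable lborel" for n
          using int[OF z(1) ab(2) z(3)] by auto
        show "AE s in lborel. norm (h s * indicator {z n..b} s) \<le> norm (h s * indicator {a..b} s)" for n
          using z(2)[of n] 2 by (auto simp: indicator_def)
        show "AE s in lborel. (\<lambda>n. h s * indicator {z n..b} s) \<longlonglongrightarrow> h s * indicator {a..b} s * indicator {x<..} s"
        proof (rule AE_I2)
          fix s
          show "(\<lambda>n. h s * indicator {z n..b} s) \<longlonglongrightarrow> h s * indicator {a..b} s * indicator {x<..} s"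
          proof (cases "x < s")
            case True
            then have "\<forall>\<^sub>F n in sequentially. z n < s" by (rule order_tendstoD(2)[OF zl])
            then have "\<forall>\<^sub>F n in sequentially. h s * indicator {z n..b} s = h s * indicator {a..b} s * indicator {x<..} s"
              by eventually_elim (use True 2 in \<open>auto simp: indicator_def\<close>)
            then show ?thesis by (rule tendsto_eventually)
          next
            case False
            then have "indicator {z n..b} s = (0 :: real)" for n using z(2)[of n] by (auto simp: indicator_def)
            then show ?thesis using False by simp
          qed
        qed
      qed
      moreover have "(\<integral>s. h s * indicator {z n..b} s \<partial>lborel) = 0" for n
        by (rule zero[OF z(1) ab(2) z(3)])
      ultimately show ?thesis by (simp add: LIMSEQ_const_iff)
    qed
  qed
  \<comment> \<open>The shift by 3 keeps \<open>a n\<close> below 1/3 and, below, \<open>b n\<close>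
    above 2/3, so \<open>a n < b n\<close> for every \<open>n\<close>.\<close>
  have "\<exists>a\<in>X. 0 < a \<and> a < 1 / real (n + 3)" for n by (rule X(2)) auto
  then obtain a where a: "\<And>n. a n \<in> X" "\<And>n. a n < 1 / real (n + 3)" by metis
  have "\<exists>b\<in>X. 1 - 1 / real (n + 3) < b \<and> b < 1" for n by (rule X(2)) auto
  then obtain b where b: "\<And>n. b n \<in> X" "\<And>n. 1 - 1 / real (n + 3) < b n" by metis
  have ab: "a n < b n" for n
  proof -
    have "1 / real (n + 3) \<le> 1 / 3" by (intro divide_left_mono) auto
    then show ?thesis using a(2)[of n] b(2)[of n] by linarith
  qed
  have "AE s in lborel. \<forall>n. h s * indicator {a n..b n} s = 0"
    unfolding AE_all_countable using 1[OF a(1) b(1) ab] by simp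
  then show ?thesis
  proof eventually_elim
    case (elim s)
    show ?case
    proof
      assume s: "s \<in> {0<..<1}"
      then have "0 < min s (1 - s)" by auto
      then obtain n where n: "1 / real (Suc n) < min s (1 - s)"
        using nat_approx_posE by blast
      have "1 / real (n + 3) \<le> 1 / real (Suc n)" by (intro divide_left_mono) auto
      then have "s \<in> {a n..b n}" using n a(2)[of n] b(2)[of n] by auto
      then show "h s = 0" using elim[rule_format, of n] by simp
    qed
  qed
qed

text \<open>The derivative of \<open>move t g \<theta>\<close> with respect to \<open>\<theta>\<close>.\<close>

definition tent :: "real \<Rightarrow> (real \<Rightarrow> real) \<Rightarrow> real \<Rightarrow> real" where
  "tent t g s = (if s < t then g s / g t else if s \<le> 1 then (1 - g s) / (1 - g t) else 0)"

lemma Rats_dense_01: "0 \<le> x \<Longrightarrow> x < y \<Longrightarrow> y \<le> 1 \<Longrightarrow> \<exists>z\<in>\<rat> \<inter> {0<..<1}. x < z \<and> z < (y::real)"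
  using Rats_dense_in_real[of x y] by force

lemma integrable_unit_leb_iff:
  fixes f :: "real \<Rightarrow> real"
  assumes "f \<in> borel_measurable borel"
  shows "integrable unit_leb f \<longleftrightarrow> integrable lborel (\<lambda>s. indicator {0..1} s * f s)"
  unfolding unit_leb_def using assms by (subst integrable_density) auto

text \<open>Let \<open>A\<close> integrate \<open>D * g\<close> left of \<open>t\<close>, let
  \<open>B\<close> integrate \<open>D * (1 - g)\<close> right of it, and let
  \<open>C = A - B\<close>. The vanishing pairing says \<open>A = g * C\<close>. Formally
  \<open>dA = g * D ds\<close> and \<open>dC = D ds\<close>, so differentiating
  \<open>A = g * C\<close> leaves \<open>C dg = 0\<close>; as \<open>g\<close> increases strictly,
  \<open>C = 0\<close> and then \<open>D = 0\<close>. The proof does this with increments, since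
  \<open>g\<close> need not be differentiable.\<close>

lemma tent_total:
  assumes g: "g \<in> G0" and strict: "\<And>s t. 0 \<le> s \<Longrightarrow> s < t \<Longrightarrow> t \<le> 1 \<Longrightarrow> g s < g t"
    and gm [measurable]: "g \<in> borel_measurable borel"
    and D: "integrable unit_leb D"
    and zero: "\<And>t. t \<in> \<rat> \<inter> {0<..<1} \<Longrightarrow> (\<integral>s. D s * tent t g s \<partial>unit_leb) = 0"
  shows "AE s in unit_leb. D s = 0"
proof -
  have Dm [measurable]: "D \<in> borel_measurable borel" using borel_measurable_integrable[OF D] by simp
  have int: "integrable unit_leb (\<lambda>s. D s * f s)" if "f \<in> borel_measurable borel" "\<And>s. \<bar>f s\<bar> \<le> 1" for f
  proof (rule Bochner_Integration.integrable_bound[OF D])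
    show "(\<lambda>s. D s * f s) \<in> borel_measurable unit_leb" using that(1) by measurable
    show "AE s in unit_leb. norm (D s * f s) \<le> norm (D s)"
      using that(2) by (intro AE_I2) (simp add: abs_mult mult_left_le)
  qed
  have gr: "0 \<le> g s" "g s \<le> 1" for s using G0_range[OF g, of s] by auto
  define A where "A t = (\<integral>s. D s * (g s * indicator {..<t} s) \<partial>unit_leb)" for t
  define B where "B t = (\<integral>s. D s * ((1 - g s) * indicator {t..} s) \<partial>unit_leb)" for t
  define C where "C t = A t - B t" for t
  have iA: "integrable unit_leb (\<lambda>s. D s * (g s * indicator {..<t} s))" for t
    by (intro int) (use gr in \<open>auto simp: indicator_def\<close>)
  have iB: "integrable unit_leb (\<lambda>s. D s * ((1 - g s) * indicator {t..} s))" for t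
    by (intro int) (use gr in \<open>auto simp: indicator_def\<close>)
  have iI: "integrable unit_leb (\<lambda>s. D s * indicator {s1..<t} s)" for s1 t
    by (intro int) (auto simp: indicator_def)
  have igI: "integrable unit_leb (\<lambda>s. D s * (g s * indicator {s1..<t} s))" for s1 t
    by (intro int) (use gr in \<open>auto simp: indicator_def\<close>)
  have AC: "A t = g t * C t" and gt: "0 < g t" "g t < 1" if t: "t \<in> \<rat> \<inter> {0<..<1}" for t
  proof -
    have t01: "0 < t" "t < 1" using t by auto
    show gt: "0 < g t" "g t < 1"
      using strict[of 0 t] strict[of t 1] gr[of 0] G0_one[OF g] t01 by auto
    have "0 = (\<integral>s. D s * tent t g s \<partial>unit_leb)" using zero[OF t] by simp
    also have "\<dots> = (\<integral>s. D s * (g s * indicator {..<t} s) / g t + D s * ((1 - g s) * indicator {t..} s) / (1 - g t) \<partial>unit_leb)"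
    proof (rule integral_cong_AE)
      show "(\<lambda>s. D s * tent t g s) \<in> borel_measurable unit_leb" unfolding tent_def by measurable
      show "(\<lambda>s. D s * (g s * indicator {..<t} s) / g t + D s * ((1 - g s) * indicator {t..} s) / (1 - g t)) \<in> borel_measurable unit_leb"
        by measurable
      show "AE s in unit_leb. D s * tent t g s = D s * (g s * indicator {..<t} s) / g t + D s * ((1 - g s) * indicator {t..} s) / (1 - g t)"
        by (rule AE_unit_leb_I) (auto simp: tent_def indicator_def)
    qed
    also have "\<dots> = A t / g t + B t / (1 - g t)"
      unfolding A_def B_def using iA iB
      by (subst Bochner_Integration.integral_add) auto
    finally have "A t * (1 - g t) + B t * g t = 0" using gt by (simp add: field_simps)
    then show "A t = g t * C t" by (simp add: C_def algebra_simps)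
  qed
  have dA: "A t - A s = (\<integral>r. D r * (g r * indicator {s..<t} r) \<partial>unit_leb)" if "s < t" for s t
    unfolding A_def Bochner_Integration.integral_diff[OF iA iA, symmetric]
    by (intro Bochner_Integration.integral_cong) (use that in \<open>auto simp: indicator_def\<close>)
  have dC: "C t - C s = (\<integral>r. D r * indicator {s..<t} r \<partial>unit_leb)" if "s < t" for s t
  proof -
    have "B s - B t = (\<integral>r. D r * ((1 - g r) * indicator {s..<t} r) \<partial>unit_leb)"
      unfolding B_def Bochner_Integration.integral_diff[OF iB iB, symmetric]
      by (intro Bochner_Integration.integral_cong) (use that in \<open>auto simp: indicator_def\<close>)
    moreover have "integrable unit_leb (\<lambda>r. D r * ((1 - g r) * indicator {s..<t} r))"
      by (intro int) (use gr in \<open>auto simp: indicator_def\<close>)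
    ultimately have "(A t - A s) + (B s - B t) = (\<integral>r. D r * (g r * indicator {s..<t} r) + D r * ((1 - g r) * indicator {s..<t} r) \<partial>unit_leb)"
      using dA[OF that] igI by simp
    also have "\<dots> = (\<integral>r. D r * indicator {s..<t} r \<partial>unit_leb)"
      by (intro Bochner_Integration.integral_cong) (auto simp: algebra_simps)
    finally show ?thesis by (simp add: C_def)
  qed
  have bound: "\<bar>C s\<bar> \<le> (\<integral>r. \<bar>D r\<bar> * indicator {s..<t} r \<partial>unit_leb)"
    if st: "s \<in> \<rat> \<inter> {0<..<1}" "t \<in> \<rat> \<inter> {0<..<1}" "s < t" for s t
  proof -
    have pos: "0 < g t - g s" using strict[of s t] st by auto
    \<comment> \<open>Product rule for increments: inserting \<open>A = g * C\<close> at both ends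
      cancels \<open>C t\<close>. The right side integrates \<open>D * (g - g t)\<close> over
      \<open>{s..<t}\<close>, where \<open>g - g t\<close> is at most \<open>g t - g s\<close> in
      absolute value, so this factor can be divided out.\<close>
    have "(g t - g s) * C s = (A t - A s) - g t * (C t - C s)"
      using AC[OF st(1)] AC[OF st(2)] by (simp add: algebra_simps)
    also have "\<dots> = (\<integral>r. D r * (g r * indicator {s..<t} r) - g t * (D r * indicator {s..<t} r) \<partial>unit_leb)"
      using iI igI by (simp add: dA[OF st(3)] dC[OF st(3)])
    finally have "(g t - g s) * \<bar>C s\<bar> = \<bar>\<integral>r. D r * (g r * indicator {s..<t} r) - g t * (D r * indicator {s..<t} r) \<partial>unit_leb\<bar>"
      using pos by (metis abs_mult abs_of_pos)
    also have "\<dots> \<le> (\<integral>r. (g t - g s) * (\<bar>D r\<bar> * indicator {s..<t} r) \<partial>unit_leb)"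
    proof (rule integral_abs_bound[THEN order_trans], rule integral_mono)
      show "integrable unit_leb (\<lambda>r. \<bar>D r * (g r * indicator {s..<t} r) - g t * (D r * indicator {s..<t} r)\<bar>)"
        using iI igI by simp
      have "integrable unit_leb (\<lambda>r. \<bar>D r * indicator {s..<t} r\<bar>)" using iI by simp
      then show "integrable unit_leb (\<lambda>r. (g t - g s) * (\<bar>D r\<bar> * indicator {s..<t} r))"
        by (simp add: abs_mult)
      fix r
      show "\<bar>D r * (g r * indicator {s..<t} r) - g t * (D r * indicator {s..<t} r)\<bar> \<le> (g t - g s) * (\<bar>D r\<bar> * indicator {s..<t} r)"
      proof (cases "r \<in> {s..<t}")
        case True
        then have "g s \<le> g r" "g r \<le> g t" using st by (auto intro!: G0_mono[OF g])
        then have "\<bar>g r - g t\<bar> \<le> g t - g s" by auto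
        then have "\<bar>D r\<bar> * \<bar>g r - g t\<bar> \<le> \<bar>D r\<bar> * (g t - g s)" by (rule mult_left_mono) auto
        then show ?thesis using True by (simp add: abs_mult[symmetric] algebra_simps)
      qed auto
    qed
    also have "\<dots> = (g t - g s) * (\<integral>r. \<bar>D r\<bar> * indicator {s..<t} r \<partial>unit_leb)" by simp
    finally show ?thesis using pos by simp
  qed
  have C0: "C s = 0" if s: "s \<in> \<rat> \<inter> {0<..<1}" for s
  proof -
    have "\<exists>z\<in>\<rat> \<inter> {0<..<1}. s < z \<and> z < min 1 (s + 1 / real (Suc n))" for n
      by (rule Rats_dense_01) (use s in auto)
    then obtain z where z: "\<And>n. z n \<in> \<rat> \<inter> {0<..<1}" "\<And>n. s < z n" "\<And>n. z n < s + 1 / real (Suc n)"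
      by (metis min_less_iff_conj)
    have "(\<lambda>n. 1 / real (Suc n)) \<longlonglongrightarrow> 0" by (rule LIMSEQ_Suc[OF lim_1_over_n])
    then have "(\<lambda>n. s + 1 / real (Suc n)) \<longlonglongrightarrow> s + 0" by (intro tendsto_intros)
    then have zl: "z \<longlonglongrightarrow> s"
      by (intro tendsto_sandwich[OF _ _ tendsto_const, of s z _ "\<lambda>n. s + 1 / real (Suc n)"])
         (use z in \<open>auto intro!: always_eventually less_imp_le\<close>)
    have ns: "AE r in unit_leb. r \<noteq> s"
      unfolding AE_unit_leb using AE_lborel_singleton[of s] by eventually_elim auto
    have "(\<lambda>n. \<integral>r. \<bar>D r\<bar> * indicator {s..<z n} r \<partial>unit_leb) \<longlonglongrightarrow> (\<integral>r. 0 \<partial>unit_leb)"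
    proof (rule integral_dominated_convergence[where w="\<lambda>r. \<bar>D r\<bar>"])
      show "AE r in unit_leb. (\<lambda>n. \<bar>D r\<bar> * indicator {s..<z n} r) \<longlonglongrightarrow> 0"
        using ns
      proof eventually_elim
        case (elim r)
        show ?case
        proof (cases "s < r")
          case True
          then have "\<forall>\<^sub>F n in sequentially. z n < r" by (rule order_tendstoD(2)[OF zl])
          then have "\<forall>\<^sub>F n in sequentially. \<bar>D r\<bar> * indicator {s..<z n} r = 0"
            by eventually_elim auto
          then show ?thesis by (rule tendsto_eventually)
        next
          case False then show ?thesis using elim by simp
        qed
      qed
    qed (use D in \<open>auto simp: indicator_def\<close>)
    then have "(\<lambda>n. \<integral>r. \<bar>D r\<bar> * indicator {s..<z n} r \<partial>unit_leb) \<longlonglongrightarrow> 0" by simp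
    then have "\<bar>C s\<bar> \<le> 0"
      by (rule LIMSEQ_le_const) (use bound[OF s z(1) z(2)] in auto)
    then show ?thesis by simp
  qed
  have "AE s in lborel. s \<in> {0<..<1} \<longrightarrow> D s = 0"
  proof (rule AE_zero_if_interval_integrals_zero[where X="\<rat> \<inter> {0<..<1}"])
    fix a b :: real assume ab: "a \<in> \<rat> \<inter> {0<..<1}" "b \<in> \<rat> \<inter> {0<..<1}" "a < b"
    have "integrable lborel (\<lambda>s. indicator {0..1} s * (D s * indicator {a..b} s))"
      using int[of "indicator {a..b}"]
      by (subst integrable_unit_leb_iff[symmetric]) (auto simp: indicator_def)
    moreover have "(\<lambda>s. indicator {0..1} s * (D s * indicator {a..b} s)) = (\<lambda>s. D s * indicator {a..b} s)"
      using ab by (auto simp: indicator_def fun_eq_iff)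
    ultimately show "integrable lborel (\<lambda>s. D s * indicator {a..b} s)" by simp
    have "(\<integral>s. D s * indicator {a..b} s \<partial>lborel) = (\<integral>s. D s * indicator {a..<b} s \<partial>lborel)"
    proof (rule integral_cong_AE)
      show "AE s in lborel. D s * indicator {a..b} s = D s * indicator {a..<b} s"
        using AE_lborel_singleton[of b] by eventually_elim (auto simp: indicator_def)
    qed auto
    also have "\<dots> = (LINT s:{0..1}|lborel. D s * indicator {a..<b} s)"
      unfolding set_lebesgue_integral_def
      by (intro Bochner_Integration.integral_cong) (use ab in \<open>auto simp: indicator_def\<close>)
    also have "\<dots> = C b - C a"
      unfolding dC[OF ab(3)] by (rule LINT_unit_leb) measurable
    finally show "(\<integral>s. D s * indicator {a..b} s \<partial>lborel) = 0" using C0 ab by simp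
  qed (auto intro: Rats_dense_01)
  then show ?thesis unfolding AE_unit_leb
    using AE_lborel_singleton[of "0::real"] AE_lborel_singleton[of "1::real"]
    by eventually_elim (metis atLeastAtMost_iff greaterThanLessThan_iff less_eq_real_def)
qed

section \<open>Closability along fibres\<close>

lemma measurable_unit_leb [simp]: "measurable unit_leb M = measurable borel M"
  by (rule measurable_cong_sets) simp_all

lemma lipschitz_clampf:
  fixes a :: "real \<Rightarrow> real"
  assumes "\<And>s. s \<in> {0..1} \<Longrightarrow> (a has_real_derivative a' s) (at s within {0..1})"
    and "\<And>s. s \<in> {0..1} \<Longrightarrow> \<bar>a' s\<bar> \<le> B"
  shows "\<bar>clampf a x - clampf a y\<bar> \<le> B * \<bar>x - y\<bar>"
proof -
  have "norm (a (max 0 (min 1 x)) - a (max 0 (min 1 y))) \<le> B * norm (max 0 (min 1 x) - max 0 (min 1 y))"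
    by (rule field_differentiable_bound[of "{0..1}"]) (use assms in auto)
  also have "\<dots> \<le> B * \<bar>x - y\<bar>"
  proof (rule mult_left_mono)
    show "0 \<le> B" using assms(2)[of 0] by auto
  qed auto
  finally show ?thesis by (simp add: clampf_def)
qed

text \<open>Differentiation under the integral sign, dominated by the Lipschitz constant of
  \<open>clampf a\<close> since \<open>e\<close> is bounded by 1. The segments stay in [0,1] for
  \<open>\<theta>\<close> in (0,1) only; clamping keeps the difference quotients bounded at any
  other parameter that a sequence visits.\<close>

lemma derivative_along_segments:
  fixes a a' L e :: "real \<Rightarrow> real"
  assumes a: "\<And>s. s \<in> {0..1} \<Longrightarrow> (a has_real_derivative a' s) (at s within {0..1})"
    and a': "continuous_on {0..1} a'"
    and m [measurable]: "L \<in> borel_measurable borel" "e \<in> borel_measurable borel"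
    and e: "\<And>s. \<bar>e s\<bar> \<le> 1"
    and seg: "\<And>s \<theta>. 0 < \<theta> \<Longrightarrow> \<theta> < 1 \<Longrightarrow> L s + \<theta> * e s \<in> {0..1}"
    and \<theta>: "0 < \<theta>" "\<theta> < 1"
  shows "((\<lambda>\<theta>. \<integral>s. clampf a (L s + \<theta> * e s) \<partial>unit_leb) has_real_derivative
      (\<integral>s. clampf a' (L s + \<theta> * e s) * e s \<partial>unit_leb)) (at \<theta>)" (is ?D)
    and "isCont (\<lambda>\<theta>. \<integral>s. clampf a' (L s + \<theta> * e s) * e s \<partial>unit_leb) \<theta>" (is ?C)
proof -
  have ca: "continuous_on {0..1} a" using a by (rule DERIV_continuous_on)
  have [measurable]: "clampf a \<in> borel_measurable borel" "clampf a' \<in> borel_measurable borel"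
    using continuous_on_clampf[OF ca] continuous_on_clampf[OF a'] by (auto intro: borel_measurable_continuous_onI)
  obtain B where B: "B \<ge> 0" "\<And>x. \<bar>clampf a' x\<bar> \<le> B" using clampf_bounded[OF a'] by blast
  obtain B0 where B0: "\<And>x. \<bar>clampf a x\<bar> \<le> B0" using clampf_bounded[OF ca] by blast
  have lip: "\<bar>clampf a x - clampf a y\<bar> \<le> B * \<bar>x - y\<bar>" for x y
    by (rule lipschitz_clampf[OF a]) (use B(2) clampf_eq in metis)+
  have int: "integrable unit_leb (\<lambda>s. clampf a (L s + \<theta> * e s))" for \<theta>
    by (rule integrable_unit_leb_bounded[of _ B0]) (use B0 in auto)
  \<comment> \<open>\<open>a\<close> is differentiable only within [0,1], and the point reached may
    be an endpoint. The chain rule is therefore applied within the open parameter interval, whose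
    image stays in [0,1].\<close>
  have pt: "((\<lambda>\<theta>. clampf a (L s + \<theta> * e s)) has_real_derivative clampf a' (L s + \<theta> * e s) * e s) (at \<theta>)" for s
  proof -
    have "((\<lambda>\<theta>. L s + \<theta> * e s) has_real_derivative e s) (at \<theta> within {0<..<1})"
      by (auto intro!: derivative_eq_intros)
    moreover have "(a has_real_derivative a' (L s + \<theta> * e s)) (at (L s + \<theta> * e s) within (\<lambda>\<theta>. L s + \<theta> * e s) ` {0<..<1})"
      using a[OF seg[OF \<theta>, of s]] by (rule has_field_derivative_subset) (use seg in auto)
    ultimately have "(a \<circ> (\<lambda>\<theta>. L s + \<theta> * e s) has_real_derivative a' (L s + \<theta> * e s) * e s) (at \<theta> within {0<..<1})"
      by (rule DERIV_image_chain[rotated])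
    then have "((\<lambda>\<theta>. a (L s + \<theta> * e s)) has_real_derivative clampf a' (L s + \<theta> * e s) * e s) (at \<theta>)"
      using \<theta> seg[OF \<theta>, of s] by (simp add: o_def at_within_open[of \<theta> "{0<..<1}"])
    then show ?thesis
      by (rule has_field_derivative_transform_within_open[of _ _ _ "{0<..<1}"])
         (use \<theta> seg in auto)
  qed
  show ?D
    unfolding has_field_derivative_iff tendsto_at_iff_sequentially comp_def
  proof (intro allI impI)
    fix X :: "nat \<Rightarrow> real" assume X: "\<forall>i. X i \<in> UNIV - {\<theta>}" "X \<longlonglongrightarrow> \<theta>"
    have "(\<lambda>n. \<integral>s. (clampf a (L s + X n * e s) - clampf a (L s + \<theta> * e s)) / (X n - \<theta>) \<partial>unit_leb)
      \<longlonglongrightarrow> (\<integral>s. clampf a' (L s + \<theta> * e s) * e s \<partial>unit_leb)"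
    proof (rule integral_dominated_convergence[where w="\<lambda>_. B"])
      show "AE s in unit_leb. (\<lambda>n. (clampf a (L s + X n * e s) - clampf a (L s + \<theta> * e s)) / (X n - \<theta>))
        \<longlonglongrightarrow> clampf a' (L s + \<theta> * e s) * e s"
        using pt X unfolding has_field_derivative_iff tendsto_at_iff_sequentially comp_def by blast
      show "AE s in unit_leb. norm ((clampf a (L s + X n * e s) - clampf a (L s + \<theta> * e s)) / (X n - \<theta>)) \<le> B" for n
      proof (rule AE_I2)
        fix s
        have "\<bar>clampf a (L s + X n * e s) - clampf a (L s + \<theta> * e s)\<bar> \<le> B * \<bar>(L s + X n * e s) - (L s + \<theta> * e s)\<bar>"
          by (rule lip)
        also have "(L s + X n * e s) - (L s + \<theta> * e s) = (X n - \<theta>) * e s" by (simp add: algebra_simps)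
        also have "B * \<bar>(X n - \<theta>) * e s\<bar> \<le> B * \<bar>X n - \<theta>\<bar>"
          using e[of s] B(1) by (intro mult_left_mono) (auto simp: abs_mult intro: mult_left_le)
        finally show "norm ((clampf a (L s + X n * e s) - clampf a (L s + \<theta> * e s)) / (X n - \<theta>)) \<le> B"
          using X(1) by (simp add: abs_divide divide_le_eq)
      qed
    qed simp_all
    then show "(\<lambda>n. ((\<integral>s. clampf a (L s + X n * e s) \<partial>unit_leb) - (\<integral>s. clampf a (L s + \<theta> * e s) \<partial>unit_leb)) / (X n - \<theta>))
      \<longlonglongrightarrow> (\<integral>s. clampf a' (L s + \<theta> * e s) * e s \<partial>unit_leb)"
      using int by simp
  qed
  show ?C
    unfolding isCont_def tendsto_at_iff_sequentially comp_def
  proof (intro allI impI)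
    fix X :: "nat \<Rightarrow> real" assume X: "X \<longlonglongrightarrow> \<theta>"
    show "(\<lambda>n. \<integral>s. clampf a' (L s + X n * e s) * e s \<partial>unit_leb) \<longlonglongrightarrow> (\<integral>s. clampf a' (L s + \<theta> * e s) * e s \<partial>unit_leb)"
    proof (rule integral_dominated_convergence[where w="\<lambda>_. B"])
      have "isCont (clampf a') x" for x
        using continuous_on_clampf[OF a'] by (simp add: continuous_on_eq_continuous_at)
      then show "AE s in unit_leb. (\<lambda>n. clampf a' (L s + X n * e s) * e s) \<longlonglongrightarrow> clampf a' (L s + \<theta> * e s) * e s"
        by (intro AE_I2 tendsto_intros isCont_tendsto_compose[of _ "clampf a'"] X)
      show "AE s in unit_leb. norm (clampf a' (L s + X n * e s) * e s) \<le> B" for n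
      proof (rule AE_I2)
        fix s
        have "\<bar>clampf a' (L s + X n * e s)\<bar> * \<bar>e s\<bar> \<le> B * 1"
          using B e by (intro mult_mono) auto
        then show "norm (clampf a' (L s + X n * e s) * e s) \<le> B" by (simp add: abs_mult)
      qed
    qed simp_all
  qed
qed

definition move_offset :: "real \<Rightarrow> (real \<Rightarrow> real) \<Rightarrow> real \<Rightarrow> real" where
  "move_offset t g s = (if s < t then 0 else if s \<le> 1 then (g s - g t) / (1 - g t) else 0)"

lemma move_affine:
  assumes "0 < g t" "g t < 1" "0 < \<theta>" "\<theta> < 1"
  shows "move t g \<theta> s = move_offset t g s + \<theta> * tent t g s"
proof -
  define x where "x = (g s - g t) / (1 - g t)"
  have x: "(1 - g s) / (1 - g t) = 1 - x" using assms by (simp add: x_def field_simps)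
  have "\<theta> + (1 - \<theta>) * (g s - g t) / (1 - g t) = x + \<theta> * (1 - x)"
    unfolding times_divide_eq_right[symmetric] x_def[symmetric] by (simp add: algebra_simps)
  then show ?thesis using assms x by (simp add: move_def move_offset_def tent_def x_def)
qed

text \<open>\<open>tent t g\<close> is built from the relative positions on both sides of
  \<open>t\<close>, which resampling preserves. The direction of a fibre is therefore constant along
  it.\<close>

lemma tent_move:
  assumes "0 < g t" "g t < 1" "0 < \<theta>" "\<theta> < 1" "t < 1"
  shows "tent t (move t g \<theta>) s = tent t g s"
proof -
  define x where "x = (g s - g t) / (1 - g t)"
  have x: "(1 - g s) / (1 - g t) = 1 - x" using assms by (simp add: x_def field_simps)
  have "1 - (\<theta> + (1 - \<theta>) * (g s - g t) / (1 - g t)) = (1 - \<theta>) * (1 - x)"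
    unfolding times_divide_eq_right[symmetric] x_def[symmetric] by (simp add: algebra_simps)
  then have "(1 - (\<theta> + (1 - \<theta>) * (g s - g t) / (1 - g t))) / (1 - \<theta>) = 1 - x"
    using assms by simp
  then show ?thesis using assms x by (simp add: move_def tent_def)
qed

lemma tent_bounds:
  assumes g: "g \<in> G0" and t: "0 < t" "t < 1"
  shows "0 \<le> tent t g s" "tent t g s \<le> 1"
proof -
  have r: "0 \<le> g r" "g r \<le> 1" for r using G0_range[OF g, of r] by auto
  have "g s \<le> g t" if "s < t"
  proof (cases "0 \<le> s")
    case True then show ?thesis using G0_mono[OF g, of s t] that t by simp
  next
    case False then have "g s = 0" using g by (auto simp: G0_def)
    then show ?thesis using r by simp
  qed
  moreover have "g t \<le> g s" if "t \<le> s" "s \<le> 1" using G0_mono[OF g, of t s] that t by simp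
  ultimately show "0 \<le> tent t g s" "tent t g s \<le> 1"
    using r by (auto simp: tent_def divide_le_eq_1 intro: order.antisym)
qed

context entropic
begin

lemma tent_measurable:
  assumes t: "0 < t" "t < 1"
  shows "(\<lambda>(g, s). tent t g s) \<in> borel_measurable (Q \<Otimes>\<^sub>M unit_leb)"
proof -
  have e: "(\<lambda>x. fst x (snd x)) \<in> borel_measurable (Q \<Otimes>\<^sub>M unit_leb)"
    using evaluation_measurable by (simp add: case_prod_beta' cong: measurable_cong_sets sets_pair_measure_cong)
  have [measurable]: "(\<lambda>x. fst x t) \<in> borel_measurable (Q \<Otimes>\<^sub>M unit_leb)"
    by (rule measurable_compose[OF measurable_fst]) simp
  have [measurable]: "snd \<in> borel_measurable (Q \<Otimes>\<^sub>M unit_leb)"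
    using measurable_snd[of Q unit_leb] by (simp cong: measurable_cong_sets)
  note e [measurable]
  show ?thesis unfolding tent_def case_prod_beta' by measurable
qed

lemma tent_measurable1:
  assumes "g \<in> G0"
  shows "tent t g \<in> borel_measurable borel" "move_offset t g \<in> borel_measurable borel"
proof -
  note [measurable] = G0_measurable[OF assms]
  show "tent t g \<in> borel_measurable borel" "move_offset t g \<in> borel_measurable borel"
    unfolding tent_def[abs_def] move_offset_def[abs_def] by measurable
qed

text \<open>On a fibre each component of \<open>avec\<close> is an integral of a C^1 function along
  segments, so the chain rule yields the gradient paired with the tent. Continuity of this
  derivative is what the fundamental theorem of calculus will ask for.\<close>

lemma Z1_fiber:
  assumes f: "(f, F) \<in> Z1_graph" and t: "0 < t" "t < 1"
    and g: "g \<in> G0" "0 < g t" "g t < 1" and \<theta>: "0 < \<theta>" "\<theta> < 1"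
  shows "((\<lambda>\<theta>. f (move t g \<theta>)) has_real_derivative (\<integral>s. F (move t g \<theta>) s * tent t g s \<partial>unit_leb)) (at \<theta>)" (is ?D)
    and "isCont (\<lambda>\<theta>. \<integral>s. F (move t g \<theta>) s * tent t g s \<partial>unit_leb) \<theta>" (is ?C)
proof -
  obtain m U D \<alpha> \<alpha>' where U: "C1_Rm m U D" and \<alpha>: "C1_01 m \<alpha> \<alpha>'"
    and feq: "f = (\<lambda>g. U (avec m \<alpha> g))" and Feq: "F = (\<lambda>g t. \<Sum>i<m. D i (avec m \<alpha> g) * \<alpha>' i (g t))"
    using f unfolding Z1_graph_def by blast
  define L where "L = move_offset t g"
  define e where "e = tent t g"
  note m [measurable] = tent_measurable1[OF g(1), of t, folded L_def e_def]
  have e: "\<bar>e s\<bar> \<le> 1" for s using tent_bounds[OF g(1) t, of s] by (simp add: e_def)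
  have aff: "move t g \<theta> s = L s + \<theta> * e s" if "0 < \<theta>" "\<theta> < 1" for \<theta> s
    unfolding L_def e_def by (rule move_affine[where t=t and g=g, OF g(2,3) that])
  have mG: "move t g \<theta> \<in> G0" for \<theta> by (rule move_G0[OF g(1) t])
  have seg: "L s + \<theta> * e s \<in> {0..1}" if "0 < \<theta>" "\<theta> < 1" for \<theta> s
    using G0_range[OF mG, of \<theta> s] unfolding aff[OF that] .
  define a where "a \<theta> j = (if j < m then (\<integral>s. clampf (\<alpha> j) (L s + \<theta> * e s) \<partial>unit_leb) else 0)" for \<theta> j
  define I where "I j \<theta> = (\<integral>s. clampf (\<alpha>' j) (L s + \<theta> * e s) * e s \<partial>unit_leb)" for j \<theta>
  have av: "avec m \<alpha> (move t g \<theta>) = a \<theta>" if "0 < \<theta>" "\<theta> < 1" for \<theta>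
  proof
    fix j
    show "avec m \<alpha> (move t g \<theta>) j = a \<theta> j"
    proof (cases "j < m")
      case True
      then show ?thesis using avec_eq[OF \<alpha> mG True] aff[OF that] seg[OF that] by (simp add: a_def)
    qed (simp add: avec_def a_def)
  qed
  have der: "((\<lambda>\<theta>. a \<theta> j) has_real_derivative I j \<theta>) (at \<theta>)" and cont: "isCont (I j) \<theta>"
    if j: "j < m" and \<theta>: "0 < \<theta>" "\<theta> < 1" for j \<theta>
    using derivative_along_segments[OF _ C1_01_cont(2)[OF \<alpha> j] m(2,1) e seg \<theta>, of "\<alpha> j"] \<alpha> j
    unfolding a_def I_def C1_01_def by auto
  have Fint: "(\<integral>s. F (move t g \<theta>) s * tent t g s \<partial>unit_leb) = (\<Sum>i<m. D i (a \<theta>) * I i \<theta>)" if \<theta>: "0 < \<theta>" "\<theta> < 1" for \<theta>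
  proof -
    have i: "integrable unit_leb (\<lambda>s. clampf (\<alpha>' i) (L s + \<theta> * e s) * e s)" if im: "i < m" for i
    proof -
      obtain B where B: "\<And>x. \<bar>clampf (\<alpha>' i) x\<bar> \<le> B" using clampf_bounded[OF C1_01_cont(2)[OF \<alpha> im]] by blast
      have [measurable]: "clampf (\<alpha>' i) \<in> borel_measurable borel"
        by (rule borel_measurable_continuous_onI[OF continuous_on_clampf[OF C1_01_cont(2)[OF \<alpha> im]]])
      show ?thesis
      proof (rule integrable_unit_leb_bounded[of _ B])
        fix s
        have "\<bar>clampf (\<alpha>' i) (L s + \<theta> * e s)\<bar> * \<bar>e s\<bar> \<le> B * 1"
          using B e by (intro mult_mono) (auto intro: order.trans[OF abs_ge_zero B])
        then show "\<bar>clampf (\<alpha>' i) (L s + \<theta> * e s) * e s\<bar> \<le> B" by (simp add: abs_mult)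
      qed measurable
    qed
    have "(\<integral>s. F (move t g \<theta>) s * tent t g s \<partial>unit_leb)
      = (\<integral>s. (\<Sum>i<m. D i (a \<theta>) * (clampf (\<alpha>' i) (L s + \<theta> * e s) * e s)) \<partial>unit_leb)"
      unfolding Feq av[OF \<theta>] e_def[symmetric] sum_distrib_right
      by (intro Bochner_Integration.integral_cong refl sum.cong) (use aff[OF \<theta>] seg[OF \<theta>] in simp)
    also have "\<dots> = (\<Sum>i<m. \<integral>s. D i (a \<theta>) * (clampf (\<alpha>' i) (L s + \<theta> * e s) * e s) \<partial>unit_leb)"
      by (rule Bochner_Integration.integral_sum) (use i in auto)
    also have "\<dots> = (\<Sum>i<m. D i (a \<theta>) * I i \<theta>)" unfolding I_def using i by simp
    finally show ?thesis .
  qed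
  have "((\<lambda>\<theta>. U (a \<theta>)) has_real_derivative (\<Sum>i<m. D i (a \<theta>) * I i \<theta>)) (at \<theta>)"
    by (rule C1_Rm_chain[OF U]) (use der \<theta> in \<open>auto simp: a_def\<close>)
  then show ?D
    unfolding Fint[OF \<theta>] feq
    by (rule has_field_derivative_transform_within_open[of _ _ _ "{0<..<1}"]) (use \<theta> av in auto)
  have "((\<lambda>\<theta>. a \<theta> j) \<longlongrightarrow> a \<theta> j) (at \<theta>)" for j
  proof (cases "j < m")
    case True then show ?thesis using DERIV_isCont[OF der[OF True \<theta>]] by (simp add: isCont_def)
  qed (simp add: a_def)
  then have "(a \<longlongrightarrow> a \<theta>) (at \<theta>)" by (rule tendsto_coordinatewise)
  then have "((\<lambda>\<theta>. \<Sum>i<m. D i (a \<theta>) * I i \<theta>) \<longlongrightarrow> (\<Sum>i<m. D i (a \<theta>) * I i \<theta>)) (at \<theta>)"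
    using cont \<theta> by (intro tendsto_intros C1_Rm_partial_tendsto[OF U]) (auto simp: isCont_def)
  moreover have "\<forall>\<^sub>F x in at \<theta>. (\<Sum>i<m. D i (a x) * I i x) = (\<integral>s. F (move t g x) s * tent t g s \<partial>unit_leb)"
  proof -
    have "\<forall>\<^sub>F x in at \<theta>. x \<in> {0<..<1}"
      by (rule eventually_at_in_open') (use \<theta> in auto)
    then show ?thesis by eventually_elim (simp add: Fint)
  qed
  ultimately show ?C
    unfolding isCont_def Fint[OF \<theta>] by (rule Lim_transform_eventually)
qed

text \<open>Where the integrand is not integrable the value is the default 0, so vanishing is
  informative only together with integrability of \<open>H g\<close>, which is established
  separately.\<close>

definition tent_integral :: "real \<Rightarrow> ((real \<Rightarrow> real) \<Rightarrow> real \<Rightarrow> real) \<Rightarrow> (real \<Rightarrow> real) \<Rightarrow> real" where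
  "tent_integral t H g = (\<integral>s. H g s * tent t g s \<partial>unit_leb)"

lemma tent_integral_measurable:
  assumes "0 < t" "t < 1" "(\<lambda>(g, s). H g s) \<in> borel_measurable (Q \<Otimes>\<^sub>M unit_leb)"
  shows "tent_integral t H \<in> borel_measurable Q"
proof -
  have "(\<lambda>(g, s). H g s * tent t g s) \<in> borel_measurable (Q \<Otimes>\<^sub>M unit_leb)"
    using borel_measurable_times[OF assms(3) tent_measurable[OF assms(1,2)]] by (simp add: case_prod_beta')
  then show ?thesis unfolding tent_integral_def[abs_def] by (rule unit_leb.borel_measurable_lebesgue_integral)
qed

lemma move_measurable1:
  assumes "0 < t" "t < 1" "g \<in> G0"
  shows "move t g \<in> measurable borel Q"
  using measurable_compose[OF measurable_Pair1'[of g Q borel] move_measurable[OF assms(1,2)]] assms(3)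
  by (simp add: space_Q)

text \<open>One-dimensional closability along the fibre \<open>\<theta> \<mapsto> move t g \<theta>\<close>: the summability
  assumption makes \<open>f n\<close> tend to 0 almost everywhere on the fibre while its derivative tends
  to \<open>tent_integral t H\<close> in \<open>L\<^sup>1\<close>.\<close>

lemma fiber_closable:
  assumes Z: "\<And>n. (f n, F n) \<in> Z1_graph" and t: "0 < t" "t < 1"
    and H: "(\<lambda>(g, s). H g s) \<in> borel_measurable (Q \<Otimes>\<^sub>M unit_leb)"
    and K: "\<And>n. K n = (\<lambda>g. \<integral>\<^sup>+ s. ennreal \<bar>F n g s - H g s\<bar> \<partial>unit_leb)"
    and g: "g \<in> G0" "0 < g t" "g t < 1"
    and fin: "\<And>a b. 0 < a \<Longrightarrow> a < b \<Longrightarrow> b < 1 \<Longrightarrow>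
      (\<integral>\<^sup>+ \<theta>. (\<Sum>n. ennreal \<bar>f n (move t g \<theta>)\<bar> + K n (move t g \<theta>)) * indicator {a..b} \<theta> \<partial>lborel) < \<infinity>"
  shows "AE \<theta> in lborel. \<theta> \<in> {0<..<1} \<longrightarrow> tent_integral t H (move t g \<theta>) = 0"
proof -
  define S where "S g = (\<Sum>n. ennreal \<bar>f n g\<bar> + K n g)" for g
  have Kq [measurable]: "K n \<in> borel_measurable Q" for n
  proof -
    have "(\<lambda>(g, s). ennreal \<bar>F n g s - H g s\<bar>) \<in> borel_measurable (Q \<Otimes>\<^sub>M unit_leb)"
      using Z1_measurable(2)[OF Z[of n]] H by (simp add: case_prod_beta')
    then show ?thesis unfolding K by (rule unit_leb.borel_measurable_nn_integral)
  qed
  note [measurable] = Z1_measurable(1)[OF Z] move_measurable1[OF t g(1)]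
  have Sq [measurable]: "S \<in> borel_measurable Q" unfolding S_def[abs_def] by measurable
  define h where "h \<theta> = tent_integral t H (move t g \<theta>)" for \<theta>
  define \<phi>' where "\<phi>' n \<theta> = (\<integral>s. F n (move t g \<theta>) s * tent t g s \<partial>unit_leb)" for n \<theta>
  have hm [measurable]: "h \<in> borel_measurable borel"
    unfolding h_def[abs_def] using tent_integral_measurable[OF t H] by measurable
  have mG: "move t g \<theta> \<in> G0" for \<theta> by (rule move_G0[OF g(1) t])
  note tm [measurable] = tent_measurable1(1)[OF g(1), of t]
  \<comment> \<open>\<open>tent\<close> is the same at \<open>g\<close> and at the moved point and
    lies in [0,1], so the pairings differ by at most the L1 distance \<open>K\<close> of the
    gradients. If \<open>K\<close> is infinite there is nothing to show; if it is finite,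
    \<open>H\<close> is integrable there because the cylinder gradient is bounded.\<close>
  have bnd: "ennreal \<bar>\<phi>' n \<theta> - h \<theta>\<bar> \<le> K n (move t g \<theta>)" if \<theta>: "0 < \<theta>" "\<theta> < 1" for n \<theta>
  proof (cases "K n (move t g \<theta>) = \<infinity>")
    case False
    let ?F = "F n (move t g \<theta>)" and ?H = "H (move t g \<theta>)"
    obtain B where B: "\<forall>s. \<bar>?F s\<bar> \<le> B" using Z1_measurable(4)[OF Z mG] by blast
    have Fm [measurable]: "?F \<in> borel_measurable borel" by (rule Z1_measurable(3)[OF Z mG])
    have Hm [measurable]: "?H \<in> borel_measurable borel"
      using measurable_compose[OF measurable_Pair1'[of "move t g \<theta>" Q unit_leb] H] mG
      by (simp add: space_Q)
    have iF: "integrable unit_leb ?F" by (rule integrable_unit_leb_bounded[of _ B]) (use B in auto)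
    have iD: "integrable unit_leb (\<lambda>s. ?F s - ?H s)"
    proof -
      have "(\<lambda>s. ?F s - ?H s) \<in> borel_measurable unit_leb"
        using borel_measurable_diff[OF Fm Hm] by simp
      then show ?thesis using False unfolding integrable_iff_bounded K by (auto simp: less_top)
    qed
    have "integrable unit_leb (\<lambda>s. ?F s - (?F s - ?H s))" by (rule Bochner_Integration.integrable_diff[OF iF iD])
    then have iH: "integrable unit_leb ?H" by simp
    have te: "tent t (move t g \<theta>) s = tent t g s" for s by (rule tent_move[where t=t and g=g, OF g(2,3) \<theta> t(2)])
    have tb: "\<bar>tent t g s\<bar> \<le> 1" for s using tent_bounds[OF g(1) t, of s] by simp
    have mult: "integrable unit_leb (\<lambda>s. G s * tent t g s)" if "integrable unit_leb G" for G :: "real \<Rightarrow> real"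
    proof (rule Bochner_Integration.integrable_bound[OF that])
      show "(\<lambda>s. G s * tent t g s) \<in> borel_measurable unit_leb"
        using borel_measurable_times[OF borel_measurable_integrable[OF that]] tm by simp
      show "AE s in unit_leb. norm (G s * tent t g s) \<le> norm (G s)"
        unfolding real_norm_def abs_mult by (intro AE_I2 mult_left_le[OF tb abs_ge_zero])
    qed
    have "\<phi>' n \<theta> - h \<theta> = (\<integral>s. (?F s - ?H s) * tent t g s \<partial>unit_leb)"
      unfolding \<phi>'_def h_def tent_integral_def te left_diff_distrib
      using mult[OF iF] mult[OF iH] by simp
    then have "\<bar>\<phi>' n \<theta> - h \<theta>\<bar> = \<bar>\<integral>s. (?F s - ?H s) * tent t g s \<partial>unit_leb\<bar>" by simp
    also have "\<dots> \<le> (\<integral>s. \<bar>(?F s - ?H s) * tent t g s\<bar> \<partial>unit_leb)" by (rule integral_abs_bound)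
    also have "\<dots> \<le> (\<integral>s. \<bar>?F s - ?H s\<bar> \<partial>unit_leb)"
    proof (rule integral_mono[OF integrable_abs[OF mult[OF iD]] integrable_abs[OF iD]])
      show "\<bar>(?F s - ?H s) * tent t g s\<bar> \<le> \<bar>?F s - ?H s\<bar>" for s
        unfolding abs_mult by (rule mult_left_le[OF tb abs_ge_zero])
    qed
    finally have "ennreal \<bar>\<phi>' n \<theta> - h \<theta>\<bar> \<le> ennreal (\<integral>s. \<bar>?F s - ?H s\<bar> \<partial>unit_leb)" by (rule ennreal_leI)
    also have "\<dots> = K n (move t g \<theta>)"
      unfolding K using iD by (subst nn_integral_eq_integral) auto
    finally show ?thesis .
  qed simp
  have \<phi>m [measurable]: "\<phi>' n \<in> borel_measurable borel" for n
  proof -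
    have "(\<lambda>(g, s). F n g s) \<in> borel_measurable (Q \<Otimes>\<^sub>M unit_leb)" by (rule Z1_measurable(2)[OF Z])
    moreover have "(\<lambda>x. (move t g (fst x), snd x)) \<in> measurable (borel \<Otimes>\<^sub>M unit_leb) (Q \<Otimes>\<^sub>M unit_leb)"
      by measurable
    ultimately have "(\<lambda>x. F n (move t g (fst x)) (snd x)) \<in> borel_measurable (borel \<Otimes>\<^sub>M unit_leb)"
      using measurable_compose by fastforce
    then have "(\<lambda>(\<theta>, s). F n (move t g \<theta>) s * tent t g s) \<in> borel_measurable (borel \<Otimes>\<^sub>M unit_leb)"
      using measurable_compose[OF measurable_snd tm, of borel]
      by (simp add: case_prod_beta' cong: measurable_cong_sets sets_pair_measure_cong)
    then show ?thesis unfolding \<phi>'_def by (rule unit_leb.borel_measurable_lebesgue_integral)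
  qed
  \<comment> \<open>The parameters at which the values tend to 0. They fill (0,1) up to a null set,
    because terms of a convergent series tend to 0, and they serve as endpoints for the fundamental
    theorem of calculus.\<close>
  define X where "X = {\<theta>\<in>{0<..<1}. (\<lambda>n. f n (move t g \<theta>)) \<longlonglongrightarrow> 0}"
  have X: "AE \<theta> in lborel. \<theta> \<in> {0<..<1} \<longrightarrow> \<theta> \<in> X"
  proof -
    have "AE \<theta> in lborel. \<forall>n::nat. S (move t g \<theta>) * indicator {1 / real (n + 3)..1 - 1 / real (n + 3)} \<theta> \<noteq> \<infinity>"
    proof (subst AE_all_countable, rule allI)
      fix n :: nat
      have "1 / real (n + 3) \<le> 1 / 3" by (intro divide_left_mono) auto
      then have "(\<integral>\<^sup>+ \<theta>. S (move t g \<theta>) * indicator {1 / real (n + 3)..1 - 1 / real (n + 3)} \<theta> \<partial>lborel) < \<infinity>"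
        unfolding S_def by (intro fin) auto
      then show "AE \<theta> in lborel. S (move t g \<theta>) * indicator {1 / real (n + 3)..1 - 1 / real (n + 3)} \<theta> \<noteq> \<infinity>"
        by (intro nn_integral_PInf_AE) auto
    qed
    then show ?thesis
    proof eventually_elim
      case (elim \<theta>)
      show ?case
      proof
        assume \<theta>: "\<theta> \<in> {0<..<1}"
        then have "0 < min \<theta> (1 - \<theta>)" by auto
        then obtain n where n: "1 / real (Suc n) < min \<theta> (1 - \<theta>)" using nat_approx_posE by blast
        have "1 / real (n + 3) \<le> 1 / real (Suc n)" by (intro divide_left_mono) auto
        then have "\<theta> \<in> {1 / real (n + 3)..1 - 1 / real (n + 3)}" using n by auto
        then have "S (move t g \<theta>) \<noteq> \<infinity>" using elim[rule_format, of n] by simp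
        moreover have "(\<Sum>n. ennreal \<bar>f n (move t g \<theta>)\<bar>) \<le> S (move t g \<theta>)"
          unfolding S_def by (rule suminf_le) auto
        ultimately have "(\<Sum>n. ennreal \<bar>f n (move t g \<theta>)\<bar>) \<noteq> \<infinity>"
          by (metis infinity_ennreal_def neq_top_trans)
        then have "summable (\<lambda>n. \<bar>f n (move t g \<theta>)\<bar>)"
          by (intro summable_suminf_not_top) auto
        then have "(\<lambda>n. f n (move t g \<theta>)) \<longlonglongrightarrow> 0"
          using summable_LIMSEQ_zero tendsto_rabs_zero_iff by blast
        then show "\<theta> \<in> X" using \<theta> by (simp add: X_def)
      qed
    qed
  qed
  have "AE \<theta> in lborel. \<theta> \<in> {0<..<1} \<longrightarrow> h \<theta> = 0"
  proof (rule AE_zero_if_interval_integrals_zero)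
    show "X \<subseteq> {0<..<1}" by (auto simp: X_def)
    fix x y :: real assume xy: "0 \<le> x" "x < y" "y \<le> 1"
    show "\<exists>z\<in>X. x < z \<and> z < y"
    proof (rule ccontr)
      assume neg: "\<not> ?thesis"
      have "AE \<theta> in lborel. \<theta> \<notin> {x<..<y}"
        using X by eventually_elim (use xy neg in auto)
      then have "{x<..<y} \<in> null_sets lborel" using AE_iff_null_sets[of "{x<..<y}" lborel] by simp
      then show False using xy by auto
    qed
  next
    fix a b assume ab: "a \<in> X" "b \<in> X" "a < b"
    have ab01: "0 < a" "b < 1" "a \<in> {0<..<1}" "b \<in> {0<..<1}" using ab by (auto simp: X_def)
    have FTC: "has_bochner_integral lborel (\<lambda>\<theta>. \<phi>' n \<theta> * indicator {a..b} \<theta>) (f n (move t g b) - f n (move t g a))" for n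
      unfolding \<phi>'_def using ab ab01
      by (intro has_bochner_integral_FTC_Icc_real Z1_fiber[OF Z t g]) auto
    define e where "e n = (\<integral>\<^sup>+ \<theta>. K n (move t g \<theta>) * indicator {a..b} \<theta> \<partial>lborel)" for n
    have "(\<Sum>n. e n) = (\<integral>\<^sup>+ \<theta>. (\<Sum>n. K n (move t g \<theta>) * indicator {a..b} \<theta>) \<partial>lborel)"
      unfolding e_def
      by (intro nn_integral_suminf[symmetric] borel_measurable_times_ennreal borel_measurable_indicator)
         (use measurable_compose[OF move_measurable1[OF t g(1)] Kq] in auto)
    also have "\<dots> \<le> (\<integral>\<^sup>+ \<theta>. S (move t g \<theta>) * indicator {a..b} \<theta> \<partial>lborel)"
      unfolding S_def by (intro nn_integral_mono) (auto simp: indicator_def intro!: suminf_le)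
    also have "\<dots> < \<infinity>" unfolding S_def using ab ab01 by (intro fin) auto
    finally have sum_e: "(\<Sum>n. e n) < \<infinity>" .
    have e_fin: "e n < \<infinity>" for n
    proof -
      have "e n \<le> (\<Sum>n. e n)" using sum_le_suminf[of e "{n}"] by simp
      then show ?thesis using sum_e by (rule le_less_trans)
    qed
    have dn: "(\<integral>\<^sup>+ \<theta>. ennreal \<bar>\<phi>' n \<theta> * indicator {a..b} \<theta> - h \<theta> * indicator {a..b} \<theta>\<bar> \<partial>lborel) \<le> e n" for n
      unfolding e_def
    proof (rule nn_integral_mono)
      fix \<theta> :: real
      show "ennreal \<bar>\<phi>' n \<theta> * indicator {a..b} \<theta> - h \<theta> * indicator {a..b} \<theta>\<bar> \<le> K n (move t g \<theta>) * indicator {a..b} \<theta>"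
        using bnd[of \<theta> n] ab01 by (auto simp: indicator_def)
    qed
    have i\<phi>: "integrable lborel (\<lambda>\<theta>. \<phi>' n \<theta> * indicator {a..b} \<theta>)" for n
      using FTC by (simp add: has_bochner_integral_iff)
    have id: "integrable lborel (\<lambda>\<theta>. \<phi>' n \<theta> * indicator {a..b} \<theta> - h \<theta> * indicator {a..b} \<theta>)" for n
      unfolding integrable_iff_bounded using le_less_trans[OF dn e_fin] by simp
    show ih: "integrable lborel (\<lambda>\<theta>. h \<theta> * indicator {a..b} \<theta>)"
      using Bochner_Integration.integrable_diff[OF i\<phi>[of 0] id[of 0]] by simp
    have le: "\<bar>(f n (move t g b) - f n (move t g a)) - (\<integral>\<theta>. h \<theta> * indicator {a..b} \<theta> \<partial>lborel)\<bar> \<le> enn2real (e n)" for n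
    proof -
      have "(f n (move t g b) - f n (move t g a)) - (\<integral>\<theta>. h \<theta> * indicator {a..b} \<theta> \<partial>lborel)
        = (\<integral>\<theta>. \<phi>' n \<theta> * indicator {a..b} \<theta> - h \<theta> * indicator {a..b} \<theta> \<partial>lborel)"
        using FTC[of n] ih i\<phi>[of n] by (simp add: has_bochner_integral_iff)
      then have "\<bar>(f n (move t g b) - f n (move t g a)) - (\<integral>\<theta>. h \<theta> * indicator {a..b} \<theta> \<partial>lborel)\<bar>
        = \<bar>\<integral>\<theta>. \<phi>' n \<theta> * indicator {a..b} \<theta> - h \<theta> * indicator {a..b} \<theta> \<partial>lborel\<bar>" by simp
      also have "\<dots> \<le> (\<integral>\<theta>. \<bar>\<phi>' n \<theta> * indicator {a..b} \<theta> - h \<theta> * indicator {a..b} \<theta>\<bar> \<partial>lborel)"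
        by (rule integral_abs_bound)
      also have "\<dots> = enn2real (\<integral>\<^sup>+ \<theta>. ennreal \<bar>\<phi>' n \<theta> * indicator {a..b} \<theta> - h \<theta> * indicator {a..b} \<theta>\<bar> \<partial>lborel)"
        by (rule integral_eq_nn_integral) auto
      also have "\<dots> \<le> enn2real (e n)" using dn e_fin by (intro enn2real_mono) auto
      finally show ?thesis .
    qed
    have e0: "(\<lambda>n. enn2real (e n)) \<longlonglongrightarrow> 0"
    proof -
      have "summable (\<lambda>n. enn2real (e n))"
        by (rule summable_suminf_not_top) (use sum_e e_fin in \<open>auto simp: less_top\<close>)
      then show ?thesis by (rule summable_LIMSEQ_zero)
    qed
    \<comment> \<open>Two limits of one sequence: the error bound gives 0, and convergence at the
      endpoints gives minus the integral of \<open>h\<close>.\<close>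
    have "(\<lambda>n. (f n (move t g b) - f n (move t g a)) - (\<integral>\<theta>. h \<theta> * indicator {a..b} \<theta> \<partial>lborel)) \<longlonglongrightarrow> 0"
      by (rule Lim_null_comparison[OF always_eventually e0]) (intro allI, unfold real_norm_def, rule le)
    moreover have "(\<lambda>n. (f n (move t g b) - f n (move t g a)) - (\<integral>\<theta>. h \<theta> * indicator {a..b} \<theta> \<partial>lborel))
      \<longlonglongrightarrow> (0 - 0) - (\<integral>\<theta>. h \<theta> * indicator {a..b} \<theta> \<partial>lborel)"
      using ab unfolding X_def by (intro tendsto_diff tendsto_const) simp_all
    ultimately have "0 = (0 - 0) - (\<integral>\<theta>. h \<theta> * indicator {a..b} \<theta> \<partial>lborel)"
      by (rule LIMSEQ_unique)
    then show "(\<integral>\<theta>. h \<theta> * indicator {a..b} \<theta> \<partial>lborel) = 0" by simp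
  qed
  then show ?thesis by (simp add: h_def)
qed

end

section \<open>Closability of the gradient\<close>

text \<open>A choice of indices, not necessarily increasing: what later arguments use is the
  summability of the selected terms.\<close>

lemma fast_subsequence:
  fixes e :: "nat \<Rightarrow> ennreal"
  assumes "e \<longlonglongrightarrow> 0"
  obtains r :: "nat \<Rightarrow> nat" where "\<And>n. e (r n) \<le> ennreal ((1 / 2) ^ n)"
proof -
  have "\<exists>k. e k \<le> ennreal ((1 / 2) ^ n)" for n
  proof -
    have "\<forall>\<^sub>F k in sequentially. e k < ennreal ((1 / 2) ^ n)"
      using assms by (rule order_tendstoD(2)) simp
    then obtain k where "e k < ennreal ((1 / 2) ^ n)" by (auto simp: eventually_sequentially)
    then show ?thesis by (auto intro: less_imp_le)
  qed
  then show ?thesis using that by metis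
qed

lemma suminf_half_powers: "(\<Sum>n. ennreal ((1 / 2) ^ n)) < \<infinity>"
proof -
  have "(\<Sum>n. ennreal ((1 / 2) ^ n)) = ennreal (\<Sum>n. (1 / 2) ^ n)"
    by (rule suminf_ennreal2) (auto intro: summable_geometric)
  then show ?thesis by simp
qed

context entropic
begin

text \<open>A fast selection collects all values and gradient errors in one integrable function
  \<open>S\<close>. Invariance under resampling makes \<open>S\<close> integrable for
  \<open>law t\<close> along almost every fibre, and the lower bound on \<open>law t\<close> turns
  this into Lebesgue integrability on compact intervals, as the one-dimensional argument
  requires.\<close>

lemma closable:
  assumes Z: "\<And>n. (f n, F n) \<in> Z1_graph"
    and H: "(\<lambda>(g, s). H g s) \<in> borel_measurable (Q \<Otimes>\<^sub>M unit_leb)"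
    and f0: "(\<lambda>n. \<integral>\<^sup>+ g. ennreal \<bar>f n g\<bar> \<partial>Q) \<longlonglongrightarrow> 0"
    and F0: "(\<lambda>n. \<integral>\<^sup>+ g. \<integral>\<^sup>+ s. ennreal \<bar>F n g s - H g s\<bar> \<partial>unit_leb \<partial>Q) \<longlonglongrightarrow> 0"
  shows "AE g in Q. AE s in unit_leb. H g s = 0"
proof -
  define K where "K n = (\<lambda>g. \<integral>\<^sup>+ s. ennreal \<bar>F n g s - H g s\<bar> \<partial>unit_leb)" for n
  have Kq [measurable]: "K n \<in> borel_measurable Q" for n
  proof -
    have "(\<lambda>(g, s). ennreal \<bar>F n g s - H g s\<bar>) \<in> borel_measurable (Q \<Otimes>\<^sub>M unit_leb)"
      using Z1_measurable(2)[OF Z[of n]] H by (simp add: case_prod_beta')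
    then show ?thesis unfolding K_def by (rule unit_leb.borel_measurable_nn_integral)
  qed
  note fm [measurable] = Z1_measurable(1)[OF Z]
  have "(\<lambda>n. (\<integral>\<^sup>+ g. ennreal \<bar>f n g\<bar> \<partial>Q) + (\<integral>\<^sup>+ g. K n g \<partial>Q)) \<longlonglongrightarrow> 0 + 0"
    unfolding K_def by (intro tendsto_add f0 F0)
  then have e0: "(\<lambda>n. (\<integral>\<^sup>+ g. ennreal \<bar>f n g\<bar> \<partial>Q) + (\<integral>\<^sup>+ g. K n g \<partial>Q)) \<longlonglongrightarrow> 0" by simp
  obtain r where r: "\<And>n. (\<integral>\<^sup>+ g. ennreal \<bar>f (r n) g\<bar> \<partial>Q) + (\<integral>\<^sup>+ g. K (r n) g \<partial>Q) \<le> ennreal ((1 / 2) ^ n)"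
    by (rule fast_subsequence[OF e0]) blast
  define S where "S g = (\<Sum>n. ennreal \<bar>f (r n) g\<bar> + K (r n) g)" for g
  have Sm [measurable]: "S \<in> borel_measurable Q" unfolding S_def[abs_def] by measurable
  have "(\<integral>\<^sup>+ g. S g \<partial>Q) = (\<Sum>n. \<integral>\<^sup>+ g. ennreal \<bar>f (r n) g\<bar> + K (r n) g \<partial>Q)"
    unfolding S_def by (rule nn_integral_suminf) measurable
  also have "\<dots> = (\<Sum>n. (\<integral>\<^sup>+ g. ennreal \<bar>f (r n) g\<bar> \<partial>Q) + (\<integral>\<^sup>+ g. K (r n) g \<partial>Q))"
    by (intro suminf_cong nn_integral_add) measurable
  also have "\<dots> \<le> (\<Sum>n. ennreal ((1 / 2) ^ n))"
    by (intro suminf_le r) auto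
  also have "\<dots> < \<infinity>" by (rule suminf_half_powers)
  finally have S_fin: "(\<integral>\<^sup>+ g. S g \<partial>Q) < \<infinity>" .
  have tent0: "AE g in Q. tent_integral t H g = 0" if t: "0 < t" "t < 1" for t
  proof -
    interpret L: prob_space "law t" by (rule prob_space_law)
    have mv: "(\<lambda>(g, \<theta>). move t g \<theta>) \<in> measurable (Q \<Otimes>\<^sub>M law t) Q"
      using move_measurable[OF t] by (simp cong: measurable_cong_sets sets_pair_measure_cong)
    have mS: "(\<lambda>g. \<integral>\<^sup>+ \<theta>. S (move t g \<theta>) \<partial>law t) \<in> borel_measurable Q"
      using L.borel_measurable_nn_integral[of "\<lambda>g \<theta>. S (move t g \<theta>)" Q] measurable_compose[OF mv Sm]
      by (simp add: case_prod_beta')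
    have "AE g in Q. (\<integral>\<^sup>+ \<theta>. S (move t g \<theta>) \<partial>law t) \<noteq> \<infinity>"
      using S_fin by (intro nn_integral_PInf_AE mS) (simp add: nn_integral_move[OF t Sm])
    then have "AE g in Q. (\<integral>\<^sup>+ \<theta>. ennreal \<bar>tent_integral t H (move t g \<theta>)\<bar> \<partial>law t) = 0"
      using AE_space AE_value[OF t]
    proof eventually_elim
      case (elim g)
      have g: "g \<in> G0" "0 < g t" "g t < 1" using elim by (auto simp: space_Q)
      note mg [measurable] = move_measurable1[OF t g(1)]
      have Sg: "(\<lambda>\<theta>. S (move t g \<theta>)) \<in> borel_measurable borel"
        by (rule measurable_compose[OF mg Sm])
      have "AE \<theta> in lborel. \<theta> \<in> {0<..<1} \<longrightarrow> tent_integral t H (move t g \<theta>) = 0"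
      proof (rule fiber_closable[where f="\<lambda>n. f (r n)" and F="\<lambda>n. F (r n)" and K="\<lambda>n. K (r n)"])
        fix a b :: real assume ab: "0 < a" "a < b" "b < 1"
        obtain c where c: "c \<noteq> 0" "\<And>f. f \<in> borel_measurable borel \<Longrightarrow>
            c * (\<integral>\<^sup>+ \<theta>. f \<theta> * indicator {a..b} \<theta> \<partial>lborel) \<le> (\<integral>\<^sup>+ \<theta>. f \<theta> \<partial>law t)"
          using law_lower_bound[OF t ab(1) less_imp_le[OF ab(2)] ab(3)] by blast
        have "c * (\<integral>\<^sup>+ \<theta>. S (move t g \<theta>) * indicator {a..b} \<theta> \<partial>lborel) < \<infinity>"
          by (rule le_less_trans[OF c(2)[OF Sg]]) (use elim(1) in \<open>simp add: less_top\<close>)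
        then have "(\<integral>\<^sup>+ \<theta>. S (move t g \<theta>) * indicator {a..b} \<theta> \<partial>lborel) < \<infinity>"
          using c(1) by (auto simp: ennreal_mult_less_top)
        then show "(\<integral>\<^sup>+ \<theta>. (\<Sum>n. ennreal \<bar>f (r n) (move t g \<theta>)\<bar> + K (r n) (move t g \<theta>)) * indicator {a..b} \<theta> \<partial>lborel) < \<infinity>"
          by (simp only: S_def)
      qed (use Z t H g K_def in auto)
      then show ?case
        by (intro law_null[OF t]) (auto elim: eventually_mono
            intro!: measurable_compose[OF measurable_compose[OF mg tent_integral_measurable[OF t H]]])
    qed
    \<comment> \<open>Invariance is used a second time, in the opposite direction: what vanishes for
      almost every \<open>g\<close> and almost every resampled value vanishes almost surely under
      \<open>Q\<close>.\<close>
    then have "(\<integral>\<^sup>+ g. \<integral>\<^sup>+ \<theta>. ennreal \<bar>tent_integral t H (move t g \<theta>)\<bar> \<partial>law t \<partial>Q) = (\<integral>\<^sup>+ g. 0 \<partial>Q)"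
      by (rule nn_integral_cong_AE)
    moreover have Tm: "(\<lambda>g. ennreal \<bar>tent_integral t H g\<bar>) \<in> borel_measurable Q"
      using tent_integral_measurable[OF t H] by measurable
    ultimately have "(\<integral>\<^sup>+ g. ennreal \<bar>tent_integral t H g\<bar> \<partial>Q) = 0"
      using nn_integral_move[OF t Tm] by simp
    then show ?thesis using Tm by (simp add: nn_integral_0_iff_AE)
  qed
  have "AE g in Q. \<forall>t\<in>\<rat> \<inter> {0<..<1}. tent_integral t H g = 0"
    by (rule AE_ball_countable') (use tent0 countable_rat in auto)
  moreover have "AE g in Q. S g \<noteq> \<infinity>"
    using S_fin by (intro nn_integral_PInf_AE) auto
  ultimately show ?thesis
    using AE_space AE_strict_mono
  proof eventually_elim
    case (elim g)
    have g: "g \<in> G0" using elim by (simp add: space_Q)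
    have Hm: "H g \<in> borel_measurable borel"
      using measurable_compose[OF measurable_Pair1'[of g Q unit_leb] H] g by (simp add: space_Q)
    have Fm: "F (r 0) g \<in> borel_measurable borel" by (rule Z1_measurable(3)[OF Z g])
    have "ennreal \<bar>f (r 0) g\<bar> + K (r 0) g \<le> S g"
      unfolding S_def using sum_le_suminf[of "\<lambda>n. ennreal \<bar>f (r n) g\<bar> + K (r n) g" "{0}"] by simp
    \<comment> \<open>Finiteness of \<open>S g\<close> puts a bounded cylinder gradient at finite L1
      distance from \<open>H g\<close>; this is the source of the integrability that
      \<open>tent_total\<close> asks for.\<close>
    then have "K (r 0) g < \<infinity>"
      using elim(2) by (metis add_increasing infinity_ennreal_def less_top order.trans order_refl top.extremum_uniqueI zero_le)
    then have iD: "integrable unit_leb (\<lambda>s. F (r 0) g s - H g s)"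
      unfolding integrable_iff_bounded K_def using Fm Hm by simp
    obtain B where B: "\<forall>s. \<bar>F (r 0) g s\<bar> \<le> B" using Z1_measurable(4)[OF Z g] by blast
    have iF: "integrable unit_leb (F (r 0) g)"
      by (rule integrable_unit_leb_bounded[OF Fm]) (use B in blast)
    have iH: "integrable unit_leb (H g)"
      using Bochner_Integration.integrable_diff[OF iF iD] by simp
    show "AE s in unit_leb. H g s = 0"
      by (rule tent_total[OF g _ G0_measurable[OF g] iH])
         (use elim in \<open>auto simp: tent_integral_def\<close>)
  qed
qed

end

section \<open>Lattice operations and approximation with bounded gradient\<close>

lemma sum_add_lessThan: "(\<Sum>i<m1 + m2. f i) = (\<Sum>i<m1. f i) + (\<Sum>i<m2::nat. f (m1 + i) :: 'a :: comm_monoid_add)"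
  by (induction m2) (auto simp: add.assoc)

text \<open>Both representations are placed side by side: coordinates below \<open>m1\<close> feed
  \<open>U1\<close> and the next \<open>m2\<close> feed \<open>U2\<close>, so the composite is again
  a C^1 function of finitely many integrals.\<close>

lemma Z1_combine:
  fixes \<psi> p1 p2 :: "real \<Rightarrow> real \<Rightarrow> real"
  assumes f1: "(f1, F1) \<in> Z1_graph" and f2: "(f2, F2) \<in> Z1_graph"
    and d1: "\<And>x y. ((\<lambda>x. \<psi> x y) has_real_derivative p1 x y) (at x)"
    and d2: "\<And>x y. ((\<lambda>y. \<psi> x y) has_real_derivative p2 x y) (at y)"
    and c1: "continuous_on UNIV (\<lambda>x. p1 (fst x) (snd x))"
    and c2: "continuous_on UNIV (\<lambda>x. p2 (fst x) (snd x))"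
  shows "(\<lambda>g. \<psi> (f1 g) (f2 g), \<lambda>g t. p1 (f1 g) (f2 g) * F1 g t + p2 (f1 g) (f2 g) * F2 g t) \<in> Z1_graph"
proof -
  obtain m1 U1 D1 \<alpha>1 \<alpha>1' where U1: "C1_Rm m1 U1 D1" and \<alpha>1: "C1_01 m1 \<alpha>1 \<alpha>1'"
    and f1eq: "f1 = (\<lambda>g. U1 (avec m1 \<alpha>1 g))" and F1eq: "F1 = (\<lambda>g t. \<Sum>i<m1. D1 i (avec m1 \<alpha>1 g) * \<alpha>1' i (g t))"
    using f1 unfolding Z1_graph_def by blast
  obtain m2 U2 D2 \<alpha>2 \<alpha>2' where U2: "C1_Rm m2 U2 D2" and \<alpha>2: "C1_01 m2 \<alpha>2 \<alpha>2'"
    and f2eq: "f2 = (\<lambda>g. U2 (avec m2 \<alpha>2 g))" and F2eq: "F2 = (\<lambda>g t. \<Sum>i<m2. D2 i (avec m2 \<alpha>2 g) * \<alpha>2' i (g t))"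
    using f2 unfolding Z1_graph_def by blast
  define r1 :: "(nat \<Rightarrow> real) \<Rightarrow> nat \<Rightarrow> real" where "r1 x j = (if j < m1 then x j else 0)" for x j
  define r2 :: "(nat \<Rightarrow> real) \<Rightarrow> nat \<Rightarrow> real" where "r2 x j = (if j < m2 then x (m1 + j) else 0)" for x j
  define U where "U x = \<psi> (U1 (r1 x)) (U2 (r2 x))" for x
  define D where "D i x = (if i < m1 then p1 (U1 (r1 x)) (U2 (r2 x)) * D1 i (r1 x)
     else p2 (U1 (r1 x)) (U2 (r2 x)) * D2 (i - m1) (r2 x))" for i x
  define \<alpha> where "\<alpha> i = (if i < m1 then \<alpha>1 i else \<alpha>2 (i - m1))" for i
  define \<alpha>' where "\<alpha>' i = (if i < m1 then \<alpha>1' i else \<alpha>2' (i - m1))" for i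
  have cr1: "continuous_on UNIV r1"
  proof (rule continuous_on_coordinatewise_then_product)
    show "continuous_on UNIV (\<lambda>x. r1 x j)" for j
      unfolding r1_def by (cases "j < m1") simp_all
  qed
  have cr2: "continuous_on UNIV r2"
  proof (rule continuous_on_coordinatewise_then_product)
    show "continuous_on UNIV (\<lambda>x. r2 x j)" for j
      unfolding r2_def by (cases "j < m2") simp_all
  qed
  have cU1: "continuous_on UNIV (\<lambda>x. U1 (r1 x))"
    by (rule continuous_on_compose2[OF C1_Rm_continuous[OF U1] cr1]) simp
  have cU2: "continuous_on UNIV (\<lambda>x. U2 (r2 x))"
    by (rule continuous_on_compose2[OF C1_Rm_continuous[OF U2] cr2]) simp
  have cp: "continuous_on UNIV (\<lambda>x. p (U1 (r1 x)) (U2 (r2 x)))"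
    if "continuous_on UNIV (\<lambda>x. p (fst x) (snd x))" for p :: "real \<Rightarrow> real \<Rightarrow> real"
    using continuous_on_compose2[OF that continuous_on_Pair[OF cU1 cU2]] by simp
  have CU: "C1_Rm (m1 + m2) U D"
    unfolding C1_Rm_def
  proof (intro conjI allI impI)
    fix x
    have "r1 (\<lambda>j. if j < m1 + m2 then x j else 0) = r1 x" "r2 (\<lambda>j. if j < m1 + m2 then x j else 0) = r2 x"
      by (auto simp: r1_def r2_def)
    then show "U x = U (\<lambda>j. if j < m1 + m2 then x j else 0)" by (simp add: U_def)
  next
    fix i x assume i: "i < m1 + m2"
    show "((\<lambda>h. U (x(i := h))) has_real_derivative D i x) (at (x i))"
    proof (cases "i < m1")
      case True
      have r: "r1 (x(i := h)) = (r1 x)(i := h)" "r2 (x(i := h)) = r2 x" for h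
        using True by (auto simp: r1_def r2_def)
      have "((\<lambda>h. U1 ((r1 x)(i := h))) has_real_derivative D1 i (r1 x)) (at (r1 x i))"
        using U1 True unfolding C1_Rm_def by blast
      then have g: "((\<lambda>h. U1 ((r1 x)(i := h))) has_real_derivative D1 i (r1 x)) (at (x i))"
        using True by (simp add: r1_def)
      have "(r1 x)(i := x i) = r1 x" using True by (auto simp: r1_def)
      then have "((\<lambda>z. \<psi> z (U2 (r2 x))) has_real_derivative p1 (U1 (r1 x)) (U2 (r2 x))) (at (U1 ((r1 x)(i := x i))))"
        using d1 by simp
      from DERIV_chain2[OF this g] show ?thesis using True by (simp add: U_def D_def r)
    next
      case False
      have im: "i - m1 < m2" "m1 + (i - m1) = i" using i False by auto
      have r: "r1 (x(i := h)) = r1 x" "r2 (x(i := h)) = (r2 x)(i - m1 := h)" for h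
        using False im by (auto simp: r1_def r2_def fun_eq_iff)
      have "((\<lambda>h. U2 ((r2 x)(i - m1 := h))) has_real_derivative D2 (i - m1) (r2 x)) (at (r2 x (i - m1)))"
        using U2 im(1) unfolding C1_Rm_def by blast
      then have g: "((\<lambda>h. U2 ((r2 x)(i - m1 := h))) has_real_derivative D2 (i - m1) (r2 x)) (at (x i))"
        using im by (simp add: r2_def)
      have "(r2 x)(i - m1 := x i) = r2 x" using im by (auto simp: r2_def)
      then have "((\<lambda>z. \<psi> (U1 (r1 x)) z) has_real_derivative p2 (U1 (r1 x)) (U2 (r2 x))) (at (U2 ((r2 x)(i - m1 := x i))))"
        using d2 by simp
      from DERIV_chain2[OF this g] show ?thesis using False by (simp add: U_def D_def r)
    qed
  next
    fix i assume i: "i < m1 + m2"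
    show "continuous_on UNIV (D i)"
    proof (cases "i < m1")
      case True
      then have "continuous_on UNIV (D1 i)" using U1 by (auto simp: C1_Rm_def)
      from continuous_on_compose2[OF this cr1] cp[OF c1] show ?thesis
        using True unfolding D_def by (simp add: continuous_on_mult)
    next
      case False
      then have "continuous_on UNIV (D2 (i - m1))" using U2 i by (auto simp: C1_Rm_def)
      from continuous_on_compose2[OF this cr2] cp[OF c2] show ?thesis
        using False unfolding D_def by (simp add: continuous_on_mult)
    qed
  qed
  have C\<alpha>: "C1_01 (m1 + m2) \<alpha> \<alpha>'"
    using \<alpha>1 \<alpha>2 unfolding C1_01_def \<alpha>_def \<alpha>'_def by auto
  have r: "r1 (avec (m1 + m2) \<alpha> g) = avec m1 \<alpha>1 g" "r2 (avec (m1 + m2) \<alpha> g) = avec m2 \<alpha>2 g" for g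
    by (auto simp: r1_def r2_def avec_def \<alpha>_def)
  have u: "(\<lambda>g. \<psi> (f1 g) (f2 g)) = (\<lambda>g. U (avec (m1 + m2) \<alpha> g))"
    by (simp add: U_def r f1eq f2eq)
  have Du: "(\<lambda>g t. p1 (f1 g) (f2 g) * F1 g t + p2 (f1 g) (f2 g) * F2 g t)
    = (\<lambda>g t. \<Sum>i<m1 + m2. D i (avec (m1 + m2) \<alpha> g) * \<alpha>' i (g t))"
    unfolding sum_add_lessThan
    by (intro ext) (simp add: D_def r f1eq f2eq F1eq F2eq \<alpha>'_def sum_distrib_left mult.assoc)
  show ?thesis unfolding Z1_graph_def using CU C\<alpha> u Du by blast
qed

lemma Z1_linear:
  assumes "(f1, F1) \<in> Z1_graph" "(f2, F2) \<in> Z1_graph"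
  shows "(\<lambda>g. a * f1 g + b * f2 g, \<lambda>g t. a * F1 g t + b * F2 g t) \<in> Z1_graph"
  by (rule Z1_combine[OF assms, where \<psi>="\<lambda>x y. a * x + b * y" and ?p1.0="\<lambda>_ _. a" and ?p2.0="\<lambda>_ _. b"])
     (auto intro!: derivative_eq_intros)

text \<open>The maximum is half of \<open>x + y\<close> plus the absolute difference; the latter is
  replaced by a smooth function within \<open>\<delta>\<close> of it.\<close>

definition smooth_max :: "real \<Rightarrow> real \<Rightarrow> real \<Rightarrow> real" where
  "smooth_max \<delta> x y = (x + y + sqrt ((x - y)\<^sup>2 + \<delta>\<^sup>2)) / 2"

text \<open>The derivative in \<open>x\<close>; the derivative in \<open>y\<close> is its complement
  to 1. The gradient of a smoothed maximum is thus a convex combination of the two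
  gradients.\<close>

definition smooth_max_weight :: "real \<Rightarrow> real \<Rightarrow> real \<Rightarrow> real" where
  "smooth_max_weight \<delta> x y = (1 + (x - y) / sqrt ((x - y)\<^sup>2 + \<delta>\<^sup>2)) / 2"

lemma Z1_smooth_max:
  assumes "(f1, F1) \<in> Z1_graph" "(f2, F2) \<in> Z1_graph" "\<delta> > 0"
  shows "(\<lambda>g. smooth_max \<delta> (f1 g) (f2 g), \<lambda>g t. smooth_max_weight \<delta> (f1 g) (f2 g) * F1 g t
    + (1 - smooth_max_weight \<delta> (f1 g) (f2 g)) * F2 g t) \<in> Z1_graph"
proof (rule Z1_combine[OF assms(1,2)])
  have pos: "0 < (x - y)\<^sup>2 + \<delta>\<^sup>2" for x y :: real using assms(3) by (simp add: add_nonneg_pos)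
  then have s: "sqrt ((x - y)\<^sup>2 + \<delta>\<^sup>2) > 0" for x y by simp
  have quot: "inverse r / 2 * (2 * z) = z / r" "inverse r / 2 * - (2 * z) = - (z / r)" for r z :: real
    by (simp_all add: inverse_eq_divide)
  have dx: "((\<lambda>x. sqrt ((x - y)\<^sup>2 + \<delta>\<^sup>2)) has_real_derivative (x - y) / sqrt ((x - y)\<^sup>2 + \<delta>\<^sup>2)) (at x)" for x y
  proof -
    have "((\<lambda>x. (x - y)\<^sup>2 + \<delta>\<^sup>2) has_real_derivative 2 * (x - y)) (at x)"
      by (auto intro!: derivative_eq_intros)
    from DERIV_chain2[OF DERIV_real_sqrt[OF pos] this] show ?thesis
      by (rule DERIV_cong) (rule quot)
  qed
  have dy: "((\<lambda>y. sqrt ((x - y)\<^sup>2 + \<delta>\<^sup>2)) has_real_derivative - ((x - y) / sqrt ((x - y)\<^sup>2 + \<delta>\<^sup>2))) (at y)" for x y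
  proof -
    have "((\<lambda>y. (x - y)\<^sup>2 + \<delta>\<^sup>2) has_real_derivative - (2 * (x - y))) (at y)"
      by (auto intro!: derivative_eq_intros)
    from DERIV_chain2[OF DERIV_real_sqrt[OF pos] this] show ?thesis
      by (rule DERIV_cong) (rule quot)
  qed
  show "((\<lambda>x. smooth_max \<delta> x y) has_real_derivative smooth_max_weight \<delta> x y) (at x)" for x y
    unfolding smooth_max_def smooth_max_weight_def
    using DERIV_cdivide[OF DERIV_add[OF DERIV_add[OF DERIV_ident DERIV_const] dx]]
    by (simp only: add_0_right)
  show "((\<lambda>y. smooth_max \<delta> x y) has_real_derivative 1 - smooth_max_weight \<delta> x y) (at y)" for x y
  proof -
    have "((\<lambda>y. smooth_max \<delta> x y) has_real_derivative (1 + - ((x - y) / sqrt ((x - y)\<^sup>2 + \<delta>\<^sup>2))) / 2) (at y)"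
      unfolding smooth_max_def
      using DERIV_cdivide[OF DERIV_add[OF DERIV_add[OF DERIV_const DERIV_ident] dy]]
      by (simp only: add_0_left)
    moreover have "(1 + - ((x - y) / sqrt ((x - y)\<^sup>2 + \<delta>\<^sup>2))) / 2 = 1 - smooth_max_weight \<delta> x y"
      by (simp add: smooth_max_weight_def field_split_simps)
    ultimately show ?thesis by (simp only:)
  qed
  show "continuous_on UNIV (\<lambda>x. smooth_max_weight \<delta> (fst x) (snd x))"
    "continuous_on UNIV (\<lambda>x. 1 - smooth_max_weight \<delta> (fst x) (snd x))"
    unfolding smooth_max_weight_def
    by (intro continuous_intros; use s in \<open>force simp: less_le\<close>)+
qed

lemma smooth_max_weight_bounds:
  assumes "\<delta> > 0"
  shows "0 \<le> smooth_max_weight \<delta> x y" "smooth_max_weight \<delta> x y \<le> 1"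
proof -
  have "\<bar>x - y\<bar> \<le> sqrt ((x - y)\<^sup>2 + \<delta>\<^sup>2)" by (rule real_le_rsqrt) simp
  moreover have "0 < sqrt ((x - y)\<^sup>2 + \<delta>\<^sup>2)" using assms by (simp add: add_nonneg_pos)
  ultimately have "\<bar>(x - y) / sqrt ((x - y)\<^sup>2 + \<delta>\<^sup>2)\<bar> \<le> 1"
    by (simp add: abs_divide)
  then have "- 1 \<le> (x - y) / sqrt ((x - y)\<^sup>2 + \<delta>\<^sup>2)" "(x - y) / sqrt ((x - y)\<^sup>2 + \<delta>\<^sup>2) \<le> 1"
    by linarith+
  then show "0 \<le> smooth_max_weight \<delta> x y" "smooth_max_weight \<delta> x y \<le> 1"
    unfolding smooth_max_weight_def by simp_all
qed

lemma smooth_max_approx: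
  assumes "\<delta> > 0"
  shows "\<bar>smooth_max \<delta> x y - max x y\<bar> \<le> \<delta>"
proof -
  have "\<bar>x - y\<bar> \<le> sqrt ((x - y)\<^sup>2 + \<delta>\<^sup>2)" by (rule real_le_rsqrt) simp
  moreover have "sqrt ((x - y)\<^sup>2 + \<delta>\<^sup>2) \<le> \<bar>x - y\<bar> + \<delta>"
    using sqrt_add_le_add_sqrt[of "(x - y)\<^sup>2" "\<delta>\<^sup>2"] assms by simp
  moreover have "smooth_max \<delta> x y - max x y = (sqrt ((x - y)\<^sup>2 + \<delta>\<^sup>2) - \<bar>x - y\<bar>) / 2"
    by (simp add: smooth_max_def max_def abs_if field_simps)
  moreover define r where "r = sqrt ((x - y)\<^sup>2 + \<delta>\<^sup>2)"
  ultimately have "smooth_max \<delta> x y - max x y = (r - \<bar>x - y\<bar>) / 2" "\<bar>x - y\<bar> \<le> r" "r \<le> \<bar>x - y\<bar> + \<delta>"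
    by (simp_all only: r_def)
  moreover have "\<bar>D\<bar> \<le> \<delta>" if "D = (r - d) / 2" "d \<le> r" "r \<le> d + \<delta>" for D d
    using that assms by (simp add: abs_le_iff field_simps)
  ultimately show ?thesis by blast
qed

section \<open>Stability of approximation with bounded gradient\<close>

context entropic
begin

text \<open>Functions that are approximated in \<open>L\<^sup>2\<close> by cylinder functions whose gradient has norm at most 1
  up to an \<open>L\<^sup>1\<close>-small excess. The excess bounds the squared norm, so that convex combinations of
  gradients do not increase it.\<close>

definition grad_approx :: "((real \<Rightarrow> real) \<Rightarrow> real) \<Rightarrow> bool" where
  "grad_approx f \<longleftrightarrow> f \<in> borel_measurable Q \<and>
     (\<forall>\<epsilon>>0. \<exists>f' F e. (f', F) \<in> Z1_graph \<and> e \<in> borel_measurable Q \<and>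
        (\<integral>\<^sup>+ g. ennreal ((f' g - f g)\<^sup>2) \<partial>Q) \<le> ennreal \<epsilon> \<and>
        (\<forall>g\<in>G0. (\<integral>\<^sup>+ s. ennreal ((F g s)\<^sup>2) \<partial>unit_leb) \<le> 1 + e g) \<and>
        (\<integral>\<^sup>+ g. e g \<partial>Q) \<le> ennreal \<epsilon>)"

lemma grad_approxE:
  assumes "grad_approx f" "\<epsilon> > 0"
  obtains f' F e where "(f', F) \<in> Z1_graph" "e \<in> borel_measurable Q"
    "(\<integral>\<^sup>+ g. ennreal ((f' g - f g)\<^sup>2) \<partial>Q) \<le> ennreal \<epsilon>"
    "\<forall>g\<in>G0. (\<integral>\<^sup>+ s. ennreal ((F g s)\<^sup>2) \<partial>unit_leb) \<le> 1 + e g"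
    "(\<integral>\<^sup>+ g. e g \<partial>Q) \<le> ennreal \<epsilon>"
  using assms unfolding grad_approx_def by blast

lemma grad_approx_measurable: "grad_approx f \<Longrightarrow> f \<in> borel_measurable Q"
  by (simp add: grad_approx_def)

lemma grad_approx_uminus:
  assumes f: "grad_approx f"
  shows "grad_approx (\<lambda>g. - f g)"
  unfolding grad_approx_def
proof (intro conjI allI impI)
  show "(\<lambda>g. - f g) \<in> borel_measurable Q" using grad_approx_measurable[OF f] by measurable
  fix \<epsilon> :: real assume "\<epsilon> > 0"
  with f obtain f' F e where *: "(f', F) \<in> Z1_graph" "e \<in> borel_measurable Q"
    "(\<integral>\<^sup>+ g. ennreal ((f' g - f g)\<^sup>2) \<partial>Q) \<le> ennreal \<epsilon>"
    "\<forall>g\<in>G0. (\<integral>\<^sup>+ s. ennreal ((F g s)\<^sup>2) \<partial>unit_leb) \<le> 1 + e g"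
    "(\<integral>\<^sup>+ g. e g \<partial>Q) \<le> ennreal \<epsilon>"
    by (rule grad_approxE)
  have "(\<lambda>g. - f' g, \<lambda>g t. - F g t) \<in> Z1_graph" using Z1_linear[OF *(1) *(1), of "-1" 0] by simp
  moreover have "(- f' g - - f g)\<^sup>2 = (f' g - f g)\<^sup>2" for g by (simp add: power2_commute)
  ultimately show "\<exists>f' F e. (f', F) \<in> Z1_graph \<and> e \<in> borel_measurable Q \<and>
        (\<integral>\<^sup>+ g. ennreal ((f' g - - f g)\<^sup>2) \<partial>Q) \<le> ennreal \<epsilon> \<and>
        (\<forall>g\<in>G0. (\<integral>\<^sup>+ s. ennreal ((F g s)\<^sup>2) \<partial>unit_leb) \<le> 1 + e g) \<and>
        (\<integral>\<^sup>+ g. e g \<partial>Q) \<le> ennreal \<epsilon>"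
    using *(2-5) by (intro exI[of _ "\<lambda>g. - f' g"] exI[of _ "\<lambda>g t. - F g t"] exI[of _ e]) simp
qed

lemma nn_integral_square_convex:
  assumes p: "0 \<le> p" "p \<le> 1" and m [measurable]: "F1 \<in> borel_measurable M" "F2 \<in> borel_measurable M"
  shows "(\<integral>\<^sup>+ s. ennreal ((p * F1 s + (1 - p) * F2 s)\<^sup>2) \<partial>M)
    \<le> ennreal p * (\<integral>\<^sup>+ s. ennreal ((F1 s)\<^sup>2) \<partial>M) + ennreal (1 - p) * (\<integral>\<^sup>+ s. ennreal ((F2 s)\<^sup>2) \<partial>M)"
proof -
  have "(p * x + (1 - p) * y)\<^sup>2 \<le> p * x\<^sup>2 + (1 - p) * y\<^sup>2" for x y :: real
  proof -
    have "0 \<le> p * (1 - p) * (x - y)\<^sup>2" using p by simp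
    then show ?thesis by (simp add: power2_eq_square algebra_simps)
  qed
  then have "(\<integral>\<^sup>+ s. ennreal ((p * F1 s + (1 - p) * F2 s)\<^sup>2) \<partial>M)
    \<le> (\<integral>\<^sup>+ s. ennreal p * ennreal ((F1 s)\<^sup>2) + ennreal (1 - p) * ennreal ((F2 s)\<^sup>2) \<partial>M)"
    using p by (intro nn_integral_mono) (simp add: ennreal_mult[symmetric] ennreal_plus[symmetric] del: ennreal_plus)
  also have "\<dots> = ennreal p * (\<integral>\<^sup>+ s. ennreal ((F1 s)\<^sup>2) \<partial>M) + ennreal (1 - p) * (\<integral>\<^sup>+ s. ennreal ((F2 s)\<^sup>2) \<partial>M)"
    by (simp add: nn_integral_add nn_integral_cmult)
  finally show ?thesis .
qed

lemma nn_integral_le_sum3: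
  fixes f :: "'a \<Rightarrow> real"
  assumes [measurable]: "a \<in> borel_measurable M" "b \<in> borel_measurable M"
    and le: "\<And>x. x \<in> space M \<Longrightarrow> \<bar>f x\<bar> \<le> \<bar>a x\<bar> + \<bar>b x\<bar> + c" "c \<ge> 0" and M: "prob_space M"
  shows "(\<integral>\<^sup>+ x. ennreal ((f x)\<^sup>2) \<partial>M)
    \<le> 3 * (\<integral>\<^sup>+ x. ennreal ((a x)\<^sup>2) \<partial>M) + 3 * (\<integral>\<^sup>+ x. ennreal ((b x)\<^sup>2) \<partial>M) + ennreal (3 * c\<^sup>2)"
proof -
  interpret prob_space M by (rule M)
  have "(f x)\<^sup>2 \<le> 3 * (a x)\<^sup>2 + 3 * (b x)\<^sup>2 + 3 * c\<^sup>2" if "x \<in> space M" for x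
  proof -
    have "(f x)\<^sup>2 \<le> (\<bar>a x\<bar> + \<bar>b x\<bar> + c)\<^sup>2"
      using power_mono[OF le(1)[OF that] abs_ge_zero, of 2] by simp
    also have "\<dots> \<le> 3 * \<bar>a x\<bar>\<^sup>2 + 3 * \<bar>b x\<bar>\<^sup>2 + 3 * c\<^sup>2"
    proof -
      have "0 \<le> (\<bar>a x\<bar> - \<bar>b x\<bar>)\<^sup>2 + (\<bar>a x\<bar> - c)\<^sup>2 + (\<bar>b x\<bar> - c)\<^sup>2" by simp
      then show ?thesis by (simp add: power2_eq_square algebra_simps)
    qed
    finally show ?thesis by simp
  qed
  then have "(\<integral>\<^sup>+ x. ennreal ((f x)\<^sup>2) \<partial>M) \<le> (\<integral>\<^sup>+ x. 3 * ennreal ((a x)\<^sup>2) + 3 * ennreal ((b x)\<^sup>2) + ennreal (3 * c\<^sup>2) \<partial>M)"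
  proof (intro nn_integral_mono)
    fix x assume "x \<in> space M"
    then have "ennreal ((f x)\<^sup>2) \<le> ennreal (3 * (a x)\<^sup>2 + 3 * (b x)\<^sup>2 + 3 * c\<^sup>2)"
      using \<open>\<And>x. x \<in> space M \<Longrightarrow> (f x)\<^sup>2 \<le> 3 * (a x)\<^sup>2 + 3 * (b x)\<^sup>2 + 3 * c\<^sup>2\<close> by (intro ennreal_leI)
    also have "\<dots> = 3 * ennreal ((a x)\<^sup>2) + 3 * ennreal ((b x)\<^sup>2) + ennreal (3 * c\<^sup>2)"
      by (simp add: ennreal_mult)
    finally show "ennreal ((f x)\<^sup>2) \<le> 3 * ennreal ((a x)\<^sup>2) + 3 * ennreal ((b x)\<^sup>2) + ennreal (3 * c\<^sup>2)" .
  qed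
  also have "\<dots> = 3 * (\<integral>\<^sup>+ x. ennreal ((a x)\<^sup>2) \<partial>M) + 3 * (\<integral>\<^sup>+ x. ennreal ((b x)\<^sup>2) \<partial>M) + ennreal (3 * c\<^sup>2)"
    by (simp add: nn_integral_add nn_integral_cmult emeasure_space_1)
  finally show ?thesis .
qed

text \<open>The weight between the two gradients depends on \<open>g\<close> but not on the time
  variable, so convexity of the squared norm bounds it by \<open>1 + (e1 g + e2 g)\<close> for each
  \<open>g\<close>.\<close>

lemma grad_approx_max:
  assumes f1: "grad_approx f1" and f2: "grad_approx f2"
  shows "grad_approx (\<lambda>g. max (f1 g) (f2 g))"
  unfolding grad_approx_def
proof (intro conjI allI impI)
  note [measurable] = grad_approx_measurable[OF f1] grad_approx_measurable[OF f2]
  show "(\<lambda>g. max (f1 g) (f2 g)) \<in> borel_measurable Q" by measurable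
  fix \<epsilon> :: real assume \<epsilon>: "\<epsilon> > 0"
  \<comment> \<open>Three errors, two from the approximations and one from smoothing, enter through
    the square of a sum of three terms, each with a factor 3; the choice
    \<open>\<delta> = sqrt \<eta>\<close> below gives smoothing an equal share.\<close>
  define \<eta> where "\<eta> = \<epsilon> / 9"
  have \<eta>: "\<eta> > 0" using \<epsilon> by (simp add: \<eta>_def)
  obtain h1 F1 e1 where 1: "(h1, F1) \<in> Z1_graph" "e1 \<in> borel_measurable Q"
    "(\<integral>\<^sup>+ g. ennreal ((h1 g - f1 g)\<^sup>2) \<partial>Q) \<le> ennreal \<eta>"
    "\<forall>g\<in>G0. (\<integral>\<^sup>+ s. ennreal ((F1 g s)\<^sup>2) \<partial>unit_leb) \<le> 1 + e1 g"
    "(\<integral>\<^sup>+ g. e1 g \<partial>Q) \<le> ennreal \<eta>"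
    by (rule grad_approxE[OF f1 \<eta>])
  obtain h2 F2 e2 where 2: "(h2, F2) \<in> Z1_graph" "e2 \<in> borel_measurable Q"
    "(\<integral>\<^sup>+ g. ennreal ((h2 g - f2 g)\<^sup>2) \<partial>Q) \<le> ennreal \<eta>"
    "\<forall>g\<in>G0. (\<integral>\<^sup>+ s. ennreal ((F2 g s)\<^sup>2) \<partial>unit_leb) \<le> 1 + e2 g"
    "(\<integral>\<^sup>+ g. e2 g \<partial>Q) \<le> ennreal \<eta>"
    by (rule grad_approxE[OF f2 \<eta>])
  note [measurable] = 1(2) 2(2) Z1_measurable(1)[OF 1(1)] Z1_measurable(1)[OF 2(1)]
  define \<delta> where "\<delta> = sqrt \<eta>"
  have \<delta>: "\<delta> > 0" "\<delta>\<^sup>2 = \<eta>" using \<eta> by (auto simp: \<delta>_def)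
  define w where "w g = smooth_max_weight \<delta> (h1 g) (h2 g)" for g
  have w: "0 \<le> w g" "w g \<le> 1" for g unfolding w_def by (rule smooth_max_weight_bounds[OF \<delta>(1)])+
  show "\<exists>f' F e. (f', F) \<in> Z1_graph \<and> e \<in> borel_measurable Q \<and>
        (\<integral>\<^sup>+ g. ennreal ((f' g - max (f1 g) (f2 g))\<^sup>2) \<partial>Q) \<le> ennreal \<epsilon> \<and>
        (\<forall>g\<in>G0. (\<integral>\<^sup>+ s. ennreal ((F g s)\<^sup>2) \<partial>unit_leb) \<le> 1 + e g) \<and>
        (\<integral>\<^sup>+ g. e g \<partial>Q) \<le> ennreal \<epsilon>"
  proof (intro exI conjI ballI)
    show "(\<lambda>g. smooth_max \<delta> (h1 g) (h2 g), \<lambda>g t. w g * F1 g t + (1 - w g) * F2 g t) \<in> Z1_graph"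
      unfolding w_def by (rule Z1_smooth_max[OF 1(1) 2(1) \<delta>(1)])
    show "(\<lambda>g. e1 g + e2 g) \<in> borel_measurable Q" by measurable
    have "(\<integral>\<^sup>+ g. e1 g + e2 g \<partial>Q) \<le> ennreal \<eta> + ennreal \<eta>"
      using add_mono[OF 1(5) 2(5)] by (subst nn_integral_add) auto
    also have "\<dots> \<le> ennreal \<epsilon>" using \<eta> by (simp add: ennreal_plus[symmetric] \<eta>_def del: ennreal_plus)
    finally show "(\<integral>\<^sup>+ g. e1 g + e2 g \<partial>Q) \<le> ennreal \<epsilon>" .
    show "(\<integral>\<^sup>+ s. ennreal ((w g * F1 g s + (1 - w g) * F2 g s)\<^sup>2) \<partial>unit_leb) \<le> 1 + (e1 g + e2 g)" if g: "g \<in> G0" for g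
    proof -
      have "(\<integral>\<^sup>+ s. ennreal ((w g * F1 g s + (1 - w g) * F2 g s)\<^sup>2) \<partial>unit_leb)
        \<le> ennreal (w g) * (\<integral>\<^sup>+ s. ennreal ((F1 g s)\<^sup>2) \<partial>unit_leb) + ennreal (1 - w g) * (\<integral>\<^sup>+ s. ennreal ((F2 g s)\<^sup>2) \<partial>unit_leb)"
        by (rule nn_integral_square_convex[OF w]) (use Z1_measurable(3)[OF 1(1) g] Z1_measurable(3)[OF 2(1) g] in auto)
      also have "\<dots> \<le> ennreal (w g) * (1 + e1 g) + ennreal (1 - w g) * (1 + e2 g)"
        by (intro add_mono mult_left_mono 1(4)[rule_format] 2(4)[rule_format] g) auto
      also have "\<dots> = (ennreal (w g) + ennreal (1 - w g)) + (ennreal (w g) * e1 g + ennreal (1 - w g) * e2 g)"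
        by (simp add: distrib_left add_ac)
      also have "\<dots> \<le> 1 + (1 * e1 g + 1 * e2 g)"
      proof (intro add_mono mult_right_mono)
        show "ennreal (w g) + ennreal (1 - w g) \<le> 1" using w[of g] by (simp add: ennreal_plus[symmetric] del: ennreal_plus)
      qed (use w[of g] in auto)
      finally show ?thesis by simp
    qed
    have "(\<integral>\<^sup>+ g. ennreal ((smooth_max \<delta> (h1 g) (h2 g) - max (f1 g) (f2 g))\<^sup>2) \<partial>Q)
      \<le> 3 * (\<integral>\<^sup>+ g. ennreal ((h1 g - f1 g)\<^sup>2) \<partial>Q) + 3 * (\<integral>\<^sup>+ g. ennreal ((h2 g - f2 g)\<^sup>2) \<partial>Q) + ennreal (3 * \<delta>\<^sup>2)"
    proof (rule nn_integral_le_sum3)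
      fix g
      have "\<bar>max (h1 g) (h2 g) - max (f1 g) (f2 g)\<bar> \<le> \<bar>h1 g - f1 g\<bar> + \<bar>h2 g - f2 g\<bar>" by (auto simp: max_def)
      then show "\<bar>smooth_max \<delta> (h1 g) (h2 g) - max (f1 g) (f2 g)\<bar> \<le> \<bar>h1 g - f1 g\<bar> + \<bar>h2 g - f2 g\<bar> + \<delta>"
        using smooth_max_approx[OF \<delta>(1), of "h1 g" "h2 g"] by linarith
    qed (use \<delta> Q.prob_space_axioms in auto)
    also have "\<dots> \<le> 3 * ennreal \<eta> + 3 * ennreal \<eta> + ennreal (3 * \<eta>)"
      unfolding \<delta>(2) by (intro add_mono mult_left_mono 1(3) 2(3)) auto
    also have "\<dots> = ennreal (3 * \<eta>) + ennreal (3 * \<eta>) + ennreal (3 * \<eta>)"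
      using \<eta> by (simp add: ennreal_mult)
    also have "\<dots> = ennreal \<epsilon>"
      using \<eta> by (simp add: ennreal_plus[symmetric] \<eta>_def del: ennreal_plus)
    finally show "(\<integral>\<^sup>+ g. ennreal ((smooth_max \<delta> (h1 g) (h2 g) - max (f1 g) (f2 g))\<^sup>2) \<partial>Q) \<le> ennreal \<epsilon>" .
  qed
qed

lemma grad_approx_min:
  assumes "grad_approx f1" "grad_approx f2"
  shows "grad_approx (\<lambda>g. min (f1 g) (f2 g))"
proof -
  have "grad_approx (\<lambda>g. - max (- f1 g) (- f2 g))"
    using assms by (intro grad_approx_uminus grad_approx_max)
  then show ?thesis by (simp add: minus_max_eq_min)
qed

lemma grad_approx_limit:
  assumes u [measurable]: "u \<in> borel_measurable Q"
    and lim: "\<And>\<epsilon>. \<epsilon> > 0 \<Longrightarrow> \<exists>f. grad_approx f \<and> (\<integral>\<^sup>+ g. ennreal ((f g - u g)\<^sup>2) \<partial>Q) \<le> ennreal \<epsilon>"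
  shows "grad_approx u"
  unfolding grad_approx_def
proof (intro conjI allI impI u)
  fix \<epsilon> :: real assume \<epsilon>: "\<epsilon> > 0"
  \<comment> \<open>Two errors, each with a factor 3 from the square of the sum, so each may use
    \<open>\<epsilon> / 6\<close>.\<close>
  then have \<eta>: "\<epsilon> / 6 > 0" by simp
  obtain f where f: "grad_approx f" "(\<integral>\<^sup>+ g. ennreal ((f g - u g)\<^sup>2) \<partial>Q) \<le> ennreal (\<epsilon> / 6)"
    using lim[OF \<eta>] by blast
  obtain h F e where h: "(h, F) \<in> Z1_graph" "e \<in> borel_measurable Q"
    "(\<integral>\<^sup>+ g. ennreal ((h g - f g)\<^sup>2) \<partial>Q) \<le> ennreal (\<epsilon> / 6)"
    "\<forall>g\<in>G0. (\<integral>\<^sup>+ s. ennreal ((F g s)\<^sup>2) \<partial>unit_leb) \<le> 1 + e g"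
    "(\<integral>\<^sup>+ g. e g \<partial>Q) \<le> ennreal (\<epsilon> / 6)"
    by (rule grad_approxE[OF f(1) \<eta>])
  note [measurable] = grad_approx_measurable[OF f(1)] Z1_measurable(1)[OF h(1)]
  have "(\<integral>\<^sup>+ g. ennreal ((h g - u g)\<^sup>2) \<partial>Q)
    \<le> 3 * (\<integral>\<^sup>+ g. ennreal ((h g - f g)\<^sup>2) \<partial>Q) + 3 * (\<integral>\<^sup>+ g. ennreal ((f g - u g)\<^sup>2) \<partial>Q) + ennreal (3 * 0\<^sup>2)"
    by (rule nn_integral_le_sum3) (use Q.prob_space_axioms in auto)
  also have "\<dots> \<le> 3 * ennreal (\<epsilon> / 6) + 3 * ennreal (\<epsilon> / 6) + ennreal (3 * 0\<^sup>2)"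
    by (intro add_mono mult_left_mono h(3) f(2)) auto
  also have "\<dots> = ennreal (\<epsilon> / 2) + ennreal (\<epsilon> / 2) + ennreal (3 * 0\<^sup>2)"
    using \<epsilon> ennreal_mult[of 3 "\<epsilon> / 6"] by simp
  also have "\<dots> = ennreal \<epsilon>"
    using \<epsilon> by (simp add: ennreal_plus[symmetric] del: ennreal_plus)
  finally have 1: "(\<integral>\<^sup>+ g. ennreal ((h g - u g)\<^sup>2) \<partial>Q) \<le> ennreal \<epsilon>" .
  have "(\<integral>\<^sup>+ g. e g \<partial>Q) \<le> ennreal \<epsilon>"
    using h(5) by (rule order.trans) (use \<epsilon> in \<open>simp add: ennreal_leI\<close>)
  with 1 h show "\<exists>f' F e. (f', F) \<in> Z1_graph \<and> e \<in> borel_measurable Q \<and>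
        (\<integral>\<^sup>+ g. ennreal ((f' g - u g)\<^sup>2) \<partial>Q) \<le> ennreal \<epsilon> \<and>
        (\<forall>g\<in>G0. (\<integral>\<^sup>+ s. ennreal ((F g s)\<^sup>2) \<partial>unit_leb) \<le> 1 + e g) \<and>
        (\<integral>\<^sup>+ g. e g \<partial>Q) \<le> ennreal \<epsilon>"
    by blast
qed

end

section \<open>Linear functionals as limits of cylinder functions\<close>

text \<open>A \<open>C\<^sup>1\<close> cutoff which is 1 left of \<open>-1\<close> and 0 right of 1; its derivative is minus the hat function,
  whose integer translates form a partition of unity.\<close>

definition hat :: "real \<Rightarrow> real" where
  "hat z = max 0 (z + 1) - 2 * max 0 z + max 0 (z - 1)"

definition cutoff :: "real \<Rightarrow> real" where
  "cutoff z = 1 - ((max 0 (z + 1))\<^sup>2 - 2 * (max 0 z)\<^sup>2 + (max 0 (z - 1))\<^sup>2) / 2"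

text \<open>\<open>cutoff\<close> is a combination of translates of this function, so its regularity
  reduces to this case. The first-order remainder is at most the square of \<open>h\<close>, also
  across the kink at 0.\<close>

lemma DERIV_pos_part_square: "((\<lambda>z::real. (max 0 z)\<^sup>2) has_real_derivative 2 * max 0 z) (at z)"
proof -
  have "((\<lambda>h. ((max 0 (z + h))\<^sup>2 - (max 0 z)\<^sup>2) / h - 2 * max 0 z) \<longlongrightarrow> 0) (at 0)"
  proof (rule Lim_null_comparison[OF _ tendsto_rabs_zero[OF tendsto_ident_at]])
    have "\<bar>(max 0 (z + h))\<^sup>2 - (max 0 z)\<^sup>2 - 2 * max 0 z * h\<bar> \<le> h\<^sup>2" for h :: real
    proof -
      consider "0 \<le> z" "0 \<le> z + h" | "0 \<le> z" "z + h \<le> 0" | "z \<le> 0" "0 \<le> z + h" | "z \<le> 0" "z + h \<le> 0" by linarith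
      then show ?thesis
      proof cases
        case 1 then show ?thesis by (simp add: max_def power2_eq_square algebra_simps)
      next
        case 2
        then have "(max 0 (z + h))\<^sup>2 - (max 0 z)\<^sup>2 - 2 * max 0 z * h = h\<^sup>2 - (z + h)\<^sup>2"
          by (simp add: max_def power2_eq_square algebra_simps)
        moreover have "(z + h)\<^sup>2 \<le> h\<^sup>2"
          using 2 by (intro power2_le_iff_abs_le[THEN iffD2] abs_le_square_iff[THEN iffD1]) auto
        ultimately show ?thesis by simp
      next
        case 3
        have "(z + h)\<^sup>2 \<le> h\<^sup>2" by (rule power_mono) (use 3 in auto)
        moreover have "(max 0 (z + h))\<^sup>2 - (max 0 z)\<^sup>2 - 2 * max 0 z * h = (z + h)\<^sup>2"
          using 3 by (simp add: max_def)
        ultimately show ?thesis by simp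
      next
        case 4 then show ?thesis by (simp add: max_def)
      qed
    qed
    then have "norm (((max 0 (z + h))\<^sup>2 - (max 0 z)\<^sup>2) / h - 2 * max 0 z) \<le> \<bar>h\<bar>" if "h \<noteq> 0" for h :: real
    proof -
      have "((max 0 (z + h))\<^sup>2 - (max 0 z)\<^sup>2) / h - 2 * max 0 z = ((max 0 (z + h))\<^sup>2 - (max 0 z)\<^sup>2 - 2 * max 0 z * h) / h"
        using that by (simp add: field_simps)
      then have "norm (((max 0 (z + h))\<^sup>2 - (max 0 z)\<^sup>2) / h - 2 * max 0 z) = \<bar>(max 0 (z + h))\<^sup>2 - (max 0 z)\<^sup>2 - 2 * max 0 z * h\<bar> / \<bar>h\<bar>"
        by simp
      also have "\<dots> \<le> h\<^sup>2 / \<bar>h\<bar>"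
        by (rule divide_right_mono) (use \<open>\<And>h. \<bar>(max 0 (z + h))\<^sup>2 - (max 0 z)\<^sup>2 - 2 * max 0 z * h\<bar> \<le> h\<^sup>2\<close> in auto)
      also have "\<dots> = \<bar>h\<bar>" using that by (simp add: power2_eq_square abs_if)
      finally show ?thesis .
    qed
    then show "\<forall>\<^sub>F h in at 0. norm (((max 0 (z + h))\<^sup>2 - (max 0 z)\<^sup>2) / h - 2 * max 0 z) \<le> \<bar>h\<bar>"
      by (auto simp: eventually_at_filter)
  qed
  then show ?thesis unfolding DERIV_def by (simp add: LIM_zero_iff)
qed

lemma DERIV_cutoff: "(cutoff has_real_derivative - hat z) (at z)"
proof -
  have s: "((\<lambda>z. (max 0 (z + c))\<^sup>2) has_real_derivative 2 * max 0 (z + c)) (at z)" for c :: real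
  proof -
    have "((\<lambda>z. z + c) has_real_derivative 1) (at z)" by (auto intro!: derivative_eq_intros)
    from DERIV_chain2[where f="\<lambda>z. (max 0 z)\<^sup>2" and g="\<lambda>z. z + c", OF DERIV_pos_part_square this]
    show ?thesis by simp
  qed
  have "((\<lambda>z. 1 - ((max 0 (z + 1))\<^sup>2 - 2 * (max 0 (z + 0))\<^sup>2 + (max 0 (z + - 1))\<^sup>2) / 2) has_real_derivative
     0 - (2 * max 0 (z + 1) - 2 * (2 * max 0 (z + 0)) + 2 * max 0 (z + - 1)) / 2) (at z)"
    by (intro DERIV_diff DERIV_const DERIV_cdivide DERIV_add DERIV_cmult s)
  moreover have "(\<lambda>z. 1 - ((max 0 (z + 1))\<^sup>2 - 2 * (max 0 (z + 0))\<^sup>2 + (max 0 (z + - 1))\<^sup>2) / 2) = cutoff"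
    by (simp add: cutoff_def fun_eq_iff)
  moreover have "0 - (2 * max 0 (z + 1) - 2 * (2 * max 0 (z + 0)) + 2 * max 0 (z + - 1)) / 2 = - hat z"
    by (simp add: hat_def field_simps)
  ultimately show ?thesis by (simp only:)
qed

lemma hat_continuous: "continuous_on A hat"
  unfolding hat_def[abs_def] by (intro continuous_intros)

lemma hat_nonneg: "0 \<le> hat z"
  by (auto simp: hat_def max_def)

lemma hat_zero: "1 \<le> \<bar>z\<bar> \<Longrightarrow> hat z = 0"
  by (auto simp: hat_def max_def)

lemma cutoff_left: "z \<le> - 1 \<Longrightarrow> cutoff z = 1"
  by (auto simp: cutoff_def max_def)

lemma cutoff_right: "1 \<le> z \<Longrightarrow> cutoff z = 0"
  by (simp add: cutoff_def max_def power2_eq_square algebra_simps)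

lemma cutoff_bounds: "0 \<le> cutoff z" "cutoff z \<le> 1"
proof -
  consider "z \<le> - 1" | "-1 \<le> z" "z \<le> 0" | "0 \<le> z" "z \<le> 1" | "1 \<le> z" by linarith
  then have "0 \<le> cutoff z \<and> cutoff z \<le> 1"
  proof cases
    case 2
    then have "cutoff z = 1 - (z + 1)\<^sup>2 / 2" by (auto simp: cutoff_def max_def)
    moreover have "(z + 1)\<^sup>2 \<le> 1" using 2 by (intro power_le_one) auto
    ultimately show ?thesis by simp
  next
    case 3
    then have "cutoff z = (1 - z)\<^sup>2 / 2" by (simp add: cutoff_def max_def power2_eq_square field_simps)
    moreover have "(1 - z)\<^sup>2 \<le> 1" using 3 by (intro power_le_one) auto
    ultimately show ?thesis using zero_le_power2[of "1 - z"] by linarith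
  qed (auto simp: cutoff_left cutoff_right)
  then show "0 \<le> cutoff z" "cutoff z \<le> 1" by auto
qed

text \<open>\<open>hat\<close> is a second difference of the positive part, hence a difference of
  two consecutive translates of the clamp \<open>cl\<close>. The sum telescopes to the two outermost
  clamps, which equal 1 and 0 for \<open>z\<close> between 0 and \<open>N\<close>.\<close>

lemma sum_hat:
  assumes "0 \<le> z" "z \<le> real N"
  shows "(\<Sum>j<Suc N. hat (z - real j)) = 1"
proof -
  define cl where "cl z = max 0 z - max 0 (z - 1)" for z :: real
  have "hat (z - real j) = - (cl (z + 1 - real (Suc j)) - cl (z + 1 - real j))" for j
    by (simp add: hat_def cl_def algebra_simps)
  then have "(\<Sum>j<Suc N. hat (z - real j)) = - (\<Sum>j<Suc N. cl (z + 1 - real (Suc j)) - cl (z + 1 - real j))"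
    by (simp only: sum_negf)
  also have "\<dots> = cl (z + 1) - cl (z - real N)"
    by (subst sum_lessThan_telescope[of "\<lambda>j. cl (z + 1 - real j)"]) (simp add: algebra_simps)
  also have "\<dots> = 1" using assms by (auto simp: cl_def max_def)
  finally show ?thesis .
qed

lemma measure_unit_leb_UNIV: "measure unit_leb UNIV = 1"
  using unit_leb.prob_space by simp

lemma measure_unit_leb_Icc: "0 \<le> a \<Longrightarrow> a \<le> b \<Longrightarrow> b \<le> 1 \<Longrightarrow> (\<integral>r. indicator {a..b} r \<partial>unit_leb) = b - a"
proof -
  assume ab: "0 \<le> a" "a \<le> b" "b \<le> 1"
  have "(\<integral>r. indicator {a..b} r \<partial>unit_leb) = (LINT r:{0..1}|lborel. indicator {a..b} r :: real)"
    by (rule LINT_unit_leb[symmetric]) simp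
  also have "\<dots> = (\<integral>r. indicator {a..b} r \<partial>lborel)"
    unfolding set_lebesgue_integral_def by (intro Bochner_Integration.integral_cong) (use ab in \<open>auto simp: indicator_def\<close>)
  also have "\<dots> = b - a" using ab by simp
  finally show ?thesis .
qed

lemma integral_unit_leb_ge:
  assumes h: "h \<in> borel_measurable borel" "\<And>r. 0 \<le> h r" "\<And>r. h r \<le> 1"
    and a: "0 \<le> a" "a \<le> 1" "\<And>r. 0 \<le> r \<Longrightarrow> r \<le> a \<Longrightarrow> h r = 1"
  shows "a \<le> (\<integral>r. h r \<partial>unit_leb)"
proof -
  have "a = (\<integral>r. indicator {0..a} r \<partial>unit_leb)" using measure_unit_leb_Icc[of 0 a] a by simp
  also have "\<dots> \<le> (\<integral>r. h r \<partial>unit_leb)"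
  proof (rule integral_mono)
    show "integrable unit_leb h" by (rule integrable_unit_leb_bounded[of _ 1]) (use h in \<open>auto simp: abs_of_nonneg\<close>)
    show "integrable unit_leb (indicator {0..a} :: real \<Rightarrow> real)"
      by (rule integrable_unit_leb_bounded[of _ 1]) (auto simp: indicator_def)
  qed (use h a in \<open>auto simp: indicator_def\<close>)
  finally show ?thesis .
qed

lemma integral_unit_leb_le:
  assumes h: "h \<in> borel_measurable borel" "\<And>r. 0 \<le> h r" "\<And>r. h r \<le> 1"
    and a: "0 \<le> a" "a \<le> 1" "\<And>r. a \<le> r \<Longrightarrow> r \<le> 1 \<Longrightarrow> h r = 0"
  shows "(\<integral>r. h r \<partial>unit_leb) \<le> a"
proof -
  have "(\<integral>r. h r \<partial>unit_leb) \<le> (\<integral>r. indicator {0..a} r \<partial>unit_leb)"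
  proof (rule integral_mono_AE)
    show "integrable unit_leb h" by (rule integrable_unit_leb_bounded[of _ 1]) (use h in \<open>auto simp: abs_of_nonneg\<close>)
    show "integrable unit_leb (indicator {0..a} :: real \<Rightarrow> real)"
      by (rule integrable_unit_leb_bounded[of _ 1]) (auto simp: indicator_def)
    show "AE r in unit_leb. h r \<le> indicator {0..a} r"
      by (rule AE_unit_leb_I) (use h(3) a(3) in \<open>auto simp: indicator_def\<close>)
  qed
  also have "\<dots> = a" using measure_unit_leb_Icc[of 0 a] a by simp
  finally show ?thesis .
qed

section \<open>Level times of a monotone function and the cylinder functions built on them\<close>

context entropic
begin

context
  fixes v :: "real \<Rightarrow> real" and B c :: real
  assumes v: "continuous_on UNIV v" and B: "\<And>s. \<bar>v s\<bar> \<le> B"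
begin

lemma v_measurable [measurable]: "v \<in> borel_measurable borel"
  by (rule borel_measurable_continuous_onI[OF v])

text \<open>The Lebesgue measure of the times at which \<open>g\<close> is below
  \<open>j / N\<close>, with the indicator smoothed over \<open>1 / N\<close> on either side. For
  nondecreasing \<open>g\<close> it approximates a generalised inverse at that level.\<close>

definition occ_time :: "nat \<Rightarrow> (real \<Rightarrow> real) \<Rightarrow> nat \<Rightarrow> real" where
  "occ_time N g j = (\<integral>r. cutoff (real N * g r - real j) \<partial>unit_leb)"

lemma cutoff_measurable:
  assumes "g \<in> G0"
  shows "(\<lambda>r. cutoff (real N * g r - real j)) \<in> borel_measurable borel"
proof -
  have "continuous_on UNIV cutoff" by (rule DERIV_continuous_on[OF has_field_derivative_at_within[OF DERIV_cutoff]])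
  then have [measurable]: "cutoff \<in> borel_measurable borel" by (rule borel_measurable_continuous_onI)
  note [measurable] = G0_measurable[OF assms]
  show ?thesis by measurable
qed

text \<open>Smoothing shifts a level by at most \<open>1 / N\<close>: as long as \<open>g\<close>
  has not exceeded \<open>(j - 1) / N\<close>, the cutoff is still 1. With the counterpart for
  \<open>(j + 1) / N\<close> this makes \<open>occ_time\<close> usable as an inverse of
  \<open>g\<close>.\<close>

lemma occ_time_ge:
  assumes g: "g \<in> G0" and a: "0 \<le> a" "a \<le> 1" "real N * g a - real j \<le> - 1"
  shows "a \<le> occ_time N g j"
  unfolding occ_time_def
proof (rule integral_unit_leb_ge[OF cutoff_measurable[OF g] cutoff_bounds a(1,2)])
  fix r assume "0 \<le> r" "r \<le> a"
  then have "real N * g r \<le> real N * g a" by (intro mult_left_mono G0_mono[OF g]) (use a in auto)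
  then show "cutoff (real N * g r - real j) = 1" using a(3) by (intro cutoff_left) linarith
qed

lemma occ_time_le:
  assumes g: "g \<in> G0" and a: "0 \<le> a" "a \<le> 1" "1 \<le> real N * g a - real j"
  shows "occ_time N g j \<le> a"
  unfolding occ_time_def
proof (rule integral_unit_leb_le[OF cutoff_measurable[OF g] cutoff_bounds a(1,2)])
  fix r assume "a \<le> r" "r \<le> 1"
  then have "real N * g a \<le> real N * g r" by (intro mult_left_mono G0_mono[OF g]) (use a in auto)
  then show "cutoff (real N * g r - real j) = 0" using a(3) by (intro cutoff_right) linarith
qed

lemma occ_time_bounds:
  assumes g: "g \<in> G0"
  shows "0 \<le> occ_time N g j" "occ_time N g j \<le> 1"
proof -
  have i: "integrable unit_leb (\<lambda>r. cutoff (real N * g r - real j))"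
    by (rule integrable_unit_leb_bounded[OF cutoff_measurable[OF g], where B=1]) (use cutoff_bounds in \<open>auto simp: abs_of_nonneg\<close>)
  show "0 \<le> occ_time N g j" unfolding occ_time_def by (rule integral_nonneg_AE) (use cutoff_bounds in auto)
  have "occ_time N g j \<le> (\<integral>r. 1 \<partial>unit_leb)" unfolding occ_time_def
    by (rule integral_mono[OF i]) (use cutoff_bounds in auto)
  then show "occ_time N g j \<le> 1" by (simp add: measure_unit_leb_UNIV)
qed

text \<open>The levels whose inverse is at most \<open>s\<close> number about
  \<open>N * g s\<close>. In the upper bound smoothing, the passage to a time right of
  \<open>s\<close>, and rounding cost at most one level each, whence the 3.\<close>

lemma count_occ_time:
  assumes g: "g \<in> G0" and s: "0 < s" "s < 1" and N: "N > 0"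
  shows "\<bar>(\<Sum>j<Suc N. indicator {occ_time N g j..1} s) / real N - g s\<bar> \<le> 3 / real N"
proof -
  define J where "J = {j. j < Suc N \<and> occ_time N g j \<le> s}"
  have finJ: "finite J" by (auto simp: J_def)
  have gs: "0 \<le> g s" "g s \<le> 1" using G0_range[OF g, of s] by auto
  have "(\<Sum>j<Suc N. indicator {occ_time N g j..1} s) = (\<Sum>j<Suc N. if occ_time N g j \<le> s then 1 else 0 :: real)"
    by (intro sum.cong) (use s in auto)
  also have "\<dots> = (\<Sum>j\<in>J. 1)"
    unfolding J_def by (subst sum.inter_filter[symmetric]) (auto intro!: sum.cong)
  finally have card: "(\<Sum>j<Suc N. indicator {occ_time N g j..1} s) = real (card J)" by simp
  define x where "x = real N * g s"
  have x: "0 \<le> x" "x \<le> real N" using gs by (auto simp: x_def mult_left_le)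
  have "{..<nat \<lfloor>x\<rfloor>} \<subseteq> J"
  proof
    fix j assume "j \<in> {..<nat \<lfloor>x\<rfloor>}"
    then have "real j + 1 \<le> of_int \<lfloor>x\<rfloor>" using x(1) by (auto simp: zless_nat_eq_int_zless)
    then have j: "real j + 1 \<le> x" using of_int_floor_le order_trans by blast
    then have "occ_time N g j \<le> s" by (intro occ_time_le[OF g]) (use s in \<open>auto simp: x_def\<close>)
    moreover have "j < Suc N" using j x(2) by linarith
    ultimately show "j \<in> J" by (simp add: J_def)
  qed
  from card_mono[OF finJ this] have "nat \<lfloor>x\<rfloor> \<le> card J" by simp
  moreover have "x - 1 \<le> real (nat \<lfloor>x\<rfloor>)" using x(1) by linarith
  ultimately have lower: "x - 1 \<le> real (card J)" by linarith
  have "J \<subseteq> {..<nat \<lceil>x\<rceil> + 2}"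
  proof
    fix j assume j: "j \<in> J"
    show "j \<in> {..<nat \<lceil>x\<rceil> + 2}"
    proof (rule ccontr)
      assume "\<not> ?thesis"
      \<comment> \<open>A time strictly right of \<open>s\<close> is wanted, since
        \<open>s \<le> occ_time N g j\<close> would not exclude \<open>j\<close> from
        \<open>J\<close>. Right continuity supplies one at the cost of less than one level.\<close>
      then have jx: "x + 2 \<le> real j" using x(1) by (auto simp: not_less) linarith
      have "\<forall>\<^sub>F r in at_right s. g r < g s + 1 / real N"
        using order_tendstoD(2)[OF G0_right_cont[OF g, of s], of "g s + 1 / real N"] s N by auto
      moreover have "\<forall>\<^sub>F r in at_right s. r \<in> {s<..<1}"
        by (rule eventually_at_right_real[OF s(2)])
      ultimately have "\<forall>\<^sub>F r in at_right s. g r < g s + 1 / real N \<and> r \<in> {s<..<1}"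
        by (rule eventually_conj)
      then obtain r where r: "g r < g s + 1 / real N" "s < r" "r < 1"
        using eventually_happens'[of "at_right s"] by (auto simp: trivial_limit_at_right_real)
      have "real N * g r \<le> real N * (g s + 1 / real N)" using r(1) by (intro mult_left_mono) auto
      also have "\<dots> = x + 1" using N by (simp add: x_def algebra_simps)
      finally have "r \<le> occ_time N g j" using jx s r by (intro occ_time_ge[OF g]) auto
      then show False using j r by (simp add: J_def)
    qed
  qed
  then have "card J \<le> nat \<lceil>x\<rceil> + 2" using card_mono[of "{..<nat \<lceil>x\<rceil> + 2}" J] by simp
  then have upper: "real (card J) \<le> x + 3" using x(1) by linarith
  have "real (card J) / real N - g s = (real (card J) - x) / real N"
    using N by (simp add: x_def field_simps)
  also have "\<bar>(real (card J) - x) / real N\<bar> \<le> 3 / real N"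
    using lower upper N by (auto simp: abs_divide intro!: divide_right_mono)
  finally show ?thesis unfolding card .
qed

text \<open>For an antiderivative \<open>V\<close> of \<open>v\<close> the difference
  \<open>V 1 - V m\<close> is the integral of \<open>v\<close> over [m,1]. The sum is then a Riemann
  sum over the levels of \<open>g\<close>, with smoothed level times in place of exact ones.\<close>

definition lin_approx :: "nat \<Rightarrow> (real \<Rightarrow> real) \<Rightarrow> (real \<Rightarrow> real) \<Rightarrow> real" where
  "lin_approx N V g = c + (\<Sum>j<Suc N. V 1 - V (avec (Suc N) (\<lambda>j y. cutoff (real N * y - real j)) g j)) / real N"

text \<open>The factor \<open>N\<close> from the steep cutoff cancels the mesh \<open>1 / N\<close>.
  What is left is an average of \<open>v\<close> over the inverse times of the levels near
  \<open>g t\<close>, weighted by the partition of unity \<open>hat\<close>.\<close>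

definition lin_grad :: "nat \<Rightarrow> (real \<Rightarrow> real) \<Rightarrow> real \<Rightarrow> real" where
  "lin_grad N g t = (\<Sum>j<Suc N. v (avec (Suc N) (\<lambda>j y. cutoff (real N * y - real j)) g j) * hat (real N * g t - real j))"

lemma C1_cutoff: "C1_01 (Suc N) (\<lambda>j y. cutoff (real N * y - real j)) (\<lambda>j y. - (real N * hat (real N * y - real j)))"
  unfolding C1_01_def
proof (intro allI impI conjI ballI)
  fix i s
  have "((\<lambda>y. real N * y - real i) has_real_derivative real N) (at s)"
    by (auto intro!: derivative_eq_intros)
  from DERIV_chain2[OF DERIV_cutoff this]
  have "((\<lambda>y. cutoff (real N * y - real i)) has_real_derivative - (real N * hat (real N * s - real i))) (at s)"
    by (simp add: mult.commute)
  then show "((\<lambda>y. cutoff (real N * y - real i)) has_real_derivative - (real N * hat (real N * s - real i))) (at s within {0..1})"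
    by (rule has_field_derivative_at_within)
  show "continuous_on {0..1} (\<lambda>y. - (real N * hat (real N * y - real i)))"
    by (intro continuous_intros continuous_on_compose2[OF hat_continuous[of UNIV]]) auto
qed

lemma avec_occ_time: "g \<in> G0 \<Longrightarrow> j < Suc N \<Longrightarrow> avec (Suc N) (\<lambda>j y. cutoff (real N * y - real j)) g j = occ_time N g j"
  unfolding occ_time_def by (rule avec_eq[OF C1_cutoff])

lemma lin_Z1:
  assumes V: "\<And>x. (V has_real_derivative v x) (at x)" and N: "N > 0"
  shows "(lin_approx N V, lin_grad N) \<in> Z1_graph"
proof -
  define U where "U x = c + (\<Sum>j<Suc N. V 1 - V (x j)) / real N" for x :: "nat \<Rightarrow> real"
  define D where "D i x = - (v (x i) / real N)" for i :: nat and x :: "nat \<Rightarrow> real"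
  have CU: "C1_Rm (Suc N) U D"
    unfolding C1_Rm_def
  proof (intro conjI allI impI)
    fix x show "U x = U (\<lambda>j. if j < Suc N then x j else 0)" by (simp add: U_def)
  next
    fix i x assume i: "i < Suc N"
    have "(\<Sum>j<Suc N. V 1 - V ((x(i := h)) j)) = (V 1 - V h) + (\<Sum>j\<in>{..<Suc N} - {i}. V 1 - V (x j))" for h
      using i by (subst sum.remove[of _ i]) (auto intro!: sum.cong)
    then have "U (x(i := h)) = c + ((V 1 - V h) + (\<Sum>j\<in>{..<Suc N} - {i}. V 1 - V (x j))) / real N" for h
      unfolding U_def by (simp only:)
    moreover have "((\<lambda>h. c + ((V 1 - V h) + (\<Sum>j\<in>{..<Suc N} - {i}. V 1 - V (x j))) / real N) has_real_derivative
        0 + ((0 - v (x i)) + 0) / real N) (at (x i))"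
      by (intro DERIV_add DERIV_const DERIV_cdivide DERIV_diff V)
    ultimately show "((\<lambda>h. U (x(i := h))) has_real_derivative D i x) (at (x i))"
      by (simp add: D_def)
  next
    fix i
    have "continuous_on UNIV (\<lambda>x::nat \<Rightarrow> real. v (x i))"
      by (rule continuous_on_compose2[OF v continuous_on_product_coordinates]) simp
    then show "continuous_on UNIV (D i)" unfolding D_def using N by (intro continuous_intros) auto
  qed
  have "lin_approx N V = (\<lambda>g. U (avec (Suc N) (\<lambda>j y. cutoff (real N * y - real j)) g))"
    by (simp add: lin_approx_def U_def fun_eq_iff)
  moreover have "lin_grad N = (\<lambda>g t. \<Sum>i<Suc N. D i (avec (Suc N) (\<lambda>j y. cutoff (real N * y - real j)) g) * (- (real N * hat (real N * g t - real i))))"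
    unfolding lin_grad_def[abs_def] D_def using N by (intro ext sum.cong) auto
  ultimately show ?thesis unfolding Z1_graph_def using CU C1_cutoff[of N] by blast
qed

text \<open>Exchanging sum and integral turns the Riemann sum into the integral of
  \<open>n * v\<close>, where \<open>n s\<close> counts the levels with inverse at most
  \<open>s\<close>, divided by \<open>N\<close>; it is within \<open>3 / N\<close> of
  \<open>g s\<close>.\<close>

lemma lin_approx_error:
  assumes V: "\<And>x. (V has_real_derivative v x) (at x)" and N: "N > 0" and g: "g \<in> G0"
  shows "\<bar>lin_approx N V g - (c + (\<integral>s. g s * v s \<partial>unit_leb))\<bar> \<le> 3 * B / real N"
proof -
  note gm [measurable] = G0_measurable[OF g]
  have B0: "0 \<le> B" using B[of 0] by simp
  have FTC: "V 1 - V a = (\<integral>s. v s * indicator {a..1} s \<partial>unit_leb)" if "0 \<le> a" "a \<le> 1" for a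
  proof -
    have "(\<integral>s. v s * indicator {a..1} s \<partial>lborel) = V 1 - V a"
      by (rule integral_FTC_Icc_real) (use that V v in \<open>auto simp: continuous_on_eq_continuous_at\<close>)
    moreover have "(\<integral>s. v s * indicator {a..1} s \<partial>unit_leb) = (LINT s:{0..1}|lborel. v s * indicator {a..1} s)"
      by (rule LINT_unit_leb[symmetric]) measurable
    moreover have "(LINT s:{0..1}|lborel. v s * indicator {a..1} s) = (\<integral>s. v s * indicator {a..1} s \<partial>lborel)"
      unfolding set_lebesgue_integral_def
      by (intro Bochner_Integration.integral_cong) (use that in \<open>auto simp: indicator_def\<close>)
    ultimately show ?thesis by simp
  qed
  define n where "n s = (\<Sum>j<Suc N. indicator {occ_time N g j..1} s) / real N" for s
  have nm [measurable]: "n \<in> borel_measurable borel" unfolding n_def by measurable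
  have i1: "integrable unit_leb (\<lambda>s. v s * indicator {occ_time N g j..1} s)" for j
    by (rule integrable_unit_leb_bounded[of _ B]) (use B B0 in \<open>auto simp: indicator_def\<close>)
  have "(\<Sum>j<Suc N. V 1 - V (avec (Suc N) (\<lambda>j y. cutoff (real N * y - real j)) g j))
      = (\<Sum>j<Suc N. \<integral>s. v s * indicator {occ_time N g j..1} s \<partial>unit_leb)"
    by (intro sum.cong refl) (simp add: avec_occ_time[OF g] FTC occ_time_bounds[OF g])
  also have "\<dots> = (\<integral>s. (\<Sum>j<Suc N. v s * indicator {occ_time N g j..1} s) \<partial>unit_leb)"
    by (rule Bochner_Integration.integral_sum[symmetric]) (rule i1)
  finally have "lin_approx N V g - c = (\<integral>s. (\<Sum>j<Suc N. v s * indicator {occ_time N g j..1} s) \<partial>unit_leb) / real N"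
    by (simp add: lin_approx_def)
  also have "\<dots> = (\<integral>s. n s * v s \<partial>unit_leb)"
    unfolding n_def by (simp add: sum_distrib_left[symmetric] sum_divide_distrib[symmetric] mult.commute flip: integral_divide_zero)
  finally have eq: "lin_approx N V g - c = (\<integral>s. n s * v s \<partial>unit_leb)" .
  have n_bound: "\<bar>n s\<bar> \<le> real (Suc N) / real N" for s
  proof -
    have "\<bar>\<Sum>j<Suc N. indicator {occ_time N g j..1} s :: real\<bar> \<le> (\<Sum>j<Suc N. 1)"
      by (intro order.trans[OF sum_abs] sum_mono) (auto simp: indicator_def)
    then show ?thesis using N by (simp add: n_def abs_divide divide_right_mono)
  qed
  have in': "integrable unit_leb (\<lambda>s. n s * v s)"
  proof (rule integrable_unit_leb_bounded[of _ "real (Suc N) / real N * B"])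
    show "\<bar>n s * v s\<bar> \<le> real (Suc N) / real N * B" for s
      unfolding abs_mult by (intro mult_mono n_bound B) auto
  qed measurable
  have ig: "integrable unit_leb (\<lambda>s. g s * v s)"
  proof (rule integrable_unit_leb_bounded[of _ "1 * B"])
    show "\<bar>g s * v s\<bar> \<le> 1 * B" for s
      unfolding abs_mult by (intro mult_mono B) (use G0_range[OF g, of s] in auto)
  qed measurable
  have "lin_approx N V g - (c + (\<integral>s. g s * v s \<partial>unit_leb)) = (\<integral>s. n s * v s - g s * v s \<partial>unit_leb)"
    using eq in' ig by simp
  then have "\<bar>lin_approx N V g - (c + (\<integral>s. g s * v s \<partial>unit_leb))\<bar> \<le> (\<integral>s. \<bar>n s * v s - g s * v s\<bar> \<partial>unit_leb)"
    using integral_abs_bound by metis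
  also have "\<dots> \<le> (\<integral>s. 3 * B / real N \<partial>unit_leb)"
  proof (rule integral_mono_AE)
    show "AE s in unit_leb. \<bar>n s * v s - g s * v s\<bar> \<le> 3 * B / real N"
    proof (rule AE_unit_leb_I)
      fix s :: real assume s: "s \<in> {0<..<1}"
      have "\<bar>n s * v s - g s * v s\<bar> = \<bar>n s - g s\<bar> * \<bar>v s\<bar>" by (simp add: left_diff_distrib[symmetric] abs_mult)
      also have "\<dots> \<le> (3 / real N) * B"
        unfolding n_def by (intro mult_mono B count_occ_time[OF g _ _ N]) (use s in auto)
      finally show "\<bar>n s * v s - g s * v s\<bar> \<le> 3 * B / real N" by simp
    qed
  qed (use in' ig in auto)
  also have "\<dots> = 3 * B / real N" by (simp add: measure_unit_leb_UNIV)
  finally show ?thesis .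
qed

lemma lin_grad_eq: "g \<in> G0 \<Longrightarrow> lin_grad N g s = (\<Sum>j<Suc N. v (occ_time N g j) * hat (real N * g s - real j))"
  unfolding lin_grad_def by (intro sum.cong refl) (simp add: avec_occ_time)

lemma sum_hat_G0: "g \<in> G0 \<Longrightarrow> (\<Sum>j<Suc N. hat (real N * g s - real j)) = 1"
  by (rule sum_hat) (use G0_range[of g s] in \<open>auto simp: mult_left_le\<close>)

lemma lin_grad_bound:
  assumes g: "g \<in> G0"
  shows "\<bar>lin_grad N g s\<bar> \<le> B"
proof -
  have "\<bar>lin_grad N g s\<bar> \<le> (\<Sum>j<Suc N. B * hat (real N * g s - real j))"
    unfolding lin_grad_eq[OF g]
    by (intro order.trans[OF sum_abs] sum_mono) (auto simp: abs_mult hat_nonneg abs_of_nonneg intro!: mult_right_mono B)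
  also have "\<dots> = B" unfolding sum_distrib_left[symmetric] sum_hat_G0[OF g] by simp
  finally show ?thesis .
qed

text \<open>Only levels within \<open>1 / N\<close> of \<open>g s\<close> carry weight. Strict
  increase of \<open>g\<close> forces their inverse times to approach \<open>s\<close>; a flat piece
  could keep them away from \<open>s\<close>, whereas a jump does no harm.\<close>

lemma lin_grad_tendsto:
  assumes g: "g \<in> G0" and strict: "\<And>s t. 0 \<le> s \<Longrightarrow> s < t \<Longrightarrow> t \<le> 1 \<Longrightarrow> g s < g t" and s: "0 < s" "s < 1"
  shows "(\<lambda>N. lin_grad (Suc N) g s) \<longlonglongrightarrow> v s"
proof (rule LIMSEQ_I)
  fix e :: real assume e: "0 < e"
  have "isCont v s" using v by (simp add: continuous_on_eq_continuous_at)
  then obtain d where d: "d > 0" "\<And>x. \<bar>x - s\<bar> < d \<Longrightarrow> \<bar>v x - v s\<bar> < e / 2"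
    using e unfolding continuous_at_eps_delta dist_real_def by (metis half_gt_zero)
  define d' where "d' = min (d / 2) (min (s / 2) ((1 - s) / 2))"
  have d': "0 < d'" "d' < d" "d' < s" "d' < 1 - s" using d s by (auto simp: d'_def min_def)
  define \<gamma> where "\<gamma> = min (g s - g (s - d')) (g (s + d') - g s)"
  have \<gamma>: "\<gamma> > 0" using strict[of "s - d'" s] strict[of s "s + d'"] d' s by (simp add: \<gamma>_def)
  \<comment> \<open>Two level widths: one for the distance of the level from \<open>g s\<close>, one
    for the smoothing inside \<open>occ_time\<close>.\<close>
  obtain N0 where N0: "2 / \<gamma> < real N0" using reals_Archimedean2 by blast
  show "\<exists>no. \<forall>n\<ge>no. norm (lin_grad (Suc n) g s - v s) < e"
  proof (intro exI[of _ N0] allI impI)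
    fix n assume n: "N0 \<le> n"
    define N where "N = Suc n"
    have N: "2 \<le> real N * \<gamma>"
    proof -
      have "2 / \<gamma> \<le> real N" using N0 n by (simp add: N_def)
      then show ?thesis using \<gamma> by (simp add: divide_le_eq)
    qed
    have close: "\<bar>v (occ_time N g j) - v s\<bar> \<le> e / 2" if "\<bar>real N * g s - real j\<bar> < 1" for j
    proof -
      have "real N * \<gamma> \<le> real N * (g s - g (s - d'))" "real N * \<gamma> \<le> real N * (g (s + d') - g s)"
        by (intro mult_left_mono; simp add: \<gamma>_def)+
      then have "real N * g (s - d') - real j \<le> - 1" "1 \<le> real N * g (s + d') - real j"
        using N that unfolding right_diff_distrib abs_less_iff by linarith+
      then have "s - d' \<le> occ_time N g j" "occ_time N g j \<le> s + d'"
        using d' s by (auto intro!: occ_time_ge[OF g] occ_time_le[OF g])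
      then have "\<bar>occ_time N g j - s\<bar> < d" using d' by linarith
      then show ?thesis using d(2) by (simp add: less_imp_le)
    qed
    have "lin_grad N g s - v s = (\<Sum>j<Suc N. (v (occ_time N g j) - v s) * hat (real N * g s - real j))"
      unfolding lin_grad_eq[OF g] left_diff_distrib sum_subtractf sum_distrib_left[symmetric] sum_hat_G0[OF g] by simp
    then have "\<bar>lin_grad N g s - v s\<bar> \<le> (\<Sum>j<Suc N. \<bar>(v (occ_time N g j) - v s) * hat (real N * g s - real j)\<bar>)"
      using sum_abs by metis
    also have "\<dots> \<le> (\<Sum>j<Suc N. e / 2 * hat (real N * g s - real j))"
    proof (rule sum_mono)
      fix j
      show "\<bar>(v (occ_time N g j) - v s) * hat (real N * g s - real j)\<bar> \<le> e / 2 * hat (real N * g s - real j)"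
      proof (cases "\<bar>real N * g s - real j\<bar> < 1")
        case True
        show ?thesis unfolding abs_mult abs_of_nonneg[OF hat_nonneg]
          by (rule mult_right_mono[OF close[OF True] hat_nonneg])
      next
        case False then show ?thesis by (simp add: hat_zero)
      qed
    qed
    also have "\<dots> = e / 2" unfolding sum_distrib_left[symmetric] sum_hat_G0[OF g] by simp
    finally show "norm (lin_grad (Suc n) g s - v s) < e" using e by (simp add: N_def)
  qed
qed

text \<open>The cylinder gradients are bounded by \<open>B\<close> and, for almost every
  \<open>g\<close>, converge to \<open>v\<close>. By dominated convergence the L1 distance of their
  squares from the square of \<open>v\<close> tends to 0 in mean, and this distance serves as the
  excess.\<close>

lemma grad_approx_linear:
  assumes v1: "(\<integral>\<^sup>+ s. ennreal ((v s)\<^sup>2) \<partial>unit_leb) \<le> 1"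
  shows "grad_approx (\<lambda>g. c + (\<integral>s. g s * v s \<partial>unit_leb))"
  unfolding grad_approx_def
proof (intro conjI allI impI)
  have B0: "0 \<le> B" using B[of 0] by simp
  have ev: "(\<lambda>(g, s). g s * v s) \<in> borel_measurable (Q \<Otimes>\<^sub>M unit_leb)"
  proof -
    have 1: "(\<lambda>x. fst x (snd x)) \<in> borel_measurable (Q \<Otimes>\<^sub>M unit_leb)"
      using evaluation_measurable by (simp add: case_prod_beta' cong: measurable_cong_sets sets_pair_measure_cong)
    have "(\<lambda>x. v (snd x)) \<in> borel_measurable (Q \<Otimes>\<^sub>M unit_leb)"
      by (rule measurable_compose[OF measurable_snd]) simp
    from borel_measurable_times[OF 1 this] show ?thesis by (simp add: case_prod_beta')
  qed
  have fm: "(\<lambda>g. \<integral>s. g s * v s \<partial>unit_leb) \<in> borel_measurable Q"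
    by (rule unit_leb.borel_measurable_lebesgue_integral[OF ev])
  then show "(\<lambda>g. c + (\<integral>s. g s * v s \<partial>unit_leb)) \<in> borel_measurable Q" by measurable
  fix \<epsilon> :: real assume \<epsilon>: "\<epsilon> > 0"
  obtain V where V: "\<And>x. (V has_real_derivative v x) (at x)"
  proof -
    have "\<exists>F. \<forall>x. -\<infinity> < ereal x \<longrightarrow> ereal x < \<infinity> \<longrightarrow> (F has_vector_derivative v x) (at x)"
      by (rule einterval_antiderivative) (use v in \<open>auto simp: continuous_on_eq_continuous_at\<close>)
    then show ?thesis using that by (auto simp: has_real_derivative_iff_has_vector_derivative)
  qed
  define e where "e N g = (\<integral>s. \<bar>(lin_grad (Suc N) g s)\<^sup>2 - (v s)\<^sup>2\<bar> \<partial>unit_leb)" for N g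
  have Z: "(lin_approx (Suc N) V, lin_grad (Suc N)) \<in> Z1_graph" for N by (rule lin_Z1[OF V]) simp
  have em [measurable]: "e N \<in> borel_measurable Q" for N
  proof -
    have 1: "(\<lambda>x. lin_grad (Suc N) (fst x) (snd x)) \<in> borel_measurable (Q \<Otimes>\<^sub>M unit_leb)"
      using Z1_measurable(2)[OF Z[of N]] by (simp add: case_prod_beta')
    have 2: "(\<lambda>x. v (snd x)) \<in> borel_measurable (Q \<Otimes>\<^sub>M unit_leb)"
      by (rule measurable_compose[OF measurable_snd]) simp
    have "(\<lambda>(g, s). \<bar>(lin_grad (Suc N) g s)\<^sup>2 - (v s)\<^sup>2\<bar>) \<in> borel_measurable (Q \<Otimes>\<^sub>M unit_leb)"
      unfolding case_prod_beta' using 1 2 by (intro borel_measurable_abs borel_measurable_diff borel_measurable_power)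
    then show ?thesis unfolding e_def[abs_def] by (rule unit_leb.borel_measurable_lebesgue_integral)
  qed
  have sq: "\<bar>(lin_grad (Suc N) g s)\<^sup>2 - (v s)\<^sup>2\<bar> \<le> 2 * B\<^sup>2" if "g \<in> G0" for N g s
  proof -
    have "(lin_grad (Suc N) g s)\<^sup>2 \<le> B\<^sup>2" "(v s)\<^sup>2 \<le> B\<^sup>2"
      using lin_grad_bound[OF that] B B0 by (auto simp: power2_le_iff_abs_le)
    then show ?thesis by (simp add: abs_le_iff) (smt (verit) zero_le_power2)
  qed
  have gm: "lin_grad (Suc N) g \<in> borel_measurable borel" if "g \<in> G0" for N g
    by (rule Z1_measurable(3)[OF Z that])
  have i: "integrable unit_leb (\<lambda>s. \<bar>(lin_grad (Suc N) g s)\<^sup>2 - (v s)\<^sup>2\<bar>)" if "g \<in> G0" for N g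
    by (rule integrable_unit_leb_bounded[of _ "2 * B\<^sup>2"]) (use gm[OF that] sq[OF that] in auto)
  have e0: "0 \<le> e N g" for N g unfolding e_def by (rule integral_nonneg_AE) simp
  have eB: "e N g \<le> 2 * B\<^sup>2" if "g \<in> G0" for N g
  proof -
    have "e N g \<le> (\<integral>s. 2 * B\<^sup>2 \<partial>unit_leb)"
      unfolding e_def by (rule integral_mono[OF i[OF that]]) (use sq[OF that] in auto)
    then show ?thesis by (simp add: measure_unit_leb_UNIV)
  qed
  have elim: "AE g in Q. (\<lambda>N. e N g) \<longlonglongrightarrow> 0"
    using AE_space AE_strict_mono
  proof eventually_elim
    case (elim g)
    then have g: "g \<in> G0" by (simp add: space_Q)
    have "(\<lambda>N. e N g) \<longlonglongrightarrow> (\<integral>s. \<bar>(v s)\<^sup>2 - (v s)\<^sup>2\<bar> \<partial>unit_leb)"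
      unfolding e_def
    proof (rule integral_dominated_convergence[where w="\<lambda>_. 2 * B\<^sup>2"])
      show "AE s in unit_leb. (\<lambda>N. \<bar>(lin_grad (Suc N) g s)\<^sup>2 - (v s)\<^sup>2\<bar>) \<longlonglongrightarrow> \<bar>(v s)\<^sup>2 - (v s)\<^sup>2\<bar>"
      proof (rule AE_unit_leb_I)
        fix s :: real assume "s \<in> {0<..<1}"
        then have "(\<lambda>N. lin_grad (Suc N) g s) \<longlonglongrightarrow> v s" using elim(2) by (intro lin_grad_tendsto[OF g]) auto
        then show "(\<lambda>N. \<bar>(lin_grad (Suc N) g s)\<^sup>2 - (v s)\<^sup>2\<bar>) \<longlonglongrightarrow> \<bar>(v s)\<^sup>2 - (v s)\<^sup>2\<bar>"
          by (intro tendsto_rabs tendsto_diff tendsto_power tendsto_const)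
      qed
    qed (use gm[OF g] sq[OF g] in auto)
    then show ?case by simp
  qed
  have "(\<lambda>N. \<integral>g. e N g \<partial>Q) \<longlonglongrightarrow> (\<integral>g. 0 \<partial>Q)"
    by (rule integral_dominated_convergence[where w="\<lambda>_. 2 * B\<^sup>2"])
       (use elim e0 eB in \<open>auto simp: space_Q intro!: AE_I2\<close>)
  then have "\<forall>\<^sub>F N in sequentially. (\<integral>g. e N g \<partial>Q) < \<epsilon>"
    using \<epsilon> by (intro order_tendstoD(2)) auto
  moreover have "\<forall>\<^sub>F N in sequentially. (3 * B / real (Suc N))\<^sup>2 < \<epsilon>"
  proof -
    have "(\<lambda>N. 3 * B * (1 / real (Suc N))) \<longlonglongrightarrow> 3 * B * 0"
      by (intro tendsto_intros LIMSEQ_Suc[OF lim_1_over_n])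
    then have "(\<lambda>N. (3 * B * (1 / real (Suc N)))\<^sup>2) \<longlonglongrightarrow> (3 * B * 0)\<^sup>2" by (rule tendsto_power)
    then show ?thesis using \<epsilon> by (intro order_tendstoD(2)) auto
  qed
  ultimately have "\<forall>\<^sub>F N in sequentially. (\<integral>g. e N g \<partial>Q) < \<epsilon> \<and> (3 * B / real (Suc N))\<^sup>2 < \<epsilon>"
    by (rule eventually_conj)
  then obtain N where N: "(\<integral>g. e N g \<partial>Q) < \<epsilon>" "(3 * B / real (Suc N))\<^sup>2 < \<epsilon>"
    by (auto simp: eventually_sequentially)
  show "\<exists>f' F e. (f', F) \<in> Z1_graph \<and> e \<in> borel_measurable Q \<and>
        (\<integral>\<^sup>+ g. ennreal ((f' g - (c + (\<integral>s. g s * v s \<partial>unit_leb)))\<^sup>2) \<partial>Q) \<le> ennreal \<epsilon> \<and>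
        (\<forall>g\<in>G0. (\<integral>\<^sup>+ s. ennreal ((F g s)\<^sup>2) \<partial>unit_leb) \<le> 1 + e g) \<and>
        (\<integral>\<^sup>+ g. e g \<partial>Q) \<le> ennreal \<epsilon>"
  proof (intro exI conjI ballI)
    show "(lin_approx (Suc N) V, lin_grad (Suc N)) \<in> Z1_graph" by (rule Z)
    show "(\<lambda>g. ennreal (e N g)) \<in> borel_measurable Q" by measurable
    have "(\<integral>\<^sup>+ g. ennreal ((lin_approx (Suc N) V g - (c + (\<integral>s. g s * v s \<partial>unit_leb)))\<^sup>2) \<partial>Q) \<le> (\<integral>\<^sup>+ g. ennreal \<epsilon> \<partial>Q)"
    proof (intro nn_integral_mono ennreal_leI)
      fix g assume "g \<in> space Q"
      then have "\<bar>lin_approx (Suc N) V g - (c + (\<integral>s. g s * v s \<partial>unit_leb))\<bar> \<le> 3 * B / real (Suc N)"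
        by (intro lin_approx_error[OF V]) (auto simp: space_Q)
      from power_mono[OF this abs_ge_zero, of 2]
      have "(lin_approx (Suc N) V g - (c + (\<integral>s. g s * v s \<partial>unit_leb)))\<^sup>2 \<le> (3 * B / real (Suc N))\<^sup>2"
        by (simp only: power2_abs)
      then show "(lin_approx (Suc N) V g - (c + (\<integral>s. g s * v s \<partial>unit_leb)))\<^sup>2 \<le> \<epsilon>" using N(2) by linarith
    qed
    then show "(\<integral>\<^sup>+ g. ennreal ((lin_approx (Suc N) V g - (c + (\<integral>s. g s * v s \<partial>unit_leb)))\<^sup>2) \<partial>Q) \<le> ennreal \<epsilon>"
      by (simp add: Q.emeasure_space_1)
    show "(\<integral>\<^sup>+ s. ennreal ((lin_grad (Suc N) g s)\<^sup>2) \<partial>unit_leb) \<le> 1 + ennreal (e N g)" if g: "g \<in> G0" for g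
    proof -
      note [measurable] = gm[OF g]
      have "(\<integral>\<^sup>+ s. ennreal ((lin_grad (Suc N) g s)\<^sup>2) \<partial>unit_leb)
        \<le> (\<integral>\<^sup>+ s. ennreal ((v s)\<^sup>2) + ennreal \<bar>(lin_grad (Suc N) g s)\<^sup>2 - (v s)\<^sup>2\<bar> \<partial>unit_leb)"
        by (intro nn_integral_mono) (auto simp: ennreal_plus[symmetric] simp del: ennreal_plus intro!: ennreal_leI)
      also have "\<dots> = (\<integral>\<^sup>+ s. ennreal ((v s)\<^sup>2) \<partial>unit_leb) + (\<integral>\<^sup>+ s. ennreal \<bar>(lin_grad (Suc N) g s)\<^sup>2 - (v s)\<^sup>2\<bar> \<partial>unit_leb)"
        by (rule nn_integral_add) auto
      also have "(\<integral>\<^sup>+ s. ennreal \<bar>(lin_grad (Suc N) g s)\<^sup>2 - (v s)\<^sup>2\<bar> \<partial>unit_leb) = ennreal (e N g)"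
        unfolding e_def by (rule nn_integral_eq_integral[OF i[OF g]]) simp
      finally show ?thesis using v1 add_right_mono order.trans by blast
    qed
    have "(\<integral>\<^sup>+ g. ennreal (e N g) \<partial>Q) = ennreal (\<integral>g. e N g \<partial>Q)"
    proof (rule nn_integral_eq_integral)
      show "integrable Q (e N)"
        by (rule Q.integrable_const_bound[where B="2 * B\<^sup>2"]) (use e0 eB in \<open>auto simp: space_Q intro!: AE_I2\<close>)
    qed (use e0 in auto)
    then show "(\<integral>\<^sup>+ g. ennreal (e N g) \<partial>Q) \<le> ennreal \<epsilon>" using N(1) by (simp add: ennreal_leI)
  qed
qed

end

end

section \<open>Convergence of the gradients\<close>

lemma AE_tendsto_0_subsequence:
  fixes a :: "nat \<Rightarrow> 'a \<Rightarrow> ennreal"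
  assumes [measurable]: "\<And>n. a n \<in> borel_measurable M" and lim: "(\<lambda>n. \<integral>\<^sup>+ x. a n x \<partial>M) \<longlonglongrightarrow> 0"
  obtains r :: "nat \<Rightarrow> nat" where "AE x in M. (\<lambda>n. a (r n) x) \<longlonglongrightarrow> 0"
proof -
  obtain r where r: "\<And>n. (\<integral>\<^sup>+ x. a (r n) x \<partial>M) \<le> ennreal ((1 / 2) ^ n)"
    by (rule fast_subsequence[OF lim]) blast
  have "(\<integral>\<^sup>+ x. (\<Sum>n. a (r n) x) \<partial>M) = (\<Sum>n. \<integral>\<^sup>+ x. a (r n) x \<partial>M)"
    by (rule nn_integral_suminf) simp
  also have "\<dots> \<le> (\<Sum>n. ennreal ((1 / 2) ^ n))" by (intro suminf_le r) auto
  also have "\<dots> < \<infinity>" by (rule suminf_half_powers)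
  finally have "AE x in M. (\<Sum>n. a (r n) x) \<noteq> \<infinity>" by (intro nn_integral_PInf_AE) auto
  then have "AE x in M. (\<lambda>n. a (r n) x) \<longlonglongrightarrow> 0"
  proof eventually_elim
    case (elim x)
    have fin: "a (r n) x < \<infinity>" for n
    proof -
      have "a (r n) x \<le> (\<Sum>n. a (r n) x)" using sum_le_suminf[of "\<lambda>n. a (r n) x" "{n}"] by simp
      then show ?thesis using elim by (simp add: less_top neq_top_trans)
    qed
    have "summable (\<lambda>n. enn2real (a (r n) x))"
      by (rule summable_suminf_not_top) (use elim fin in \<open>auto simp: less_top\<close>)
    then have "(\<lambda>n. enn2real (a (r n) x)) \<longlonglongrightarrow> 0" by (rule summable_LIMSEQ_zero)
    then have "(\<lambda>n. ennreal (enn2real (a (r n) x))) \<longlonglongrightarrow> ennreal 0" by (intro tendsto_ennrealI)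
    then show ?case using fin by (simp add: less_top)
  qed
  then show ?thesis by (rule that)
qed

text \<open>Riesz-Fischer, phrased with nonnegative integrals so that only differences have to be
  square integrable. The limit is taken along a subsequence converging almost everywhere, and
  Fatou's lemma transfers the Cauchy bound to it.\<close>

lemma L2_complete:
  fixes f :: "nat \<Rightarrow> 'a \<Rightarrow> real"
  assumes [measurable]: "\<And>n. f n \<in> borel_measurable M"
    and cauchy: "\<And>\<epsilon>. \<epsilon> > 0 \<Longrightarrow> \<exists>n0. \<forall>m\<ge>n0. \<forall>n\<ge>n0. (\<integral>\<^sup>+ x. ennreal ((f m x - f n x)\<^sup>2) \<partial>M) \<le> ennreal \<epsilon>"
  shows "\<exists>h\<in>borel_measurable M. (\<lambda>n. \<integral>\<^sup>+ x. ennreal ((f n x - h x)\<^sup>2) \<partial>M) \<longlonglongrightarrow> 0"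
proof -
  \<comment> \<open>The rate \<open>(1 / 4) ^ k\<close> leaves \<open>(1 / 2) ^ k\<close> after
    weighting the squares by \<open>2 ^ k\<close>. Summable weighted squares control the absolute
    increments by the inequality of arithmetic and geometric means.\<close>
  have "\<exists>n0. \<forall>m\<ge>n0. \<forall>n\<ge>n0. (\<integral>\<^sup>+ x. ennreal ((f m x - f n x)\<^sup>2) \<partial>M) \<le> ennreal ((1 / 4) ^ k)" for k :: nat
    by (rule cauchy) simp
  then obtain n0 where n0: "\<And>k m n. n0 k \<le> m \<Longrightarrow> n0 k \<le> n \<Longrightarrow>
      (\<integral>\<^sup>+ x. ennreal ((f m x - f n x)\<^sup>2) \<partial>M) \<le> ennreal ((1 / 4) ^ k)"
    by metis
  \<comment> \<open>A running sum dominates all earlier thresholds, so \<open>n0 k \<le> r i\<close>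
    whenever \<open>k \<le> i\<close>, although \<open>n0\<close> itself may fail to be
    monotone.\<close>
  define r where "r k = (\<Sum>i\<le>k. n0 i)" for k
  have r: "n0 k \<le> r k" "n0 k \<le> r (Suc k)" for k
    by (auto simp: r_def sum.atMost_Suc intro: member_le_sum trans_le_add1)
  define \<Delta> where "\<Delta> k x = f (r (Suc k)) x - f (r k) x" for k x
  have [measurable]: "\<Delta> k \<in> borel_measurable M" for k unfolding \<Delta>_def by measurable
  have "(\<integral>\<^sup>+ x. (\<Sum>k. ennreal (2 ^ k * (\<Delta> k x)\<^sup>2)) \<partial>M) = (\<Sum>k. \<integral>\<^sup>+ x. ennreal (2 ^ k * (\<Delta> k x)\<^sup>2) \<partial>M)"
    by (rule nn_integral_suminf) measurable
  also have "\<dots> \<le> (\<Sum>k. ennreal ((1 / 2) ^ k))"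
  proof (rule suminf_le)
    fix k
    have "(\<integral>\<^sup>+ x. ennreal (2 ^ k * (\<Delta> k x)\<^sup>2) \<partial>M) = ennreal (2 ^ k) * (\<integral>\<^sup>+ x. ennreal ((\<Delta> k x)\<^sup>2) \<partial>M)"
      by (subst nn_integral_cmult[symmetric]) (auto simp: ennreal_mult' intro!: nn_integral_cong)
    also have "\<dots> \<le> ennreal (2 ^ k) * ennreal ((1 / 4) ^ k)"
      unfolding \<Delta>_def by (intro mult_left_mono n0 r) auto
    also have "\<dots> = ennreal ((1 / 2) ^ k)"
      by (subst ennreal_mult[symmetric]) (auto simp: power_mult_distrib[symmetric])
    finally show "(\<integral>\<^sup>+ x. ennreal (2 ^ k * (\<Delta> k x)\<^sup>2) \<partial>M) \<le> ennreal ((1 / 2) ^ k)" .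
  qed auto
  also have "\<dots> < \<infinity>" by (rule suminf_half_powers)
  finally have "AE x in M. (\<Sum>k. ennreal (2 ^ k * (\<Delta> k x)\<^sup>2)) \<noteq> \<infinity>"
    by (intro nn_integral_PInf_AE) auto
  then have conv: "AE x in M. convergent (\<lambda>k. f (r k) x)"
  proof eventually_elim
    case (elim x)
    have s1: "summable (\<lambda>k. 2 ^ k * (\<Delta> k x)\<^sup>2)"
      by (rule summable_suminf_not_top) (use elim in auto)
    have "summable (\<lambda>k. (1 / 2 :: real) ^ k)" by (rule summable_geometric) simp
    then have s2: "summable (\<lambda>k. 2 ^ k * (\<Delta> k x)\<^sup>2 + (1 / 2) ^ k)" by (rule summable_add[OF s1])
    have "norm (\<Delta> k x) \<le> 2 ^ k * (\<Delta> k x)\<^sup>2 + (1 / 2) ^ k" for k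
    proof -
      have *: "2 ^ k * (1 / 2 :: real) ^ k = 1" by (simp add: power_mult_distrib[symmetric])
      have "0 \<le> 2 ^ k * (\<bar>\<Delta> k x\<bar> - (1 / 2) ^ k)\<^sup>2" by simp
      also have "\<dots> = 2 ^ k * \<bar>\<Delta> k x\<bar>\<^sup>2 - 2 * \<bar>\<Delta> k x\<bar> * (2 ^ k * (1 / 2) ^ k) + (2 ^ k * (1 / 2) ^ k) * (1 / 2) ^ k"
        by (simp only: power2_diff) (simp add: power2_eq_square algebra_simps)
      finally have "2 * \<bar>\<Delta> k x\<bar> \<le> 2 ^ k * \<bar>\<Delta> k x\<bar>\<^sup>2 + (1 / 2) ^ k" unfolding * by simp
      then show ?thesis by simp
    qed
    then have "summable (\<lambda>k. \<Delta> k x)" using s2 by (rule summable_comparison_test'[where N=0, rotated])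
    then have "(\<lambda>n. \<Sum>k<n. \<Delta> k x) \<longlonglongrightarrow> (\<Sum>k. \<Delta> k x)" by (rule summable_LIMSEQ)
    then have "(\<lambda>n. (\<Sum>k<n. \<Delta> k x) + f (r 0) x) \<longlonglongrightarrow> (\<Sum>k. \<Delta> k x) + f (r 0) x"
      by (intro tendsto_add tendsto_const)
    moreover have "(\<Sum>k<n. \<Delta> k x) + f (r 0) x = f (r n) x" for n
      unfolding \<Delta>_def using sum_lessThan_telescope[of "\<lambda>k. f (r k) x" n] by simp
    ultimately show ?case by (auto simp: convergent_def)
  qed
  define h where "h x = lim (\<lambda>k. f (r k) x)" for x
  have hm [measurable]: "h \<in> borel_measurable M"
    unfolding h_def[abs_def] by (rule borel_measurable_lim_metric) simp
  have bound: "(\<integral>\<^sup>+ x. ennreal ((f n x - h x)\<^sup>2) \<partial>M) \<le> ennreal ((1 / 4) ^ k)" if n: "n0 k \<le> n" for n k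
  proof -
    have "(\<integral>\<^sup>+ x. ennreal ((f n x - h x)\<^sup>2) \<partial>M) = (\<integral>\<^sup>+ x. liminf (\<lambda>i. ennreal ((f n x - f (r i) x)\<^sup>2)) \<partial>M)"
    proof (rule nn_integral_cong_AE)
      show "AE x in M. ennreal ((f n x - h x)\<^sup>2) = liminf (\<lambda>i. ennreal ((f n x - f (r i) x)\<^sup>2))"
        using conv
      proof eventually_elim
        case (elim x)
        then have "(\<lambda>i. f (r i) x) \<longlonglongrightarrow> h x" by (simp add: h_def convergent_LIMSEQ_iff)
        then have "(\<lambda>i. ennreal ((f n x - f (r i) x)\<^sup>2)) \<longlonglongrightarrow> ennreal ((f n x - h x)\<^sup>2)"
          by (intro tendsto_ennrealI tendsto_power tendsto_diff tendsto_const)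
        from lim_imp_Liminf[OF sequentially_bot this] show ?case by (rule sym)
      qed
    qed
    also have "\<dots> \<le> liminf (\<lambda>i. \<integral>\<^sup>+ x. ennreal ((f n x - f (r i) x)\<^sup>2) \<partial>M)"
      by (rule nn_integral_liminf) measurable
    also have "\<dots> \<le> ennreal ((1 / 4) ^ k)"
    proof (rule Liminf_le)
      have "n0 k \<le> r i" if "k \<le> i" for i
        unfolding r_def using that by (intro member_le_sum) auto
      then show "\<forall>\<^sub>F i in sequentially. (\<integral>\<^sup>+ x. ennreal ((f n x - f (r i) x)\<^sup>2) \<partial>M) \<le> ennreal ((1 / 4) ^ k)"
        unfolding eventually_sequentially by (intro exI[of _ k] allI impI n0[OF n])
    qed simp
    finally show ?thesis .
  qed
  have "(\<lambda>n. \<integral>\<^sup>+ x. ennreal ((f n x - h x)\<^sup>2) \<partial>M) \<longlonglongrightarrow> 0"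
    unfolding order_tendsto_iff
  proof (intro conjI allI impI)
    fix l :: ennreal assume "0 < l"
    have "(\<lambda>k. ennreal ((1 / 4) ^ k)) \<longlonglongrightarrow> ennreal 0"
      by (intro tendsto_ennrealI LIMSEQ_power_zero) auto
    then have "\<forall>\<^sub>F k in sequentially. ennreal ((1 / 4) ^ k) < l"
      using \<open>0 < l\<close> by (intro order_tendstoD(2)) auto
    then obtain k where k: "ennreal ((1 / 4) ^ k) < l" by (auto simp: eventually_sequentially)
    show "\<forall>\<^sub>F n in sequentially. (\<integral>\<^sup>+ x. ennreal ((f n x - h x)\<^sup>2) \<partial>M) < l"
      unfolding eventually_sequentially
      by (intro exI[of _ "n0 k"] allI impI le_less_trans[OF bound k])
  qed simp
  then show ?thesis using hm by blast
qed

section \<open>Strong convergence of energy-minimising approximations\<close>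

context entropic
begin

abbreviation "QL \<equiv> Q \<Otimes>\<^sub>M unit_leb"

definition grad_energy :: "((real \<Rightarrow> real) \<Rightarrow> real \<Rightarrow> real) \<Rightarrow> ennreal" where
  "grad_energy F = (\<integral>\<^sup>+ x. ennreal ((F (fst x) (snd x))\<^sup>2) \<partial>QL)"

text \<open>The pairs admissible in \<open>grad_approx\<close> at accuracy
  \<open>\<epsilon>\<close>. Two properties carry the minimisation: the sets shrink with
  \<open>\<epsilon>\<close>, and they contain midpoints.\<close>

definition near :: "((real \<Rightarrow> real) \<Rightarrow> real) \<Rightarrow> real \<Rightarrow> (((real \<Rightarrow> real) \<Rightarrow> real) \<times> ((real \<Rightarrow> real) \<Rightarrow> real \<Rightarrow> real)) set" where
  "near u \<epsilon> = {(f, F). (f, F) \<in> Z1_graph \<and> (\<integral>\<^sup>+ g. ennreal ((f g - u g)\<^sup>2) \<partial>Q) \<le> ennreal \<epsilon> \<and>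
     (\<exists>e. e \<in> borel_measurable Q \<and> (\<forall>g\<in>G0. (\<integral>\<^sup>+ s. ennreal ((F g s)\<^sup>2) \<partial>unit_leb) \<le> 1 + e g) \<and>
        (\<integral>\<^sup>+ g. e g \<partial>Q) \<le> ennreal \<epsilon>)}"

lemma near_mono: "\<epsilon> \<le> \<epsilon>' \<Longrightarrow> near u \<epsilon> \<subseteq> near u \<epsilon>'"
  unfolding near_def using ennreal_leI[of \<epsilon> \<epsilon>'] by (auto intro: order.trans)

lemma grad_energy_iterated:
  assumes "(\<lambda>x. F (fst x) (snd x)) \<in> borel_measurable QL"
  shows "grad_energy F = (\<integral>\<^sup>+ g. \<integral>\<^sup>+ s. ennreal ((F g s)\<^sup>2) \<partial>unit_leb \<partial>Q)"
proof -
  have "(\<lambda>x. ennreal ((F (fst x) (snd x))\<^sup>2)) \<in> borel_measurable QL" using assms by measurable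
  from unit_leb.nn_integral_fst[OF this] show ?thesis by (simp add: grad_energy_def)
qed

lemma Z1_measurable': "(f, F) \<in> Z1_graph \<Longrightarrow> (\<lambda>x. F (fst x) (snd x)) \<in> borel_measurable QL"
  using Z1_measurable(2) by (simp add: case_prod_beta')

lemma near_energy:
  assumes "(f, F) \<in> near u \<epsilon>"
  shows "grad_energy F \<le> 1 + ennreal \<epsilon>"
proof -
  obtain e where Z: "(f, F) \<in> Z1_graph" and [measurable]: "e \<in> borel_measurable Q"
    and e: "\<forall>g\<in>G0. (\<integral>\<^sup>+ s. ennreal ((F g s)\<^sup>2) \<partial>unit_leb) \<le> 1 + e g" "(\<integral>\<^sup>+ g. e g \<partial>Q) \<le> ennreal \<epsilon>"
    using assms unfolding near_def by blast
  have "grad_energy F \<le> (\<integral>\<^sup>+ g. 1 + e g \<partial>Q)"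
    unfolding grad_energy_iterated[OF Z1_measurable'[OF Z]]
    by (rule nn_integral_mono) (use e(1) in \<open>auto simp: space_Q\<close>)
  also have "\<dots> = 1 + (\<integral>\<^sup>+ g. e g \<partial>Q)" by (subst nn_integral_add) (auto simp: Q.emeasure_space_1)
  also have "\<dots> \<le> 1 + ennreal \<epsilon>" by (intro add_left_mono e(2))
  finally show ?thesis .
qed

lemma near_midpoint:
  assumes u [measurable]: "u \<in> borel_measurable Q" and \<epsilon>: "\<epsilon> > 0"
    and 1: "(f1, F1) \<in> near u \<epsilon>" and 2: "(f2, F2) \<in> near u \<epsilon>"
  shows "(\<lambda>g. 1 / 2 * f1 g + (1 - 1 / 2) * f2 g, \<lambda>g t. 1 / 2 * F1 g t + (1 - 1 / 2) * F2 g t) \<in> near u \<epsilon>"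
proof -
  obtain e1 where Z1: "(f1, F1) \<in> Z1_graph" and d1: "(\<integral>\<^sup>+ g. ennreal ((f1 g - u g)\<^sup>2) \<partial>Q) \<le> ennreal \<epsilon>"
    and m1 [measurable]: "e1 \<in> borel_measurable Q"
    and e1: "\<forall>g\<in>G0. (\<integral>\<^sup>+ s. ennreal ((F1 g s)\<^sup>2) \<partial>unit_leb) \<le> 1 + e1 g" "(\<integral>\<^sup>+ g. e1 g \<partial>Q) \<le> ennreal \<epsilon>"
    using 1 unfolding near_def by blast
  obtain e2 where Z2: "(f2, F2) \<in> Z1_graph" and d2: "(\<integral>\<^sup>+ g. ennreal ((f2 g - u g)\<^sup>2) \<partial>Q) \<le> ennreal \<epsilon>"
    and m2 [measurable]: "e2 \<in> borel_measurable Q"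
    and e2: "\<forall>g\<in>G0. (\<integral>\<^sup>+ s. ennreal ((F2 g s)\<^sup>2) \<partial>unit_leb) \<le> 1 + e2 g" "(\<integral>\<^sup>+ g. e2 g \<partial>Q) \<le> ennreal \<epsilon>"
    using 2 unfolding near_def by blast
  note [measurable] = Z1_measurable(1)[OF Z1] Z1_measurable(1)[OF Z2]
  have half: "ennreal (1 / 2) * a + ennreal (1 - 1 / 2) * a = a" for a
  proof -
    have "ennreal (1 / 2) + ennreal (1 - 1 / 2) = 1" by (subst ennreal_plus[symmetric]) auto
    then show ?thesis by (simp only: distrib_right[symmetric] mult_1)
  qed
  have halfs: "ennreal (1 / 2) * a + ennreal (1 - 1 / 2) * b \<le> c" if "a \<le> c" "b \<le> c" for a b c
    using add_mono[OF mult_left_mono[OF that(1), of "ennreal (1 / 2)"] mult_left_mono[OF that(2), of "ennreal (1 - 1 / 2)"]]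
    unfolding half by simp
  show ?thesis unfolding near_def
  proof (intro CollectI case_prodI conjI exI ballI)
    show "(\<lambda>g. 1 / 2 * f1 g + (1 - 1 / 2) * f2 g, \<lambda>g t. 1 / 2 * F1 g t + (1 - 1 / 2) * F2 g t) \<in> Z1_graph"
      by (rule Z1_linear[OF Z1 Z2])
    have "(\<integral>\<^sup>+ g. ennreal ((1 / 2 * f1 g + (1 - 1 / 2) * f2 g - u g)\<^sup>2) \<partial>Q)
      = (\<integral>\<^sup>+ g. ennreal ((1 / 2 * (f1 g - u g) + (1 - 1 / 2) * (f2 g - u g))\<^sup>2) \<partial>Q)"
      by (intro nn_integral_cong arg_cong[where f=ennreal] arg_cong[where f="\<lambda>x. x\<^sup>2"]) (simp add: field_simps)
    also have "\<dots> \<le> ennreal (1 / 2) * (\<integral>\<^sup>+ g. ennreal ((f1 g - u g)\<^sup>2) \<partial>Q) + ennreal (1 - 1 / 2) * (\<integral>\<^sup>+ g. ennreal ((f2 g - u g)\<^sup>2) \<partial>Q)"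
      by (rule nn_integral_square_convex) auto
    also have "\<dots> \<le> ennreal \<epsilon>" by (rule halfs[OF d1 d2])
    finally show "(\<integral>\<^sup>+ g. ennreal ((1 / 2 * f1 g + (1 - 1 / 2) * f2 g - u g)\<^sup>2) \<partial>Q) \<le> ennreal \<epsilon>" .
    show "(\<lambda>g. ennreal (1 / 2) * e1 g + ennreal (1 - 1 / 2) * e2 g) \<in> borel_measurable Q" by measurable
    have "(\<integral>\<^sup>+ g. ennreal (1 / 2) * e1 g + ennreal (1 - 1 / 2) * e2 g \<partial>Q)
      = ennreal (1 / 2) * (\<integral>\<^sup>+ g. e1 g \<partial>Q) + ennreal (1 - 1 / 2) * (\<integral>\<^sup>+ g. e2 g \<partial>Q)"
      by (subst nn_integral_add) (auto simp: nn_integral_cmult)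
    also have "\<dots> \<le> ennreal \<epsilon>" by (rule halfs[OF e1(2) e2(2)])
    finally show "(\<integral>\<^sup>+ g. ennreal (1 / 2) * e1 g + ennreal (1 - 1 / 2) * e2 g \<partial>Q) \<le> ennreal \<epsilon>" .
    fix g assume g: "g \<in> G0"
    have "(\<integral>\<^sup>+ s. ennreal ((1 / 2 * F1 g s + (1 - 1 / 2) * F2 g s)\<^sup>2) \<partial>unit_leb)
      \<le> ennreal (1 / 2) * (\<integral>\<^sup>+ s. ennreal ((F1 g s)\<^sup>2) \<partial>unit_leb) + ennreal (1 - 1 / 2) * (\<integral>\<^sup>+ s. ennreal ((F2 g s)\<^sup>2) \<partial>unit_leb)"
      by (rule nn_integral_square_convex) (use Z1_measurable(3)[OF Z1 g] Z1_measurable(3)[OF Z2 g] in auto)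
    also have "\<dots> \<le> ennreal (1 / 2) * (1 + e1 g) + ennreal (1 - 1 / 2) * (1 + e2 g)"
      by (intro add_mono mult_left_mono e1(1)[rule_format] e2(1)[rule_format] g) auto
    also have "\<dots> = (ennreal (1 / 2) * 1 + ennreal (1 - 1 / 2) * 1) + (ennreal (1 / 2) * e1 g + ennreal (1 - 1 / 2) * e2 g)"
      by (simp only: distrib_left add_ac)
    also have "\<dots> = 1 + (ennreal (1 / 2) * e1 g + ennreal (1 - 1 / 2) * e2 g)" by (simp only: half)
    finally show "(\<integral>\<^sup>+ s. ennreal ((1 / 2 * F1 g s + (1 - 1 / 2) * F2 g s)\<^sup>2) \<partial>unit_leb)
      \<le> 1 + (ennreal (1 / 2) * e1 g + ennreal (1 - 1 / 2) * e2 g)" .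
  qed
qed

text \<open>Stated with sums because subtraction in \<open>ennreal\<close> is truncated. The weights
  are written \<open>1 / 2\<close> and \<open>1 - 1 / 2\<close> to match the convexity estimate
  behind \<open>near_midpoint\<close>.\<close>

lemma parallelogram:
  assumes [measurable]: "(\<lambda>x. F1 (fst x) (snd x)) \<in> borel_measurable QL" "(\<lambda>x. F2 (fst x) (snd x)) \<in> borel_measurable QL"
  shows "grad_energy (\<lambda>g t. F1 g t - F2 g t) + 4 * grad_energy (\<lambda>g t. 1 / 2 * F1 g t + (1 - 1 / 2) * F2 g t)
    = 2 * grad_energy F1 + 2 * grad_energy F2"
proof -
  have pw: "ennreal ((a - b)\<^sup>2) + 4 * ennreal ((1 / 2 * a + (1 - 1 / 2) * b)\<^sup>2) = 2 * ennreal (a\<^sup>2) + 2 * ennreal (b\<^sup>2)" for a b :: real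
  proof -
    have "(a - b)\<^sup>2 + 4 * (1 / 2 * a + (1 - 1 / 2) * b)\<^sup>2 = 2 * a\<^sup>2 + 2 * b\<^sup>2"
      by (simp add: power2_eq_square algebra_simps)
    then have "ennreal ((a - b)\<^sup>2 + 4 * (1 / 2 * a + (1 - 1 / 2) * b)\<^sup>2) = ennreal (2 * a\<^sup>2 + 2 * b\<^sup>2)" by (simp only:)
    then have "ennreal ((a - b)\<^sup>2) + ennreal (4 * (1 / 2 * a + (1 - 1 / 2) * b)\<^sup>2) = ennreal (2 * a\<^sup>2) + ennreal (2 * b\<^sup>2)"
      by (subst (asm) (1 2) ennreal_plus) auto
    then show ?thesis by (simp add: ennreal_mult)
  qed
  have "grad_energy (\<lambda>g t. F1 g t - F2 g t) + 4 * grad_energy (\<lambda>g t. 1 / 2 * F1 g t + (1 - 1 / 2) * F2 g t)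
    = (\<integral>\<^sup>+ x. ennreal ((F1 (fst x) (snd x) - F2 (fst x) (snd x))\<^sup>2)
        + 4 * ennreal ((1 / 2 * F1 (fst x) (snd x) + (1 - 1 / 2) * F2 (fst x) (snd x))\<^sup>2) \<partial>QL)"
    unfolding grad_energy_def by (subst nn_integral_add) (auto simp: nn_integral_cmult)
  also have "\<dots> = (\<integral>\<^sup>+ x. 2 * ennreal ((F1 (fst x) (snd x))\<^sup>2) + 2 * ennreal ((F2 (fst x) (snd x))\<^sup>2) \<partial>QL)"
    by (simp only: pw)
  also have "\<dots> = 2 * grad_energy F1 + 2 * grad_energy F2"
    unfolding grad_energy_def by (subst nn_integral_add) (auto simp: nn_integral_cmult)
  finally show ?thesis .
qed

text \<open>The infimum \<open>d n\<close> of the energy over \<open>near u (\<epsilon> n)\<close>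
  increases with \<open>n\<close> and is at most 2, hence converges. For \<open>n \<le> m\<close>
  the midpoint of the two chosen pairs lies in the larger set and has energy at least
  \<open>d n\<close>, so the parallelogram law bounds the squared distance of the gradients by
  \<open>2 * (dr m - dr n) + 4 * \<epsilon> n\<close>.\<close>

lemma grad_approx_closure:
  assumes u: "grad_approx u"
  shows "\<exists>G. (u, G) \<in> closure_graph Q \<and> (AE g in Q. (\<integral>\<^sup>+ s. ennreal ((G g s)\<^sup>2) \<partial>unit_leb) \<le> 1)"
proof -
  note um [measurable] = grad_approx_measurable[OF u]
  define \<epsilon> where "\<epsilon> n = 1 / real (Suc n)" for n
  have \<epsilon>: "\<epsilon> n > 0" "\<epsilon> n \<le> 1" for n by (auto simp: \<epsilon>_def)
  have \<epsilon>_mono: "\<epsilon> m \<le> \<epsilon> n" if "n \<le> m" for m n unfolding \<epsilon>_def using that by (intro divide_left_mono) auto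
  have \<epsilon>0: "\<epsilon> \<longlonglongrightarrow> 0" unfolding \<epsilon>_def by (rule LIMSEQ_Suc[OF lim_1_over_n])
  have ne: "near u (\<epsilon> n) \<noteq> {}" for n
  proof -
    obtain f' F e where "(f', F) \<in> Z1_graph" "e \<in> borel_measurable Q"
      "(\<integral>\<^sup>+ g. ennreal ((f' g - u g)\<^sup>2) \<partial>Q) \<le> ennreal (\<epsilon> n)"
      "\<forall>g\<in>G0. (\<integral>\<^sup>+ s. ennreal ((F g s)\<^sup>2) \<partial>unit_leb) \<le> 1 + e g"
      "(\<integral>\<^sup>+ g. e g \<partial>Q) \<le> ennreal (\<epsilon> n)"
      by (rule grad_approxE[OF u \<epsilon>(1)])
    then have "(f', F) \<in> near u (\<epsilon> n)" unfolding near_def by blast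
    then show ?thesis by blast
  qed
  define d where "d n = (INF x\<in>near u (\<epsilon> n). grad_energy (snd x))" for n
  have d_le: "d n \<le> grad_energy F" if "(f, F) \<in> near u (\<epsilon> n)" for n f F
    unfolding d_def using INF_lower[OF that, of "\<lambda>x. grad_energy (snd x)"] by simp
  have energy2: "grad_energy F \<le> 2" if "(f, F) \<in> near u (\<epsilon> n)" for n f F
  proof -
    have "1 + ennreal (\<epsilon> n) \<le> 1 + ennreal 1" by (intro add_left_mono ennreal_leI \<epsilon>)
    also have "\<dots> = 2" by simp
    finally show ?thesis using near_energy[OF that] by (rule order.trans[rotated])
  qed
  have d2: "d n \<le> 2" for n
  proof -
    obtain f F where fF: "(f, F) \<in> near u (\<epsilon> n)" using ne[of n] by auto
    show ?thesis using d_le[OF fF] energy2[OF fF] by (rule order.trans)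
  qed
  have d_mono: "d n \<le> d m" if "n \<le> m" for n m
    unfolding d_def by (rule INF_superset_mono[OF near_mono[OF \<epsilon>_mono[OF that]] order_refl])
  \<comment> \<open>Real-valued copy of \<open>d\<close>, so that differences and the Cauchy
    property make sense.\<close>
  define dr where "dr n = enn2real (d n)" for n
  have dfin: "d n < top" for n using d2[of n] by (rule le_less_trans) simp
  have ddr: "d n = ennreal (dr n)" for n using dfin[of n] by (simp add: dr_def)
  have dr0: "0 \<le> dr n" for n by (simp add: dr_def)
  have dr_mono: "dr n \<le> dr m" if "n \<le> m" for n m
    using d_mono[OF that] dr0 by (simp add: ddr)
  have "convergent dr"
  proof (rule Bseq_mono_convergent)
    have "dr n \<le> 2" for n using d2[of n] ennreal_le_iff[of 2 "dr n"] by (simp add: ddr)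
    then show "Bseq dr" using dr0 by (intro BseqI'[of _ 2]) (simp add: abs_of_nonneg)
  qed (use dr_mono in auto)
  then have dr_cauchy: "Cauchy dr" by (rule convergent_Cauchy)
  have "\<exists>x\<in>near u (\<epsilon> n). grad_energy (snd x) \<le> ennreal (dr n + \<epsilon> n)" for n
  proof -
    have "d n < ennreal (dr n + \<epsilon> n)" unfolding ddr using \<epsilon>(1)[of n] dr0[of n] by (simp add: ennreal_less_iff)
    then show ?thesis unfolding d_def using INF_less_iff[of "\<lambda>x. grad_energy (snd x)" "near u (\<epsilon> n)"]
      by (auto intro: less_imp_le)
  qed
  then obtain x where x: "\<And>n. x n \<in> near u (\<epsilon> n)" "\<And>n. grad_energy (snd (x n)) \<le> ennreal (dr n + \<epsilon> n)" by metis
  define f where "f n = fst (x n)" for n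
  define F where "F n = snd (x n)" for n
  have fF: "(f n, F n) \<in> near u (\<epsilon> n)" and FE: "grad_energy (F n) \<le> ennreal (dr n + \<epsilon> n)" for n
    using x by (auto simp: f_def F_def)
  have Z: "(f n, F n) \<in> Z1_graph" for n using fF[of n] by (auto simp: near_def)
  note Fm [measurable] = Z1_measurable'[OF Z]
  have dist_le: "grad_energy (\<lambda>g t. F m g t - F n g t) \<le> ennreal (2 * (dr m - dr n) + 4 * \<epsilon> n)" if nm: "n \<le> m" for n m
  proof -
    define a where "a = grad_energy (\<lambda>g t. F m g t - F n g t)"
    have "(f m, F m) \<in> near u (\<epsilon> n)" using fF[of m] near_mono[OF \<epsilon>_mono[OF nm]] by blast
    from d_le[OF near_midpoint[OF um \<epsilon>(1) this fF[of n]]]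
    have "a + 4 * ennreal (dr n) \<le> a + 4 * grad_energy (\<lambda>g t. 1 / 2 * F m g t + (1 - 1 / 2) * F n g t)"
      unfolding ddr by (intro add_left_mono mult_left_mono) auto
    also have "\<dots> = 2 * grad_energy (F m) + 2 * grad_energy (F n)"
      unfolding a_def by (rule parallelogram) (use Fm in auto)
    also have "\<dots> \<le> 2 * ennreal (dr m + \<epsilon> m) + 2 * ennreal (dr n + \<epsilon> n)"
      by (intro add_mono mult_left_mono FE) auto
    also have "\<dots> = ennreal (2 * (dr m + \<epsilon> m) + 2 * (dr n + \<epsilon> n))"
    proof -
      have "2 * ennreal y = ennreal (2 * y)" if "0 \<le> y" for y using ennreal_mult[of 2 y] that by simp
      then have "2 * ennreal (dr m + \<epsilon> m) + 2 * ennreal (dr n + \<epsilon> n) = ennreal (2 * (dr m + \<epsilon> m)) + ennreal (2 * (dr n + \<epsilon> n))"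
        using dr0[of m] dr0[of n] \<epsilon>(1)[of m] \<epsilon>(1)[of n] by simp
      also have "\<dots> = ennreal (2 * (dr m + \<epsilon> m) + 2 * (dr n + \<epsilon> n))"
        using dr0[of m] dr0[of n] \<epsilon>(1)[of m] \<epsilon>(1)[of n] by (intro ennreal_plus[symmetric]) auto
      finally show ?thesis .
    qed
    finally have le: "a + 4 * ennreal (dr n) \<le> ennreal (2 * (dr m + \<epsilon> m) + 2 * (dr n + \<epsilon> n))" .
    have "a \<le> a + 4 * ennreal (dr n)" by simp
    then have "a < top" using le by (meson ennreal_less_top le_less_trans)
    then have a: "a = ennreal (enn2real a)" by simp
    have "ennreal (enn2real a + 4 * dr n) \<le> ennreal (2 * (dr m + \<epsilon> m) + 2 * (dr n + \<epsilon> n))"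
      using le unfolding a[symmetric] using dr0[of n] by (simp add: ennreal_mult a[symmetric])
    then have "enn2real a + 4 * dr n \<le> 2 * (dr m + \<epsilon> m) + 2 * (dr n + \<epsilon> n)"
      using dr0[of m] dr0[of n] \<epsilon>(1)[of m] \<epsilon>(1)[of n] by (subst (asm) ennreal_le_iff) auto
    then have "enn2real a \<le> 2 * (dr m - dr n) + 4 * \<epsilon> n" using \<epsilon>_mono[OF nm] by simp
    then show ?thesis unfolding a_def[symmetric] by (subst a) (rule ennreal_leI)
  qed
  have "\<exists>h\<in>borel_measurable QL. (\<lambda>n. \<integral>\<^sup>+ x. ennreal ((F n (fst x) (snd x) - h x)\<^sup>2) \<partial>QL) \<longlonglongrightarrow> 0"
  proof (rule L2_complete)
    fix e :: real assume e: "e > 0"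
    obtain n1 where n1: "\<And>m n. n1 \<le> m \<Longrightarrow> n1 \<le> n \<Longrightarrow> \<bar>dr m - dr n\<bar> < e / 4"
      using CauchyD[OF dr_cauchy, of "e / 4"] e by auto
    have "\<forall>\<^sub>F n in sequentially. \<epsilon> n < e / 8" using \<epsilon>0 e by (intro order_tendstoD(2)) auto
    then obtain n2 where n2: "\<And>n. n2 \<le> n \<Longrightarrow> \<epsilon> n < e / 8" by (auto simp: eventually_sequentially)
    have main: "(\<integral>\<^sup>+ x. ennreal ((F m (fst x) (snd x) - F n (fst x) (snd x))\<^sup>2) \<partial>QL) \<le> ennreal e"
      if "max n1 n2 \<le> n" "n \<le> m" for m n
    proof -
      have "\<bar>dr m - dr n\<bar> < e / 4" "\<epsilon> n < e / 8" by (rule n1 n2; use that in simp)+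
      then have "2 * (dr m - dr n) + 4 * \<epsilon> n \<le> e" using abs_ge_self[of "dr m - dr n"] by argo
      then show ?thesis using dist_le[OF that(2)] unfolding grad_energy_def by (meson ennreal_leI order.trans)
    qed
    have "(\<integral>\<^sup>+ x. ennreal ((F m (fst x) (snd x) - F n (fst x) (snd x))\<^sup>2) \<partial>QL) \<le> ennreal e"
      if "max n1 n2 \<le> n" "max n1 n2 \<le> m" for m n
    proof (cases "n \<le> m")
      case True then show ?thesis using main that by blast
    next
      case False then show ?thesis using main[of m n] that by (simp add: power2_commute)
    qed
    then show "\<exists>n0. \<forall>m\<ge>n0. \<forall>n\<ge>n0. (\<integral>\<^sup>+ x. ennreal ((F m (fst x) (snd x) - F n (fst x) (snd x))\<^sup>2) \<partial>QL) \<le> ennreal e"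
      by blast
  qed measurable
  then obtain h where hm [measurable]: "h \<in> borel_measurable QL"
    and hl: "(\<lambda>n. \<integral>\<^sup>+ x. ennreal ((F n (fst x) (snd x) - h x)\<^sup>2) \<partial>QL) \<longlonglongrightarrow> 0" by blast
  define G where "G g t = h (g, t)" for g t
  define k where "k n g = (\<integral>\<^sup>+ s. ennreal ((F n g s - G g s)\<^sup>2) \<partial>unit_leb)" for n g
  have m1: "(\<lambda>x. ennreal ((F n (fst x) (snd x) - h x)\<^sup>2)) \<in> borel_measurable QL" for n
    by measurable
  have km [measurable]: "k n \<in> borel_measurable Q" for n
    unfolding k_def[abs_def] G_def
    using unit_leb.borel_measurable_nn_integral_fst[OF m1[of n]] by simp
  have kint: "(\<integral>\<^sup>+ g. k n g \<partial>Q) = (\<integral>\<^sup>+ x. ennreal ((F n (fst x) (snd x) - h x)\<^sup>2) \<partial>QL)" for n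
    unfolding k_def G_def using unit_leb.nn_integral_fst[OF m1[of n]] by simp
  have k0: "(\<lambda>n. \<integral>\<^sup>+ g. k n g \<partial>Q) \<longlonglongrightarrow> 0" unfolding kint by (rule hl)
  have Gm1: "G g \<in> borel_measurable borel" if "g \<in> G0" for g
    unfolding G_def[abs_def] using measurable_compose[OF measurable_Pair1'[of g Q unit_leb] hm] that by (simp add: space_Q)
  have closure: "(u, G) \<in> closure_graph Q"
    unfolding closure_graph_def
  proof (intro CollectI case_prodI conjI exI allI)
    show "u \<in> borel_measurable Q" by (rule um)
    have "sets QL = sets (Q \<Otimes>\<^sub>M lborel)" by (intro sets_pair_measure_cong) simp_all
    then show "(\<lambda>(g, t). G g t) \<in> borel_measurable (Q \<Otimes>\<^sub>M lborel)"
      using hm by (simp add: G_def case_prod_beta' cong: measurable_cong_sets)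
    show "(f n, F n) \<in> Z1_graph" for n by (rule Z)
    have \<epsilon>lim: "(\<lambda>n. ennreal (\<epsilon> n)) \<longlonglongrightarrow> 0" using tendsto_ennrealI[OF \<epsilon>0] by simp
    have "(\<integral>\<^sup>+ g. ennreal ((f n g - u g)\<^sup>2) \<partial>Q) \<le> ennreal (\<epsilon> n)" for n
      using fF[of n] unfolding near_def by blast
    then show "(\<lambda>n. \<integral>\<^sup>+ g. ennreal ((f n g - u g)\<^sup>2) \<partial>Q) \<longlonglongrightarrow> 0"
      by (intro tendsto_sandwich[OF _ _ tendsto_const \<epsilon>lim]) auto
    have "(\<integral>\<^sup>+ g. (\<integral>\<^sup>+ t. ennreal ((F n g t - G g t)\<^sup>2) * indicator {0..1} t \<partial>lborel) \<partial>Q) = (\<integral>\<^sup>+ g. k n g \<partial>Q)" for n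
    proof (rule nn_integral_cong)
      fix g assume "g \<in> space Q"
      then have g: "g \<in> G0" by (simp add: space_Q)
      note [measurable] = Gm1[OF g] Z1_measurable(3)[OF Z g]
      show "(\<integral>\<^sup>+ t. ennreal ((F n g t - G g t)\<^sup>2) * indicator {0..1} t \<partial>lborel) = k n g"
        unfolding k_def by (rule nn_integral_unit_leb[symmetric]) measurable
    qed
    then show "(\<lambda>n. \<integral>\<^sup>+ g. (\<integral>\<^sup>+ t. ennreal ((F n g t - G g t)\<^sup>2) * indicator {0..1} t \<partial>lborel) \<partial>Q) \<longlonglongrightarrow> 0"
      using k0 by simp
  qed
  have "\<forall>n. \<exists>e. e \<in> borel_measurable Q \<and> (\<forall>g\<in>G0. (\<integral>\<^sup>+ s. ennreal ((F n g s)\<^sup>2) \<partial>unit_leb) \<le> 1 + e g) \<and>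
        (\<integral>\<^sup>+ g. e g \<partial>Q) \<le> ennreal (\<epsilon> n)"
    using fF by (auto simp: near_def)
  then obtain e where em [measurable]: "\<And>n. e n \<in> borel_measurable Q"
    and e: "\<And>n g. g \<in> G0 \<Longrightarrow> (\<integral>\<^sup>+ s. ennreal ((F n g s)\<^sup>2) \<partial>unit_leb) \<le> 1 + e n g"
    and e_int: "\<And>n. (\<integral>\<^sup>+ g. e n g \<partial>Q) \<le> ennreal (\<epsilon> n)"
    by metis
  have "(\<lambda>n. \<integral>\<^sup>+ g. e n g \<partial>Q) \<longlonglongrightarrow> 0"
  proof (rule tendsto_sandwich[OF _ _ tendsto_const])
    show "(\<lambda>n. ennreal (\<epsilon> n)) \<longlonglongrightarrow> 0" using tendsto_ennrealI[OF \<epsilon>0] by simp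
  qed (use e_int in auto)
  from tendsto_add[OF this k0]
  have "(\<lambda>n. \<integral>\<^sup>+ g. e n g + k n g \<partial>Q) \<longlonglongrightarrow> 0" by (simp add: nn_integral_add)
  \<comment> \<open>Along one sequence of indices the excess and the gradient error vanish together
    almost surely; the norm bound is then passed to the limit separately for each such
    \<open>g\<close>.\<close>
  then obtain r where "AE g in Q. (\<lambda>n. e (r n) g + k (r n) g) \<longlonglongrightarrow> 0"
    by (rule AE_tendsto_0_subsequence[rotated]) (auto intro: borel_measurable_add)
  then have "AE g in Q. (\<integral>\<^sup>+ s. ennreal ((G g s)\<^sup>2) \<partial>unit_leb) \<le> 1"
    using AE_space
  proof eventually_elim
    case (elim g)
    then have g: "g \<in> G0" by (simp add: space_Q)
    note [measurable] = Gm1[OF g] Z1_measurable(3)[OF Z g]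
    have bound: "(\<integral>\<^sup>+ s. ennreal ((G g s)\<^sup>2) \<partial>unit_leb) \<le> ennreal (1 + \<eta>) * (1 + (e (r n) g + k (r n) g)) + ennreal (1 + 1 / \<eta>) * (e (r n) g + k (r n) g)"
      if \<eta>: "\<eta> > 0" for \<eta> n
    proof -
      \<comment> \<open>Young's inequality. The main term suffers only the factor
        \<open>1 + \<eta>\<close>, and \<open>\<eta>\<close> is sent to 0 after \<open>n\<close> has
        gone to infinity.\<close>
      have pw: "a\<^sup>2 \<le> (1 + \<eta>) * b\<^sup>2 + (1 + 1 / \<eta>) * (b - a)\<^sup>2" for a b :: real
      proof -
        have "0 \<le> (\<eta> * b + (b - a))\<^sup>2 / \<eta>" using \<eta> by simp
        also have "\<dots> = \<eta> * b\<^sup>2 + 2 * b * (b - a) + (b - a)\<^sup>2 / \<eta>"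
          using \<eta> by (simp add: power2_eq_square field_simps)
        finally have 1: "0 \<le> \<eta> * b\<^sup>2 + 2 * b * (b - a) + (b - a)\<^sup>2 / \<eta>" .
        define c where "c = (b - a)\<^sup>2 / \<eta>"
        have 2: "(1 + 1 / \<eta>) * (b - a)\<^sup>2 = (b - a)\<^sup>2 + c" by (simp add: c_def distrib_right)
        from 1 show ?thesis unfolding 2 c_def[symmetric] by (simp add: power2_eq_square algebra_simps)
      qed
      have "(\<integral>\<^sup>+ s. ennreal ((G g s)\<^sup>2) \<partial>unit_leb)
        \<le> (\<integral>\<^sup>+ s. ennreal (1 + \<eta>) * ennreal ((F (r n) g s)\<^sup>2) + ennreal (1 + 1 / \<eta>) * ennreal ((F (r n) g s - G g s)\<^sup>2) \<partial>unit_leb)"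
      proof (rule nn_integral_mono)
        fix s
        have "ennreal ((G g s)\<^sup>2) \<le> ennreal ((1 + \<eta>) * (F (r n) g s)\<^sup>2 + (1 + 1 / \<eta>) * (F (r n) g s - G g s)\<^sup>2)"
          by (rule ennreal_leI[OF pw])
        also have "\<dots> = ennreal ((1 + \<eta>) * (F (r n) g s)\<^sup>2) + ennreal ((1 + 1 / \<eta>) * (F (r n) g s - G g s)\<^sup>2)"
          using \<eta> by (intro ennreal_plus) auto
        also have "\<dots> = ennreal (1 + \<eta>) * ennreal ((F (r n) g s)\<^sup>2) + ennreal (1 + 1 / \<eta>) * ennreal ((F (r n) g s - G g s)\<^sup>2)"
          using \<eta> by (intro arg_cong2[where f="(+)"] ennreal_mult) auto
        finally show "ennreal ((G g s)\<^sup>2) \<le> ennreal (1 + \<eta>) * ennreal ((F (r n) g s)\<^sup>2) + ennreal (1 + 1 / \<eta>) * ennreal ((F (r n) g s - G g s)\<^sup>2)" .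
      qed
      also have "\<dots> = ennreal (1 + \<eta>) * (\<integral>\<^sup>+ s. ennreal ((F (r n) g s)\<^sup>2) \<partial>unit_leb) + ennreal (1 + 1 / \<eta>) * k (r n) g"
        unfolding k_def by (subst nn_integral_add) (auto simp: nn_integral_cmult)
      also have "\<dots> \<le> ennreal (1 + \<eta>) * (1 + (e (r n) g + k (r n) g)) + ennreal (1 + 1 / \<eta>) * (e (r n) g + k (r n) g)"
        by (intro add_mono mult_left_mono order.trans[OF e[OF g]]) (auto intro: add_increasing2 add_increasing)
      finally show ?thesis .
    qed
    have lim: "(\<integral>\<^sup>+ s. ennreal ((G g s)\<^sup>2) \<partial>unit_leb) \<le> ennreal (1 + \<eta>)" if \<eta>: "\<eta> > 0" for \<eta>
    proof (rule LIMSEQ_le_const)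
      have "(\<lambda>n. ennreal (1 + \<eta>) * (1 + (e (r n) g + k (r n) g)) + ennreal (1 + 1 / \<eta>) * (e (r n) g + k (r n) g))
         \<longlonglongrightarrow> ennreal (1 + \<eta>) * (1 + 0) + ennreal (1 + 1 / \<eta>) * 0"
        by (intro tendsto_add tendsto_const ennreal_tendsto_cmult elim(1)) simp_all
      then show "(\<lambda>n. ennreal (1 + \<eta>) * (1 + (e (r n) g + k (r n) g)) + ennreal (1 + 1 / \<eta>) * (e (r n) g + k (r n) g))
         \<longlonglongrightarrow> ennreal (1 + \<eta>)" by simp
    qed (use bound[OF \<eta>] in blast)
    show ?case
    proof (rule ennreal_le_epsilon)
      fix \<eta> :: real assume "0 < \<eta>"
      then show "(\<integral>\<^sup>+ s. ennreal ((G g s)\<^sup>2) \<partial>unit_leb) \<le> 1 + ennreal \<eta>"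
        using lim[of \<eta>] by simp
    qed
  qed
  then show ?thesis using closure by blast
qed

end

section \<open>Lipschitz functions\<close>

definition pw_linear :: "nat \<Rightarrow> (nat \<Rightarrow> real) \<Rightarrow> real \<Rightarrow> real" where
  "pw_linear n q t = q 0 + (\<Sum>k<n. (q (Suc k) - q k) * max 0 (min 1 (real n * t - real k)))"

lemma pw_linear_continuous: "continuous_on UNIV (pw_linear n q)"
  unfolding pw_linear_def[abs_def] by (intro continuous_intros)

text \<open>Writing the interpolation as clamped ramps weighted by the node increments lets
  monotonicity be checked term by term.\<close>

lemma pw_linear_mono:
  assumes "\<And>k. k < n \<Longrightarrow> q k \<le> q (Suc k)" "s \<le> t"
  shows "pw_linear n q s \<le> pw_linear n q t"
  unfolding pw_linear_def
proof (intro add_left_mono sum_mono mult_left_mono)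
  have "real n * s \<le> real n * t" using assms(2) by (intro mult_left_mono) auto
  then show "max 0 (min 1 (real n * s - real k)) \<le> max 0 (min 1 (real n * t - real k))" for k by auto
qed (use assms(1) in auto)

lemma pw_linear_lower:
  assumes q: "\<And>k. k < n \<Longrightarrow> q k \<le> q (Suc k)" and k: "k \<le> n" "real k \<le> real n * t"
  shows "q k \<le> pw_linear n q t"
proof -
  have "q k = q 0 + (\<Sum>j<k. q (Suc j) - q j)" by (simp add: sum_lessThan_telescope)
  also have "(\<Sum>j<k. q (Suc j) - q j) \<le> (\<Sum>j<k. (q (Suc j) - q j) * max 0 (min 1 (real n * t - real j)))"
  proof (rule sum_mono)
    fix j assume "j \<in> {..<k}"
    then have "max 0 (min 1 (real n * t - real j)) = 1" using k by auto
    then show "q (Suc j) - q j \<le> (q (Suc j) - q j) * max 0 (min 1 (real n * t - real j))" by simp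
  qed
  also have "\<dots> \<le> (\<Sum>j<n. (q (Suc j) - q j) * max 0 (min 1 (real n * t - real j)))"
    by (rule sum_mono2) (use k q in \<open>auto intro!: mult_nonneg_nonneg\<close>)
  finally show ?thesis by (simp add: pw_linear_def)
qed

lemma pw_linear_upper:
  assumes q: "\<And>k. k < n \<Longrightarrow> q k \<le> q (Suc k)" and k: "k \<le> n" "real n * t \<le> real k"
  shows "pw_linear n q t \<le> q k"
proof -
  have "(\<Sum>j<n. (q (Suc j) - q j) * max 0 (min 1 (real n * t - real j))) = (\<Sum>j<k. (q (Suc j) - q j) * max 0 (min 1 (real n * t - real j)))"
    by (rule sum.mono_neutral_right) (use k in auto)
  also have "\<dots> \<le> (\<Sum>j<k. q (Suc j) - q j)"
  proof (rule sum_mono)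
    fix j assume "j \<in> {..<k}"
    then have "0 \<le> q (Suc j) - q j" using q[of j] k by auto
    then show "(q (Suc j) - q j) * max 0 (min 1 (real n * t - real j)) \<le> q (Suc j) - q j"
      by (intro mult_left_le) auto
  qed
  also have "q 0 + (\<Sum>j<k. q (Suc j) - q j) = q k" by (simp add: sum_lessThan_telescope)
  finally show ?thesis by (simp add: pw_linear_def)
qed

text \<open>Node values are natural numbers from \<open>xs\<close> divided by \<open>n\<close>, so
  there are only countably many such functions. The prescribed value at 1 may create a jump
  there.\<close>

definition pw_G0 :: "nat \<Rightarrow> nat list \<Rightarrow> real \<Rightarrow> real" where
  "pw_G0 n xs t = (if t \<in> {0..<1} then pw_linear n (\<lambda>k. real (xs ! k) / real n) t else if t = 1 then 1 else 0)"

lemma pw_G0_in_G0: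
  assumes q: "\<And>k. k < n \<Longrightarrow> xs ! k \<le> xs ! Suc k" "xs ! n \<le> n" and n: "n > 0"
  shows "pw_G0 n xs \<in> G0"
proof -
  let ?q = "\<lambda>k. real (xs ! k) / real n"
  have q': "?q k \<le> ?q (Suc k)" if "k < n" for k using q(1)[OF that] by (simp add: divide_right_mono)
  have range: "0 \<le> pw_linear n ?q t" "pw_linear n ?q t \<le> 1" if "t \<in> {0..<1}" for t
  proof -
    have "0 \<le> ?q 0" by simp
    also have "\<dots> \<le> pw_linear n ?q t" by (rule pw_linear_lower[where q="?q", OF q']) (use that in auto)
    finally show "0 \<le> pw_linear n ?q t" .
    have "pw_linear n ?q t \<le> ?q n"
      by (rule pw_linear_upper[where q="?q", OF q']) (use that in \<open>auto simp: mult_left_le\<close>)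
    also have "\<dots> \<le> 1" using q(2) n by simp
    finally show "pw_linear n ?q t \<le> 1" .
  qed
  have "continuous (at_right t) (pw_G0 n xs)" if t: "t \<in> {0..<1}" for t
  proof -
    have "(pw_linear n ?q \<longlongrightarrow> pw_linear n ?q t) (at t)"
      using pw_linear_continuous[of n ?q] by (simp add: continuous_on_eq_continuous_at isCont_def)
    then have "(pw_linear n ?q \<longlongrightarrow> pw_linear n ?q t) (at_right t)"
      by (rule tendsto_mono[rotated]) (simp add: at_le)
    moreover have "\<forall>\<^sub>F r in at_right t. pw_linear n ?q r = pw_G0 n xs r"
      using t by (auto simp: eventually_at_right pw_G0_def intro!: exI[of _ 1])
    ultimately have "(pw_G0 n xs \<longlongrightarrow> pw_linear n ?q t) (at_right t)" using tendsto_cong by blast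
    then show ?thesis using t by (simp add: continuous_within pw_G0_def)
  qed
  then show ?thesis
    unfolding G0_def using range pw_linear_mono[of n ?q] q' by (auto simp: mono_on_def pw_G0_def)
qed

lemma pw_G0_approx:
  assumes g: "g \<in> G0"
  obtains xs :: "nat \<Rightarrow> nat list" where "\<And>n. pw_G0 (Suc n) (xs n) \<in> G0"
    "\<And>t. t \<in> {0..<1} \<Longrightarrow> (\<lambda>n. pw_G0 (Suc n) (xs n) t) \<longlonglongrightarrow> g t"
proof -
  \<comment> \<open>Node \<open>k\<close> receives the value of \<open>g\<close> one grid step
    further right, rounded down. The two nodes around \<open>t\<close> then sample \<open>g\<close>
    only at times not left of \<open>t\<close>, where right continuity gives control; sampling on
    the left could miss a jump at \<open>t\<close>.\<close>
  define a where "a n k = nat \<lfloor>real (Suc n) * g (min 1 (real (Suc k) / real (Suc n)))\<rfloor>" for n k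
  define xs where "xs n = map (a n) [0..<Suc (Suc n)]" for n
  have nth: "xs n ! k = a n k" if "k \<le> Suc n" for n k
    unfolding xs_def using that by (subst nth_map) (auto simp del: upt_Suc)
  have gr: "0 \<le> g t" "g t \<le> 1" for t using G0_range[OF g, of t] by auto
  have a_mono: "a n k \<le> a n (Suc k)" for n k
    unfolding a_def
  proof (intro nat_mono floor_mono mult_left_mono G0_mono[OF g])
    have "real (Suc k) / real (Suc n) \<le> real (Suc (Suc k)) / real (Suc n)" by (intro divide_right_mono) auto
    then show "min 1 (real (Suc k) / real (Suc n)) \<le> min 1 (real (Suc (Suc k)) / real (Suc n))" by auto
  qed auto
  have a_le: "real (a n k) \<le> real (Suc n) * g (min 1 (real (Suc k) / real (Suc n)))"
    and a_ge: "real (Suc n) * g (min 1 (real (Suc k) / real (Suc n))) - 1 \<le> real (a n k)" for n k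
  proof -
    have "0 \<le> real (Suc n) * g (min 1 (real (Suc k) / real (Suc n)))" using gr by simp
    then show "real (a n k) \<le> real (Suc n) * g (min 1 (real (Suc k) / real (Suc n)))"
      "real (Suc n) * g (min 1 (real (Suc k) / real (Suc n))) - 1 \<le> real (a n k)"
      unfolding a_def by linarith+
  qed
  have in_G0: "pw_G0 (Suc n) (xs n) \<in> G0" for n
  proof (rule pw_G0_in_G0)
    have "real (a n (Suc n)) \<le> real (Suc n) * 1"
      by (rule order.trans[OF a_le]) (intro mult_left_mono gr, simp)
    then show "xs n ! Suc n \<le> Suc n" by (simp add: nth)
  qed (use a_mono in \<open>auto simp: nth\<close>)
  have conv: "(\<lambda>n. pw_G0 (Suc n) (xs n) t) \<longlonglongrightarrow> g t" if t: "t \<in> {0..<1}" for t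
  proof -
    define k where "k n = nat \<lfloor>real (Suc n) * t\<rfloor>" for n
    have k: "real (k n) \<le> real (Suc n) * t" "real (Suc n) * t \<le> real (Suc (k n))" for n
    proof -
      have "0 \<le> real (Suc n) * t" using t by simp
      then show "real (k n) \<le> real (Suc n) * t" "real (Suc n) * t \<le> real (Suc (k n))"
        unfolding k_def by linarith+
    qed
    have kn: "Suc (k n) \<le> Suc n" for n
    proof -
      have "real (Suc n) * t < real (Suc n) * 1" using t by (intro mult_strict_left_mono) auto
      with k(1)[of n] have "real (k n) < real (Suc n) * 1" by (rule le_less_trans)
      then show ?thesis by simp
    qed
    define lo where "lo n = g t - 1 / real (Suc n)" for n
    define hi where "hi n = g (min 1 (t + 2 / real (Suc n)))" for n
    have q_mono: "real (xs n ! j) / real (Suc n) \<le> real (xs n ! Suc j) / real (Suc n)" if "j < Suc n" for j n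
      using a_mono[of n j] that by (auto simp: nth intro!: divide_right_mono)
    have lower: "lo n \<le> pw_G0 (Suc n) (xs n) t" for n
    proof -
      have "t \<le> real (Suc (k n)) / real (Suc n)" using k(2)[of n] by (simp add: pos_le_divide_eq mult.commute)
      then have "g t \<le> g (min 1 (real (Suc (k n)) / real (Suc n)))" using t by (intro G0_mono[OF g]) auto
      then have "real (Suc n) * g t - 1 \<le> real (Suc n) * g (min 1 (real (Suc (k n)) / real (Suc n))) - 1"
        by (intro diff_right_mono mult_left_mono) auto
      also have "\<dots> \<le> real (a n (k n))" by (rule a_ge)
      finally have "(real (Suc n) * g t - 1) / real (Suc n) \<le> real (a n (k n)) / real (Suc n)"
        by (rule divide_right_mono) simp
      then have "lo n \<le> real (xs n ! k n) / real (Suc n)"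
        using kn[of n] by (simp add: lo_def nth diff_divide_distrib del: of_nat_Suc)
      also have "\<dots> \<le> pw_linear (Suc n) (\<lambda>j. real (xs n ! j) / real (Suc n)) t"
        by (rule pw_linear_lower[where q="\<lambda>j. real (xs n ! j) / real (Suc n)", OF q_mono]) (use kn[of n] k(1)[of n] in auto)
      finally show ?thesis using t by (simp add: pw_G0_def)
    qed
    have upper: "pw_G0 (Suc n) (xs n) t \<le> hi n" for n
    proof -
      have "pw_G0 (Suc n) (xs n) t = pw_linear (Suc n) (\<lambda>j. real (xs n ! j) / real (Suc n)) t"
        using t by (simp add: pw_G0_def)
      also have "\<dots> \<le> real (xs n ! Suc (k n)) / real (Suc n)"
        by (rule pw_linear_upper[where q="\<lambda>j. real (xs n ! j) / real (Suc n)", OF q_mono kn k(2)])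
      also have "\<dots> = real (a n (Suc (k n))) / real (Suc n)" using kn[of n] by (simp add: nth)
      also have "\<dots> \<le> (real (Suc n) * g (min 1 (real (Suc (Suc (k n))) / real (Suc n)))) / real (Suc n)"
        by (intro divide_right_mono a_le) simp
      also have "\<dots> = g (min 1 (real (Suc (Suc (k n))) / real (Suc n)))" by simp
      also have "\<dots> \<le> hi n"
        unfolding hi_def
      proof (intro G0_mono[OF g])
        have "real (Suc (Suc (k n))) / real (Suc n) = real (k n) / real (Suc n) + 2 / real (Suc n)"
          by (simp add: add_divide_distrib[symmetric] del: of_nat_Suc)
        also have "real (k n) / real (Suc n) \<le> t" using k(1)[of n] by (simp add: pos_divide_le_eq mult.commute)
        finally show "min 1 (real (Suc (Suc (k n))) / real (Suc n)) \<le> min 1 (t + 2 / real (Suc n))" by auto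
      qed auto
      finally show ?thesis .
    qed
    have lo: "lo \<longlonglongrightarrow> g t"
    proof -
      have "lo \<longlonglongrightarrow> g t - 0"
        unfolding lo_def by (intro tendsto_diff tendsto_const LIMSEQ_Suc[OF lim_1_over_n])
      then show ?thesis by simp
    qed
    have hi: "hi \<longlonglongrightarrow> g t"
      unfolding hi_def
    proof (rule filterlim_compose[OF G0_right_cont[OF g t]])
      have 1: "(\<lambda>n. t + 2 * (1 / real (Suc n))) \<longlonglongrightarrow> t + 2 * 0"
        by (intro tendsto_add tendsto_mult tendsto_const LIMSEQ_Suc[OF lim_1_over_n])
      have "(\<lambda>n. min 1 (t + 2 * (1 / real (Suc n)))) \<longlonglongrightarrow> min 1 (t + 2 * 0)"
        by (intro tendsto_min tendsto_const 1)
      moreover define r where "r n = min 1 (t + 2 / real (Suc n))" for n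
      ultimately have "r \<longlonglongrightarrow> t" using t by (simp add: r_def[abs_def] min_absorb2 del: of_nat_Suc)
      moreover have "t < r n" for n unfolding r_def using t by (simp del: of_nat_Suc)
      ultimately have "filterlim r (at_right t) sequentially"
        by (auto simp: filterlim_at less_imp_neq[symmetric] intro!: always_eventually)
      then show "filterlim (\<lambda>n. min 1 (t + 2 / real (Suc n))) (at_right t) sequentially"
        by (simp add: r_def[abs_def])
    qed
    show ?thesis
      by (rule tendsto_sandwich[OF _ _ lo hi]) (use lower upper in auto)
  qed
  show ?thesis by (rule that[OF in_G0 conv])
qed

lemma Cauchy_Schwarz_unit_leb:
  fixes a b :: "real \<Rightarrow> real"
  assumes a: "a \<in> borel_measurable borel" "\<And>s. \<bar>a s\<bar> \<le> A" and b: "b \<in> borel_measurable borel" "\<And>s. \<bar>b s\<bar> \<le> B"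
  shows "(\<integral>s. a s * b s \<partial>unit_leb)\<^sup>2 \<le> (\<integral>s. (a s)\<^sup>2 \<partial>unit_leb) * (\<integral>s. (b s)\<^sup>2 \<partial>unit_leb)"
proof -
  note [measurable] = a(1) b(1)
  have iab: "integrable unit_leb (\<lambda>s. a s * b s)"
  proof (rule integrable_unit_leb_bounded[of _ "A * B"])
    show "\<bar>a s * b s\<bar> \<le> A * B" for s
      unfolding abs_mult by (rule mult_mono'[OF a(2) b(2)]) auto
  qed measurable
  have iaa: "integrable unit_leb (\<lambda>s. (a s)\<^sup>2)"
  proof (rule integrable_unit_leb_bounded[of _ "A * A"])
    show "\<bar>(a s)\<^sup>2\<bar> \<le> A * A" for s
      unfolding power2_eq_square abs_mult by (rule mult_mono'[OF a(2) a(2)]) auto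
  qed measurable
  have ibb: "integrable unit_leb (\<lambda>s. (b s)\<^sup>2)"
  proof (rule integrable_unit_leb_bounded[of _ "B * B"])
    show "\<bar>(b s)\<^sup>2\<bar> \<le> B * B" for s
      unfolding power2_eq_square abs_mult by (rule mult_mono'[OF b(2) b(2)]) auto
  qed measurable
  define I where "I = (\<integral>s. a s * b s \<partial>unit_leb)"
  define X where "X = (\<integral>s. (a s)\<^sup>2 \<partial>unit_leb)"
  define Y where "Y = (\<integral>s. (b s)\<^sup>2 \<partial>unit_leb)"
  have quad: "0 \<le> X - 2 * l * I + l\<^sup>2 * Y" for l
  proof -
    have "0 \<le> (\<integral>s. (a s - l * b s)\<^sup>2 \<partial>unit_leb)" by (rule integral_nonneg_AE) simp
    also have "\<dots> = (\<integral>s. (a s)\<^sup>2 - 2 * l * (a s * b s) + l\<^sup>2 * (b s)\<^sup>2 \<partial>unit_leb)"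
      by (intro Bochner_Integration.integral_cong) (auto simp: power2_eq_square algebra_simps)
    also have "\<dots> = X - 2 * l * I + l\<^sup>2 * Y"
      unfolding X_def I_def Y_def using iab iaa ibb by simp
    finally show ?thesis .
  qed
  have Y0: "0 \<le> Y" unfolding Y_def by (rule integral_nonneg_AE) simp
  show ?thesis
    unfolding I_def[symmetric] X_def[symmetric] Y_def[symmetric]
  proof (cases "Y = 0")
    case True
    have "I = 0"
    proof (rule ccontr)
      assume I: "I \<noteq> 0"
      \<comment> \<open>This value of the parameter makes the quadratic equal to -1.\<close>
      have "0 \<le> X - 2 * ((X + 1) / (2 * I)) * I" using quad[of "(X + 1) / (2 * I)"] True by simp
      then show False using I by (simp add: field_simps)
    qed
    then show "I\<^sup>2 \<le> X * Y" using True by simp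
  next
    case False
    then have Y: "0 < Y" using Y0 by simp
    have "0 \<le> (X - 2 * (I / Y) * I + (I / Y)\<^sup>2 * Y) * Y" using quad[of "I / Y"] Y by simp
    also have "\<dots> = X * Y - I\<^sup>2" using Y by (simp add: power2_eq_square field_simps)
    finally show "I\<^sup>2 \<le> X * Y" by simp
  qed
qed

lemma Min_perturb:
  fixes a b :: "nat \<Rightarrow> real"
  assumes "\<And>j. j \<le> n \<Longrightarrow> \<bar>a j - b j\<bar> \<le> D"
  shows "\<bar>Min (a ` {..n}) - Min (b ` {..n})\<bar> \<le> D"
  using assms
proof (induction n)
  case (Suc n)
  have "\<bar>Min (a ` {..n}) - Min (b ` {..n})\<bar> \<le> D" "\<bar>a (Suc n) - b (Suc n)\<bar> \<le> D"
    using Suc by auto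
  moreover have "Min (c ` {..Suc n}) = min (c (Suc n)) (Min (c ` {..n}))" for c :: "nat \<Rightarrow> real"
    unfolding atMost_Suc image_insert by (rule Min_insert) auto
  moreover have "\<bar>min x x' - min y y'\<bar> \<le> D" if "\<bar>x' - y'\<bar> \<le> D" "\<bar>x - y\<bar> \<le> D" for x y x' y' :: real
    using that by (auto simp: min_def)
  ultimately show ?case by simp
qed simp

lemma Max_perturb:
  fixes a b :: "nat \<Rightarrow> real"
  assumes "\<And>j. j \<le> n \<Longrightarrow> \<bar>a j - b j\<bar> \<le> D"
  shows "\<bar>Max (a ` {..n}) - Max (b ` {..n})\<bar> \<le> D"
  using assms
proof (induction n)
  case (Suc n)
  have "\<bar>Max (a ` {..n}) - Max (b ` {..n})\<bar> \<le> D" "\<bar>a (Suc n) - b (Suc n)\<bar> \<le> D"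
    using Suc by auto
  moreover have "Max (c ` {..Suc n}) = max (c (Suc n)) (Max (c ` {..n}))" for c :: "nat \<Rightarrow> real"
    unfolding atMost_Suc image_insert by (rule Max_insert) auto
  moreover have "\<bar>max x x' - max y y'\<bar> \<le> D" if "\<bar>x' - y'\<bar> \<le> D" "\<bar>x - y\<bar> \<le> D" for x y x' y' :: real
    using that by (auto simp: max_def)
  ultimately show ?case by simp
qed simp

section \<open>Lattice interpolation of Lipschitz functions\<close>

context entropic
begin

lemma grad_approx_Min:
  fixes n :: nat
  assumes "\<And>j. j \<le> n \<Longrightarrow> grad_approx (F j)"
  shows "grad_approx (\<lambda>g. Min ((\<lambda>j. F j g) ` {..n}))"
  using assms
proof (induction n)
  case (Suc n)
  have "grad_approx (\<lambda>g. min (F (Suc n) g) (Min ((\<lambda>j. F j g) ` {..n})))"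
    using Suc by (intro grad_approx_min) auto
  moreover have "Min ((\<lambda>j. F j g) ` {..Suc n}) = min (F (Suc n) g) (Min ((\<lambda>j. F j g) ` {..n}))" for g
    unfolding atMost_Suc image_insert by (rule Min_insert) auto
  ultimately show ?case by simp
qed simp

lemma grad_approx_Max:
  fixes n :: nat
  assumes "\<And>j. j \<le> n \<Longrightarrow> grad_approx (F j)"
  shows "grad_approx (\<lambda>g. Max ((\<lambda>j. F j g) ` {..n}))"
  using assms
proof (induction n)
  case (Suc n)
  have "grad_approx (\<lambda>g. max (F (Suc n) g) (Max ((\<lambda>j. F j g) ` {..n})))"
    using Suc by (intro grad_approx_max) auto
  moreover have "Max ((\<lambda>j. F j g) ` {..Suc n}) = max (F (Suc n) g) (Max ((\<lambda>j. F j g) ` {..n}))" for g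
    unfolding atMost_Suc image_insert by (rule Max_insert) auto
  ultimately show ?case by simp
qed simp

lemma dL2_unit_leb:
  assumes "g \<in> G0" "h \<in> G0"
  shows "dL2 g h = sqrt (\<integral>s. (g s - h s)\<^sup>2 \<partial>unit_leb)"
proof -
  note [measurable] = G0_measurable[OF assms(1)] G0_measurable[OF assms(2)]
  show ?thesis unfolding dL2_def by (subst LINT_unit_leb) simp_all
qed

lemma G0_diff_bound: "g \<in> G0 \<Longrightarrow> h \<in> G0 \<Longrightarrow> \<bar>g s - h s\<bar> \<le> 1"
  using G0_range[of g s] G0_range[of h s] by auto

lemma dL2_le_1:
  assumes "g \<in> G0" "h \<in> G0"
  shows "dL2 g h \<le> 1"
proof -
  note [measurable] = G0_measurable[OF assms(1)] G0_measurable[OF assms(2)]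
  have b: "(g s - h s)\<^sup>2 \<le> 1" for s using G0_diff_bound[OF assms, of s] by (simp add: abs_square_le_1)
  have "(\<integral>s. (g s - h s)\<^sup>2 \<partial>unit_leb) \<le> (\<integral>s. 1 \<partial>unit_leb)"
    by (rule integral_mono[OF integrable_unit_leb_bounded[of _ 1]]) (use b in auto)
  then show ?thesis unfolding dL2_unit_leb[OF assms] by (simp add: measure_unit_leb_UNIV)
qed

text \<open>Each member comes with a function \<open>hc i\<close>, continuous on the whole line,
  that agrees with it on [0,1[. The members may jump at 1, whereas \<open>grad_approx_linear\<close>
  treats linear functionals given by a continuous \<open>v\<close>.\<close>

lemma dense_sequence:
  "\<exists>(h :: nat \<Rightarrow> real \<Rightarrow> real) hc. (\<forall>i. h i \<in> G0) \<and> (\<forall>i. continuous_on UNIV (hc i)) \<and>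
    (\<forall>i. \<forall>s\<in>{0..<1}. h i s = hc i s) \<and> (\<forall>g\<in>G0. \<forall>e>0. \<exists>i. dL2 g (h i) < e)"
proof -
  define S where "S = {p :: nat \<times> nat list. pw_G0 (fst p) (snd p) \<in> G0}"
  have near: "\<exists>p\<in>S. dL2 g (pw_G0 (fst p) (snd p)) < e" if g: "g \<in> G0" and e: "e > 0" for g e
  proof -
    obtain xs where xs: "\<And>n. pw_G0 (Suc n) (xs n) \<in> G0"
      "\<And>t. t \<in> {0..<1} \<Longrightarrow> (\<lambda>n. pw_G0 (Suc n) (xs n) t) \<longlonglongrightarrow> g t"
      by (rule pw_G0_approx[OF g]) blast
    define p where "p n = pw_G0 (Suc n) (xs n)" for n
    have p: "p n \<in> G0" for n using xs(1) by (simp add: p_def)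
    note [measurable] = G0_measurable[OF g] G0_measurable[OF p]
    have "(\<lambda>n. \<integral>s. (g s - p n s)\<^sup>2 \<partial>unit_leb) \<longlonglongrightarrow> (\<integral>s. (g s - g s)\<^sup>2 \<partial>unit_leb)"
    proof (rule integral_dominated_convergence[where w="\<lambda>_. 1"])
      show "AE s in unit_leb. (\<lambda>n. (g s - p n s)\<^sup>2) \<longlonglongrightarrow> (g s - g s)\<^sup>2"
        by (rule AE_unit_leb_I, intro tendsto_power tendsto_diff tendsto_const, unfold p_def, rule xs(2)) auto
      show "AE s in unit_leb. norm ((g s - p n s)\<^sup>2) \<le> 1" for n
        using G0_diff_bound[OF g p] by (intro AE_I2) (simp add: abs_square_le_1)
    qed auto
    then have "(\<lambda>n. sqrt (\<integral>s. (g s - p n s)\<^sup>2 \<partial>unit_leb)) \<longlonglongrightarrow> sqrt 0"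
      by (intro tendsto_real_sqrt) simp
    then have "(\<lambda>n. dL2 g (p n)) \<longlonglongrightarrow> 0" by (simp add: dL2_unit_leb[OF g p])
    then have "\<forall>\<^sub>F n in sequentially. dL2 g (p n) < e" using e by (intro order_tendstoD(2)) auto
    then obtain n where "dL2 g (p n) < e" by (auto simp: eventually_sequentially)
    then show ?thesis using xs(1) by (intro bexI[of _ "(Suc n, xs n)"]) (auto simp: S_def p_def)
  qed
  have "\<exists>g. g \<in> G0"
  proof -
    have "pw_G0 1 [0, 0] \<in> G0" by (rule pw_G0_in_G0) auto
    then show ?thesis by blast
  qed
  then have ne: "S \<noteq> {}" using near zero_less_one by blast
  define P where "P = from_nat_into S"
  have PS: "P i \<in> S" for i unfolding P_def by (rule from_nat_into[OF ne])
  have surj: "\<exists>i. P i = p" if "p \<in> S" for p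
    unfolding P_def using from_nat_into_surj[OF _ that] by auto
  define h where "h i = pw_G0 (fst (P i)) (snd (P i))" for i
  define hc where "hc i = pw_linear (fst (P i)) (\<lambda>k. real (snd (P i) ! k) / real (fst (P i)))" for i
  have "\<forall>i. h i \<in> G0" using PS by (simp add: S_def h_def)
  moreover have "\<forall>i. continuous_on UNIV (hc i)" by (simp add: hc_def pw_linear_continuous)
  moreover have "\<forall>i. \<forall>s\<in>{0..<1}. h i s = hc i s" by (simp add: h_def hc_def pw_G0_def)
  moreover have "\<forall>g\<in>G0. \<forall>e>0. \<exists>i. dL2 g (h i) < e" using near surj unfolding h_def by metis
  ultimately show ?thesis by (intro exI conjI)
qed

text \<open>The slope is \<open>h2 - h1\<close> times \<open>(b - a) / N\<close>, where
  \<open>N\<close> is the squared distance of \<open>h1\<close> and \<open>h2\<close>. For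
  \<open>N > 0\<close> its norm is the absolute difference of \<open>a\<close> and \<open>b\<close>
  divided by that distance, hence at most 1.\<close>

lemma affine_interpolation:
  assumes h1: "h1 \<in> G0" "continuous_on UNIV hc1" "\<And>s. s \<in> {0..<1} \<Longrightarrow> h1 s = hc1 s"
    and h2: "h2 \<in> G0" "continuous_on UNIV hc2" "\<And>s. s \<in> {0..<1} \<Longrightarrow> h2 s = hc2 s"
    and ab: "\<bar>a - b\<bar> \<le> dL2 h1 h2"
  shows "\<exists>l. grad_approx l \<and> (\<forall>g\<in>G0. \<forall>g'\<in>G0. \<bar>l g - l g'\<bar> \<le> dL2 g g') \<and> l h1 = a \<and> l h2 = b"
proof -
  note [measurable] = G0_measurable[OF h1(1)] G0_measurable[OF h2(1)]
  define N where "N = (\<integral>s. (h1 s - h2 s)\<^sup>2 \<partial>unit_leb)"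
  have N0: "0 \<le> N" unfolding N_def by (rule integral_nonneg_AE) simp
  have abN: "(b - a)\<^sup>2 \<le> N"
  proof -
    have "\<bar>a - b\<bar> \<le> sqrt N" using ab dL2_unit_leb[OF h1(1) h2(1)] by (simp add: N_def)
    from power_mono[OF this abs_ge_zero, of 2] show ?thesis using N0 by (simp add: power2_commute)
  qed
  \<comment> \<open>If \<open>N = 0\<close> then \<open>a = b\<close>, and division by zero yields
    \<open>\<kappa> = 0\<close>: the interpolant is constant.\<close>
  define \<kappa> where "\<kappa> = (b - a) / N"
  define w where "w s = \<kappa> * (h2 s - h1 s)" for s
  \<comment> \<open>Continuous representative of \<open>w\<close>, equal to it on [0,1[, to which
    the approximation of linear functionals applies.\<close>
  define v where "v s = \<kappa> * (clampf hc2 s - clampf hc1 s)" for s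
  have \<kappa>N: "\<kappa> * N = b - a" using abN N0 by (cases "N = 0") (auto simp: \<kappa>_def)
  have wm [measurable]: "w \<in> borel_measurable borel" unfolding w_def by measurable
  have wb: "\<bar>w s\<bar> \<le> \<bar>\<kappa>\<bar>" for s
    unfolding w_def abs_mult using G0_diff_bound[OF h2(1) h1(1), of s] by (intro mult_left_le) auto
  have cc: "continuous_on UNIV (clampf hc1)" "continuous_on UNIV (clampf hc2)"
    using h1(2) h2(2) by (auto intro!: continuous_on_clampf elim: continuous_on_subset)
  have vc: "continuous_on UNIV v" unfolding v_def by (intro continuous_intros cc)
  have vm [measurable]: "v \<in> borel_measurable borel" by (rule borel_measurable_continuous_onI[OF vc])
  obtain B1 where B1: "\<And>x. \<bar>clampf hc1 x\<bar> \<le> B1"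
    using clampf_bounded[OF continuous_on_subset[OF h1(2)]] by blast
  obtain B2 where B2: "\<And>x. \<bar>clampf hc2 x\<bar> \<le> B2"
    using clampf_bounded[OF continuous_on_subset[OF h2(2)]] by blast
  have vb: "\<bar>v s\<bar> \<le> \<bar>\<kappa>\<bar> * (B2 + B1)" for s
    unfolding v_def abs_mult by (intro mult_left_mono order.trans[OF abs_triangle_ineq4] add_mono B1 B2) auto
  have vw: "AE s in unit_leb. v s = w s"
    by (rule AE_unit_leb_I) (simp add: v_def w_def h1(3) h2(3))
  have w2: "(\<integral>s. (w s)\<^sup>2 \<partial>unit_leb) \<le> 1"
  proof -
    have "(\<integral>s. (w s)\<^sup>2 \<partial>unit_leb) = (\<integral>s. \<kappa>\<^sup>2 * (h1 s - h2 s)\<^sup>2 \<partial>unit_leb)"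
      by (intro Bochner_Integration.integral_cong) (auto simp: w_def power_mult_distrib power2_commute)
    also have "\<dots> = \<kappa>\<^sup>2 * N" by (simp add: N_def)
    also have "\<dots> \<le> 1"
    proof (cases "N = 0")
      case False
      then have "N > 0" using N0 by simp
      then have "\<kappa>\<^sup>2 * N = (b - a)\<^sup>2 / N" by (simp add: \<kappa>_def power2_eq_square)
      then show ?thesis using abN \<open>N > 0\<close> by simp
    qed simp
    finally show ?thesis .
  qed
  have int: "integrable unit_leb (\<lambda>s. g s * w s)" if "g \<in> G0" for g
  proof (rule integrable_unit_leb_bounded[of _ "1 * \<bar>\<kappa>\<bar>"])
    show "(\<lambda>s. g s * w s) \<in> borel_measurable borel" using G0_measurable[OF that] by measurable
    show "\<bar>g s * w s\<bar> \<le> 1 * \<bar>\<kappa>\<bar>" for s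
      unfolding abs_mult by (intro mult_mono wb) (use G0_range[OF that, of s] in auto)
  qed
  define c where "c = a - (\<integral>s. h1 s * w s \<partial>unit_leb)"
  define l where "l g = c + (\<integral>s. g s * w s \<partial>unit_leb)" for g
  have "grad_approx (\<lambda>g. c + (\<integral>s. g s * v s \<partial>unit_leb))"
  proof (rule grad_approx_linear[OF vc vb])
    have "(\<integral>\<^sup>+ s. ennreal ((v s)\<^sup>2) \<partial>unit_leb) = (\<integral>\<^sup>+ s. ennreal ((w s)\<^sup>2) \<partial>unit_leb)"
      by (rule nn_integral_cong_AE) (use vw in eventually_elim, simp)
    also have "\<dots> = ennreal (\<integral>s. (w s)\<^sup>2 \<partial>unit_leb)"
    proof (rule nn_integral_eq_integral)
      show "integrable unit_leb (\<lambda>s. (w s)\<^sup>2)"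
      proof (rule integrable_unit_leb_bounded[of _ "\<bar>\<kappa>\<bar>\<^sup>2"])
        show "\<bar>(w s)\<^sup>2\<bar> \<le> \<bar>\<kappa>\<bar>\<^sup>2" for s using power_mono[OF wb abs_ge_zero, of s 2] by simp
      qed measurable
    qed simp
    also have "\<dots> \<le> ennreal 1" by (rule ennreal_leI[OF w2])
    finally show "(\<integral>\<^sup>+ s. ennreal ((v s)\<^sup>2) \<partial>unit_leb) \<le> 1" by simp
  qed
  moreover have "(\<integral>s. g s * v s \<partial>unit_leb) = (\<integral>s. g s * w s \<partial>unit_leb)" if "g \<in> space Q" for g
  proof (rule integral_cong_AE)
    note [measurable] = G0_measurable[of g]
    show "(\<lambda>s. g s * v s) \<in> borel_measurable unit_leb" "(\<lambda>s. g s * w s) \<in> borel_measurable unit_leb"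
      using that by (auto simp: space_Q)
    show "AE s in unit_leb. g s * v s = g s * w s" using vw by eventually_elim simp
  qed
  ultimately have "grad_approx l"
    unfolding grad_approx_def l_def
    by (simp add: measurable_cong[of Q "\<lambda>g. c + (\<integral>s. g s * v s \<partial>unit_leb)" "\<lambda>g. c + (\<integral>s. g s * w s \<partial>unit_leb)"]
        cong: nn_integral_cong_simp)
  moreover have "\<bar>l g - l g'\<bar> \<le> dL2 g g'" if g: "g \<in> G0" "g' \<in> G0" for g g'
  proof -
    note [measurable] = G0_measurable[OF g(1)] G0_measurable[OF g(2)]
    have "l g - l g' = (\<integral>s. (g s - g' s) * w s \<partial>unit_leb)"
      using int[OF g(1)] int[OF g(2)] by (simp add: l_def left_diff_distrib)
    then have "(l g - l g')\<^sup>2 \<le> (\<integral>s. (g s - g' s)\<^sup>2 \<partial>unit_leb) * (\<integral>s. (w s)\<^sup>2 \<partial>unit_leb)"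
      using Cauchy_Schwarz_unit_leb[OF _ G0_diff_bound[OF g] wm wb] by simp
    also have "\<dots> \<le> (\<integral>s. (g s - g' s)\<^sup>2 \<partial>unit_leb) * 1"
      by (intro mult_left_mono w2 integral_nonneg_AE) simp
    finally have "(l g - l g')\<^sup>2 \<le> (\<integral>s. (g s - g' s)\<^sup>2 \<partial>unit_leb)" by simp
    from real_sqrt_le_mono[OF this] show ?thesis by (simp add: dL2_unit_leb[OF g])
  qed
  moreover have "l h1 = a" by (simp add: l_def c_def)
  moreover have "l h2 = b"
  proof -
    have "l h2 - l h1 = (\<integral>s. h2 s * w s - h1 s * w s \<partial>unit_leb)"
      using int[OF h1(1)] int[OF h2(1)] by (simp add: l_def)
    also have "\<dots> = (\<integral>s. \<kappa> * (h1 s - h2 s)\<^sup>2 \<partial>unit_leb)"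
      by (intro Bochner_Integration.integral_cong) (auto simp: w_def power2_eq_square algebra_simps)
    also have "\<dots> = \<kappa> * N" by (simp add: N_def)
    finally show ?thesis using \<kappa>N \<open>l h1 = a\<close> by simp
  qed
  ultimately show ?thesis by blast
qed

text \<open>At \<open>h k\<close> with \<open>k \<le> n\<close> every inner minimum includes the
  entry \<open>j = k\<close>, with value \<open>u (h k)\<close>, and row \<open>i = k\<close> has
  that value throughout, so the max-min interpolates \<open>u\<close> exactly. Being 1-Lipschitz, it
  differs from \<open>u\<close> at \<open>g\<close> by at most twice the distance to any of these
  points, whence pointwise convergence by density.\<close>

lemma lipschitz_grad_approx:
  assumes lip: "\<And>g h. g \<in> G0 \<Longrightarrow> h \<in> G0 \<Longrightarrow> \<bar>u g - u h\<bar> \<le> dL2 g h"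
  shows "grad_approx u"
proof -
  from dense_sequence obtain h hc :: "nat \<Rightarrow> real \<Rightarrow> real" where ex: "\<forall>i. h i \<in> G0" "\<forall>i. continuous_on UNIV (hc i)"
    "\<forall>i. \<forall>s\<in>{0..<1}. h i s = hc i s" "\<forall>g\<in>G0. \<forall>e>0. \<exists>i. dL2 g (h i) < e"
    by (elim exE conjE)
  note h = ex(1)[rule_format] and hc = ex(2)[rule_format] ex(3)[rule_format] and dense = ex(4)[rule_format]
  have "\<exists>l. grad_approx l \<and> (\<forall>g\<in>G0. \<forall>g'\<in>G0. \<bar>l g - l g'\<bar> \<le> dL2 g g') \<and> l (h i) = u (h i) \<and> l (h j) = u (h j)" for i j
    by (rule affine_interpolation[OF h hc h hc lip[OF h h]])
  then obtain l where l: "\<And>i j. grad_approx (l i j)"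
    "\<And>i j g g'. g \<in> G0 \<Longrightarrow> g' \<in> G0 \<Longrightarrow> \<bar>l i j g - l i j g'\<bar> \<le> dL2 g g'"
    "\<And>i j. l i j (h i) = u (h i)" "\<And>i j. l i j (h j) = u (h j)"
    by metis
  define f where "f n g = Max ((\<lambda>i. Min ((\<lambda>j. l i j g) ` {..n})) ` {..n})" for n g
  have fa: "grad_approx (f n)" for n
    unfolding f_def by (intro grad_approx_Max grad_approx_Min l)
  have f_lip: "\<bar>f n g - f n g'\<bar> \<le> dL2 g g'" if "g \<in> G0" "g' \<in> G0" for n g g'
    unfolding f_def by (intro Max_perturb Min_perturb l(2) that)
  have f_h: "f n (h k) = u (h k)" if k: "k \<le> n" for n k
  proof (rule antisym)
    show "f n (h k) \<le> u (h k)" unfolding f_def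
    proof (rule Max.boundedI)
      fix x assume "x \<in> (\<lambda>i. Min ((\<lambda>j. l i j (h k)) ` {..n})) ` {..n}"
      then obtain i where "x = Min ((\<lambda>j. l i j (h k)) ` {..n})" by blast
      also have "\<dots> \<le> l i k (h k)" by (rule Min_le) (use k in auto)
      finally show "x \<le> u (h k)" by (simp add: l)
    qed auto
    have "u (h k) = Min ((\<lambda>j. l k j (h k)) ` {..n})" by (simp add: l)
    also have "\<dots> \<le> f n (h k)" unfolding f_def by (rule Max_ge) (use k in auto)
    finally show "u (h k) \<le> f n (h k)" .
  qed
  have f_u: "\<bar>f n g - u g\<bar> \<le> 2 * dL2 g (h k)" if "g \<in> G0" "k \<le> n" for n g k
    using f_lip[OF that(1) h[of k], of n] lip[OF that(1) h[of k]] f_h[OF that(2)] by linarith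
  have lim: "(\<lambda>n. f n g) \<longlonglongrightarrow> u g" if g: "g \<in> G0" for g
  proof (rule LIMSEQ_I)
    fix e :: real assume "0 < e"
    then obtain k where k: "dL2 g (h k) < e / 2" using dense[OF g, of "e / 2"] by auto
    have "norm (f n g - u g) < e" if "k \<le> n" for n
      using f_u[OF g that] k unfolding real_norm_def by linarith
    then show "\<exists>no. \<forall>n\<ge>no. norm (f n g - u g) < e" by blast
  qed
  note fm [measurable] = grad_approx_measurable[OF fa]
  \<comment> \<open>Measurability of \<open>u\<close> is a conclusion here, obtained from the
    pointwise limit.\<close>
  have um [measurable]: "u \<in> borel_measurable Q"
    by (rule borel_measurable_LIMSEQ_real[OF _ fm]) (use lim in \<open>auto simp: space_Q\<close>)
  \<comment> \<open>Distances in \<open>G0\<close> are at most 1, so the difference is at most 2 for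
    all \<open>n\<close>.\<close>
  have bound: "(f n g - u g)\<^sup>2 \<le> 4" if "g \<in> G0" for n g
  proof -
    have "\<bar>f n g - u g\<bar> \<le> 2" using f_u[OF that, of 0 n] dL2_le_1[OF that h[of 0]] by simp
    from power_mono[OF this abs_ge_zero, of 2] show ?thesis by simp
  qed
  have "(\<lambda>n. \<integral>g. (f n g - u g)\<^sup>2 \<partial>Q) \<longlonglongrightarrow> (\<integral>g. 0 \<partial>Q)"
  proof (rule integral_dominated_convergence[where w="\<lambda>_. 4"])
    show "AE g in Q. (\<lambda>n. (f n g - u g)\<^sup>2) \<longlonglongrightarrow> 0"
    proof (rule AE_I2)
      fix g assume "g \<in> space Q"
      then have "(\<lambda>n. (f n g - u g)\<^sup>2) \<longlonglongrightarrow> (u g - u g)\<^sup>2"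
        by (intro tendsto_power tendsto_diff tendsto_const lim) (simp add: space_Q)
      then show "(\<lambda>n. (f n g - u g)\<^sup>2) \<longlonglongrightarrow> 0" by simp
    qed
    show "AE g in Q. norm ((f n g - u g)\<^sup>2) \<le> 4" for n
      using bound by (intro AE_I2) (auto simp: space_Q)
  qed auto
  then have L2: "(\<lambda>n. \<integral>g. (f n g - u g)\<^sup>2 \<partial>Q) \<longlonglongrightarrow> 0" by simp
  show ?thesis
  proof (rule grad_approx_limit[OF um])
    fix \<epsilon> :: real assume "\<epsilon> > 0"
    then have "\<forall>\<^sub>F n in sequentially. (\<integral>g. (f n g - u g)\<^sup>2 \<partial>Q) < \<epsilon>" using L2 by (intro order_tendstoD(2)) auto
    then obtain n where n: "(\<integral>g. (f n g - u g)\<^sup>2 \<partial>Q) < \<epsilon>" by (auto simp: eventually_sequentially)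
    have "integrable Q (\<lambda>g. (f n g - u g)\<^sup>2)"
      by (rule Q.integrable_const_bound[where B=4]) (use bound in \<open>auto simp: space_Q intro!: AE_I2\<close>)
    then have "(\<integral>\<^sup>+ g. ennreal ((f n g - u g)\<^sup>2) \<partial>Q) = ennreal (\<integral>g. (f n g - u g)\<^sup>2 \<partial>Q)"
      by (rule nn_integral_eq_integral) simp
    also have "\<dots> \<le> ennreal \<epsilon>" using n by (intro ennreal_leI) simp
    finally show "\<exists>f. grad_approx f \<and> (\<integral>\<^sup>+ g. ennreal ((f g - u g)\<^sup>2) \<partial>Q) \<le> ennreal \<epsilon>" using fa by blast
  qed
qed

section \<open>Uniqueness of the gradient in the closure\<close>

lemma L2_imp_L1_null:
  fixes a :: "nat \<Rightarrow> 'a \<Rightarrow> real"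
  assumes "prob_space M" and [measurable]: "\<And>n. a n \<in> borel_measurable M"
    and L2: "(\<lambda>n. \<integral>\<^sup>+ x. ennreal ((a n x)\<^sup>2) \<partial>M) \<longlonglongrightarrow> 0"
  shows "(\<lambda>n. \<integral>\<^sup>+ x. ennreal \<bar>a n x\<bar> \<partial>M) \<longlonglongrightarrow> 0"
proof -
  interpret prob_space M by fact
  have bound: "(\<integral>\<^sup>+ x. ennreal \<bar>a n x\<bar> \<partial>M) \<le> ennreal \<eta> + ennreal (1 / \<eta>) * (\<integral>\<^sup>+ x. ennreal ((a n x)\<^sup>2) \<partial>M)"
    if \<eta>: "\<eta> > 0" for \<eta> n
  proof -
    have "(\<integral>\<^sup>+ x. ennreal \<bar>a n x\<bar> \<partial>M) \<le> (\<integral>\<^sup>+ x. ennreal \<eta> + ennreal (1 / \<eta>) * ennreal ((a n x)\<^sup>2) \<partial>M)"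
    proof (rule nn_integral_mono)
      fix x
      \<comment> \<open>Either the value is below the threshold \<open>\<eta>\<close>, or it is at
        most its square divided by \<open>\<eta>\<close>. Choosing \<open>\<eta>\<close> small and
        then letting the square term vanish takes the place of Cauchy-Schwarz.\<close>
      have "\<bar>y\<bar> \<le> \<eta> + 1 / \<eta> * y\<^sup>2" for y :: real
      proof (cases "\<bar>y\<bar> \<le> \<eta>")
        case True then show ?thesis using \<eta> by (intro order.trans[OF True]) simp
      next
        case False
        then have "\<eta> * \<bar>y\<bar> \<le> \<bar>y\<bar> * \<bar>y\<bar>" by (intro mult_right_mono) auto
        then have "\<bar>y\<bar> \<le> 1 / \<eta> * y\<^sup>2" using \<eta> by (simp add: field_simps power2_eq_square)
        then show ?thesis using \<eta> by simp
      qed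
      then have "ennreal \<bar>a n x\<bar> \<le> ennreal (\<eta> + 1 / \<eta> * (a n x)\<^sup>2)" by (rule ennreal_leI)
      also have "\<dots> = ennreal \<eta> + ennreal (1 / \<eta>) * ennreal ((a n x)\<^sup>2)"
        using \<eta> by (subst ennreal_mult[symmetric]) (auto intro!: ennreal_plus)
      finally show "ennreal \<bar>a n x\<bar> \<le> ennreal \<eta> + ennreal (1 / \<eta>) * ennreal ((a n x)\<^sup>2)" .
    qed
    also have "\<dots> = ennreal \<eta> + ennreal (1 / \<eta>) * (\<integral>\<^sup>+ x. ennreal ((a n x)\<^sup>2) \<partial>M)"
      by (subst nn_integral_add) (auto simp: nn_integral_cmult emeasure_space_1)
    finally show ?thesis .
  qed
  show ?thesis unfolding order_tendsto_iff
  proof (intro conjI allI impI)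
    fix c :: ennreal assume "0 < c"
    obtain \<eta> where \<eta>: "\<eta> > 0" "ennreal \<eta> < c"
    proof -
      obtain z where z: "0 < z" "z < c" using dense[OF \<open>0 < c\<close>] by blast
      then have "z < top" by (auto simp: less_top[symmetric] top_unique dest: less_trans le_less_trans)
      then have "ennreal (enn2real z) = z" by simp
      moreover from this z have "enn2real z > 0" by (metis ennreal_0 enn2real_nonneg less_le)
      ultimately show ?thesis using that z by metis
    qed
    have "(\<lambda>n. ennreal \<eta> + ennreal (1 / \<eta>) * (\<integral>\<^sup>+ x. ennreal ((a n x)\<^sup>2) \<partial>M)) \<longlonglongrightarrow> ennreal \<eta> + ennreal (1 / \<eta>) * 0"
      by (intro tendsto_add tendsto_const ennreal_tendsto_cmult L2) simp
    then have "\<forall>\<^sub>F n in sequentially. ennreal \<eta> + ennreal (1 / \<eta>) * (\<integral>\<^sup>+ x. ennreal ((a n x)\<^sup>2) \<partial>M) < c"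
      using \<eta> by (intro order_tendstoD(2)) auto
    then show "\<forall>\<^sub>F n in sequentially. (\<integral>\<^sup>+ x. ennreal \<bar>a n x\<bar> \<partial>M) < c"
      by eventually_elim (rule le_less_trans[OF bound[OF \<eta>(1)]])
  qed simp
qed

lemma closure_graphE:
  assumes "(u, G) \<in> closure_graph Q"
  obtains f F where "\<And>n. (f n, F n) \<in> Z1_graph"
    "u \<in> borel_measurable Q" "(\<lambda>x. G (fst x) (snd x)) \<in> borel_measurable QL"
    "(\<lambda>n. \<integral>\<^sup>+ g. ennreal ((f n g - u g)\<^sup>2) \<partial>Q) \<longlonglongrightarrow> 0"
    "(\<lambda>n. \<integral>\<^sup>+ x. ennreal ((F n (fst x) (snd x) - G (fst x) (snd x))\<^sup>2) \<partial>QL) \<longlonglongrightarrow> 0"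
proof -
  have sets: "sets QL = sets (Q \<Otimes>\<^sub>M lborel)" by (intro sets_pair_measure_cong) simp_all
  obtain f F where Z: "\<And>n. (f n, F n) \<in> Z1_graph" and u: "u \<in> borel_measurable Q"
    and G: "(\<lambda>(g, t). G g t) \<in> borel_measurable (Q \<Otimes>\<^sub>M lborel)"
    and l: "(\<lambda>n. \<integral>\<^sup>+ g. ennreal ((f n g - u g)\<^sup>2) \<partial>Q) \<longlonglongrightarrow> 0"
      "(\<lambda>n. \<integral>\<^sup>+ g. (\<integral>\<^sup>+ t. ennreal ((F n g t - G g t)\<^sup>2) * indicator {0..1} t \<partial>lborel) \<partial>Q) \<longlonglongrightarrow> 0"
    using assms unfolding closure_graph_def by blast
  have Gm: "(\<lambda>x. G (fst x) (snd x)) \<in> borel_measurable QL"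
    using G sets by (simp add: case_prod_beta' cong: measurable_cong_sets)
  have "(\<integral>\<^sup>+ g. (\<integral>\<^sup>+ t. ennreal ((F n g t - G g t)\<^sup>2) * indicator {0..1} t \<partial>lborel) \<partial>Q)
    = (\<integral>\<^sup>+ x. ennreal ((F n (fst x) (snd x) - G (fst x) (snd x))\<^sup>2) \<partial>QL)" for n
  proof -
    note Fm = Z1_measurable'[OF Z[of n]]
    have m: "(\<lambda>x. ennreal ((F n (fst x) (snd x) - G (fst x) (snd x))\<^sup>2)) \<in> borel_measurable QL"
      using Fm Gm by measurable
    have "(\<integral>\<^sup>+ t. ennreal ((F n g t - G g t)\<^sup>2) * indicator {0..1} t \<partial>lborel) = (\<integral>\<^sup>+ t. ennreal ((F n g t - G g t)\<^sup>2) \<partial>unit_leb)"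
      if "g \<in> space Q" for g
      using measurable_compose[OF measurable_Pair1'[OF that, of unit_leb] m]
      by (intro nn_integral_unit_leb[symmetric]) simp
    then have "(\<integral>\<^sup>+ g. (\<integral>\<^sup>+ t. ennreal ((F n g t - G g t)\<^sup>2) * indicator {0..1} t \<partial>lborel) \<partial>Q)
      = (\<integral>\<^sup>+ g. \<integral>\<^sup>+ t. ennreal ((F n g t - G g t)\<^sup>2) \<partial>unit_leb \<partial>Q)"
      by (rule nn_integral_cong)
    then show ?thesis using unit_leb.nn_integral_fst[OF m] by simp
  qed
  then have "(\<lambda>n. \<integral>\<^sup>+ x. ennreal ((F n (fst x) (snd x) - G (fst x) (snd x))\<^sup>2) \<partial>QL) \<longlonglongrightarrow> 0"
    using l(2) by simp
  then show ?thesis by (rule that[OF Z u Gm l(1)])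
qed

text \<open>The difference of two approximating sequences consists of cylinder functions that tend
  to 0 and whose gradients tend to \<open>G1 - G2\<close>; closability makes this limit vanish. L2
  convergence supplies the required L1 convergence because both measures are probabilities.\<close>

lemma closure_unique:
  assumes 1: "(u, G1) \<in> closure_graph Q" and 2: "(u, G2) \<in> closure_graph Q"
  shows "AE g in Q. AE s in unit_leb. G1 g s = G2 g s"
proof -
  obtain f1 F1 where Z1: "\<And>n. (f1 n, F1 n) \<in> Z1_graph"
    and um [measurable]: "u \<in> borel_measurable Q" and G1m [measurable]: "(\<lambda>x. G1 (fst x) (snd x)) \<in> borel_measurable QL"
    and l1: "(\<lambda>n. \<integral>\<^sup>+ g. ennreal ((f1 n g - u g)\<^sup>2) \<partial>Q) \<longlonglongrightarrow> 0"
    "(\<lambda>n. \<integral>\<^sup>+ x. ennreal ((F1 n (fst x) (snd x) - G1 (fst x) (snd x))\<^sup>2) \<partial>QL) \<longlonglongrightarrow> 0"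
    by (rule closure_graphE[OF 1]) blast
  obtain f2 F2 where Z2: "\<And>n. (f2 n, F2 n) \<in> Z1_graph"
    and G2m [measurable]: "(\<lambda>x. G2 (fst x) (snd x)) \<in> borel_measurable QL"
    and l2: "(\<lambda>n. \<integral>\<^sup>+ g. ennreal ((f2 n g - u g)\<^sup>2) \<partial>Q) \<longlonglongrightarrow> 0"
    "(\<lambda>n. \<integral>\<^sup>+ x. ennreal ((F2 n (fst x) (snd x) - G2 (fst x) (snd x))\<^sup>2) \<partial>QL) \<longlonglongrightarrow> 0"
    by (rule closure_graphE[OF 2]) blast
  have QLp: "prob_space QL" by (rule prob_space_pair) unfold_locales
  note [measurable] = Z1_measurable(1)[OF Z1] Z1_measurable(1)[OF Z2] Z1_measurable'[OF Z1] Z1_measurable'[OF Z2]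
  define f where "f n g = 1 * f1 n g + (- 1) * f2 n g" for n g
  define F where "F n g t = 1 * F1 n g t + (- 1) * F2 n g t" for n g t
  define H where "H g t = G1 g t - G2 g t" for g t
  have Z: "(f n, F n) \<in> Z1_graph" for n unfolding f_def F_def by (rule Z1_linear[OF Z1 Z2])
  have sum0: "(\<lambda>n. 3 * a n + 3 * b n + ennreal (3 * 0\<^sup>2)) \<longlonglongrightarrow> 0"
    if "a \<longlonglongrightarrow> 0" "b \<longlonglongrightarrow> 0" for a b :: "nat \<Rightarrow> ennreal"
  proof -
    have "(\<lambda>n. 3 * a n + 3 * b n + ennreal (3 * 0\<^sup>2)) \<longlonglongrightarrow> 3 * 0 + 3 * 0 + ennreal (3 * 0\<^sup>2)"
      by (intro tendsto_add tendsto_const ennreal_tendsto_cmult that) simp_all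
    then show ?thesis by simp
  qed
  have "(\<lambda>n. \<integral>\<^sup>+ g. ennreal ((f n g)\<^sup>2) \<partial>Q) \<longlonglongrightarrow> 0"
  proof (rule tendsto_sandwich[OF _ _ tendsto_const sum0[OF l1(1) l2(1)]])
    show "\<forall>\<^sub>F n in sequentially. (\<integral>\<^sup>+ g. ennreal ((f n g)\<^sup>2) \<partial>Q)
      \<le> 3 * (\<integral>\<^sup>+ g. ennreal ((f1 n g - u g)\<^sup>2) \<partial>Q) + 3 * (\<integral>\<^sup>+ g. ennreal ((f2 n g - u g)\<^sup>2) \<partial>Q) + ennreal (3 * 0\<^sup>2)"
      by (intro always_eventually allI nn_integral_le_sum3 Q.prob_space_axioms) (auto simp: f_def)
  qed simp
  then have "(\<lambda>n. \<integral>\<^sup>+ g. ennreal \<bar>f n g\<bar> \<partial>Q) \<longlonglongrightarrow> 0"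
    by (rule L2_imp_L1_null[OF Q.prob_space_axioms, rotated]) (rule Z1_measurable(1)[OF Z])
  moreover have "(\<lambda>n. \<integral>\<^sup>+ g. \<integral>\<^sup>+ s. ennreal \<bar>F n g s - H g s\<bar> \<partial>unit_leb \<partial>Q) \<longlonglongrightarrow> 0"
  proof -
    have m: "(\<lambda>x. F n (fst x) (snd x) - H (fst x) (snd x)) \<in> borel_measurable QL" for n
      unfolding F_def H_def by measurable
    have "(\<lambda>n. \<integral>\<^sup>+ x. ennreal ((F n (fst x) (snd x) - H (fst x) (snd x))\<^sup>2) \<partial>QL) \<longlonglongrightarrow> 0"
    proof (rule tendsto_sandwich[OF _ _ tendsto_const sum0[OF l1(2) l2(2)]])
      show "\<forall>\<^sub>F n in sequentially. (\<integral>\<^sup>+ x. ennreal ((F n (fst x) (snd x) - H (fst x) (snd x))\<^sup>2) \<partial>QL)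
        \<le> 3 * (\<integral>\<^sup>+ x. ennreal ((F1 n (fst x) (snd x) - G1 (fst x) (snd x))\<^sup>2) \<partial>QL)
        + 3 * (\<integral>\<^sup>+ x. ennreal ((F2 n (fst x) (snd x) - G2 (fst x) (snd x))\<^sup>2) \<partial>QL) + ennreal (3 * 0\<^sup>2)"
        by (intro always_eventually allI nn_integral_le_sum3 QLp) (auto simp: F_def H_def)
    qed simp
    then have "(\<lambda>n. \<integral>\<^sup>+ x. ennreal \<bar>F n (fst x) (snd x) - H (fst x) (snd x)\<bar> \<partial>QL) \<longlonglongrightarrow> 0"
      by (rule L2_imp_L1_null[OF QLp, rotated]) (rule m)
    moreover have "(\<integral>\<^sup>+ x. ennreal \<bar>F n (fst x) (snd x) - H (fst x) (snd x)\<bar> \<partial>QL)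
      = (\<integral>\<^sup>+ g. \<integral>\<^sup>+ s. ennreal \<bar>F n g s - H g s\<bar> \<partial>unit_leb \<partial>Q)" for n
    proof -
      have "(\<lambda>x. ennreal \<bar>F n (fst x) (snd x) - H (fst x) (snd x)\<bar>) \<in> borel_measurable QL" using m by measurable
      from unit_leb.nn_integral_fst[OF this] show ?thesis by simp
    qed
    ultimately show ?thesis by simp
  qed
  moreover have "(\<lambda>(g, s). H g s) \<in> borel_measurable QL" unfolding H_def case_prod_beta' by measurable
  ultimately have "AE g in Q. AE s in unit_leb. H g s = 0" by (intro closable[OF Z])
  then show ?thesis by (simp add: H_def)
qed

end

theorem theorem7p9:
  fixes \<beta> :: real and Q :: "(real \<Rightarrow> real) measure" and u :: "(real \<Rightarrow> real) \<Rightarrow> real"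
  assumes "\<beta> > 0"
    and "is_Q0 \<beta> Q"
    and "\<forall>g\<in>G0. \<forall>h\<in>G0. \<bar>u g - u h\<bar> \<le> dL2 g h"
  shows "u \<in> DomE Q \<and>
    (\<forall>G. (u, G) \<in> closure_graph Q \<longrightarrow>
       (AE g in Q. (\<integral>\<^sup>+ t. ennreal ((G g t)\<^sup>2) * indicator {0..1} t \<partial>lborel) \<le> 1))"
proof -
  interpret entropic \<beta> Q using assms(1,2) by unfold_locales
  have "grad_approx u" by (rule lipschitz_grad_approx) (use assms(3) in blast)
  then obtain G1 where G1: "(u, G1) \<in> closure_graph Q" "AE g in Q. (\<integral>\<^sup>+ s. ennreal ((G1 g s)\<^sup>2) \<partial>unit_leb) \<le> 1"
    using grad_approx_closure by blast
  \<comment> \<open>The bound is known for the one gradient built by approximation; uniqueness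
    passes it on to an arbitrary \<open>G\<close> in the closure.\<close>
  have "AE g in Q. (\<integral>\<^sup>+ t. ennreal ((G g t)\<^sup>2) * indicator {0..1} t \<partial>lborel) \<le> 1" if G: "(u, G) \<in> closure_graph Q" for G
    using closure_unique[OF G G1(1)] G1(2) AE_space
  proof eventually_elim
    case (elim g)
    have "(\<lambda>x. G (fst x) (snd x)) \<in> borel_measurable QL" by (rule closure_graphE[OF G])
    from measurable_compose[OF measurable_Pair1'[OF elim(3), of unit_leb] this]
    have [measurable]: "G g \<in> borel_measurable borel" by simp
    have "(\<integral>\<^sup>+ t. ennreal ((G g t)\<^sup>2) * indicator {0..1} t \<partial>lborel) = (\<integral>\<^sup>+ s. ennreal ((G g s)\<^sup>2) \<partial>unit_leb)"
      by (rule nn_integral_unit_leb[symmetric]) measurable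
    also have "\<dots> = (\<integral>\<^sup>+ s. ennreal ((G1 g s)\<^sup>2) \<partial>unit_leb)"
      by (rule nn_integral_cong_AE) (use elim(1) in eventually_elim, simp)
    also have "\<dots> \<le> 1" by (rule elim(2))
    finally show ?case .
  qed
  then show ?thesis using G1(1) unfolding DomE_def by blast
qed

end
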